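(* Let $a,c,d\ge 1$ be integers. For a symmetry class of plane partitions, consider the boundary words of the $U_q(\mathfrak{sl}_4)$-webs (hourglass plabic graphs) that correspond to plane partitions $p$ in the class, restricted to the fundamental domain of the class. These boundary words are as follows, where $(34)$ denotes the two consecutive letters $3\,4$, $(23)$ the two consecutive letters $2\,3$, and $(\overline{31})$ the two consecutive letters $\overline 3\,\overline 1$, each such pair being treated as a single letter when positions are counted, and where $\{\cdots\}$ denotes a multiset from which one builds a subword using every letter with the multiplicity given by its exponent, subject to the restrictions stated. (1) $\mathrm{SPP}(a,a,c)$: $\;1^a\,\overline{4}^{\,c}\,2^a\,\{4^c,(34)^a\}$, where the $c$ letters $4$ and the $a$ letters $(34)$ may be freely ordered. (2) $\mathrm{CSPP}(a,a,a)$: $\;1^a\,\overline{4}^{\,a}\,\{(\overline{31})^m,\overline{1}^{\,a-m}\}\,\{4^{a-m},(34)^m\}$, where the $m$ letters $(\overline{31})$ and the $a-m$ letters $\overline 1$ of the first multiset may be freely ordered, for $0\le m\le a$, and the second subword obeys the rule: with positions numbered $0,1,\dots,a-1$, if $(\overline{31})$ is in position $i$ of the subword given by $\{(\overline{31})^m,\overline1^{\,a-m}\}$, then $(34)$ is in position $a-i-1$ of the subword given by $\{4^{a-m},(34)^m\}$. (3) $\mathrm{TSPP}(a,a,a)$: $\;1^a\,\{(23)^{a-m},2^m\}\,\{4^{a-m},(34)^m\}$, where the $a-m$ letters $(23)$ and the $m$ letters $2$ of the first multiset may be freely ordered, for all $0\le m\le a$, and the second subword satisfies: for all $0\le m\le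 a$ and $0\le i\le a-m-1$, in the part of the subword of $\{(23)^{a-m},2^m\}$ given by the letters in position $a-m$ to position $a-m-i$, the number of $(23)$'s must be less than or equal to the number of $4$'s in the part of the subword of $\{4^{a-m},(34)^m\}$ given by the letters in position $0$ to position $i$. (4) $\mathrm{TSSCPP}(a,a,a)$, $a=2d$: $\;1^d\,\underbrace{2\,\overline4\,2\cdots\overline4\,2}_{2d-1}\,\{4^{d-1},(34)^{d-1}\}\,(34)$, where the subword $w$ constructed from the $d-1$ letters $4$ and the $d-1$ letters $(34)$ must be such that $4\,w\,(34)$ is Yamanouchi in the letters $4$ and $(34)$, i.e. every initial segment of $4\,w\,(34)$ contains at least as many letters $4$ as letters $(34)$.
   Context: **Plane partitions.** A plane partition $p$ in an $a\times b\times c$ box is a set of unit cubes at positions $(i,j,k)$, $1\le i\le a$, $1\le j\le b$, $1\le k\le c$, such that if $(n,m,\ell)\in p$ then $(i,j,k)\in p$ for all $i\le n,j\le m,k\le \ell$. Put $p_{i,j}=\#\{k:(i,j,k)\in p\}$. Classes: $\mathrm{SPP}(a,a,c)$: $p_{i,j}=p_{j,i}$ for all $i,j$. $\mathrm{CSPP}(a,a,a)$: for all $i$ the $i$th row of $(p_{i,j})$ is conjugate (as an integer partition) to the $i$th column. $\mathrm{TSPP}(a,a,a)$: both symmetric and cyclically symmetric. $\mathrm{TSSCPP}(2d,2d,2d)$: totally symmetric and self-complementary, i.e. also $p_{i,j}+p_{a-i+1,b-j+1}=c$ for all $i,j$ (with $a=b=c=2d$). **Web of a plane partition.** Project the box to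 the plane by $e_1\mapsto(\tfrac{\sqrt3}{2},-\tfrac12)$, $e_2\mapsto(-\tfrac{\sqrt3}{2},-\tfrac12)$, $e_3\mapsto(0,1)$. The box becomes a hexagon with sides, clockwise from its top vertex, NE, E, SE, SW, W, NW (lengths $a,c,b,a,c,b$), and the visible faces of $p$ and of the empty box walls give a tiling of the hexagon by unit rhombi (lozenges), each the union of two unit triangles. The web $W$ of $p$ has an interior vertex in each unit triangle, white if the triangle has a vertical side on its left and black if it has a vertical side on its right. Two adjacent triangles are joined by an hourglass edge (weight 2; two strands twisted so as to cross once) if they form a lozenge, and by a simple edge (weight 1) otherwise. For each unit side on the boundary of the hexagon there is a simple edge crossing it, from the adjacent interior vertex to a boundary vertex of the opposite color. Counting hourglass strands separately, every interior vertex has degree 4. The web is drawn in a disk; the base face $F_0$ is the face adjacent to the boundary of the disk at the topmost point, and boundary vertices are read clockwise starting from $F_0$. **Fundamental domains.** Let $O$ be the centre of the hexagon. Restrict $W$ to: for SPP, the right half of the hexagon, cut by the vertical line from the bottom vertex to the top vertex; for CSPP, TSPP, TSSCPP, the sector with apex $O$ swept clockwise from the upward vertical direction through $120^\circ$, $60^\circ$, $30^\circ$, respectively. $F_0$ remains the topmost face and the boundary is read clockwise from $F_0$: first the part of the hexagon boundary, then (if different from the vertical cut) the slanted cut read towards $O$, then the vertical cut read upward. When a cut crosses a simple edge, the edge is cut off at a boundary vertex whose color is opposite to that of its remaining interior endpoint. When a cut crosses an hourglass edge, the hourglass is replaced by two (split) simple edges from the remaining interior endpoint to two consecutive boundary vertices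 of the opposite color; these contribute two consecutive letters $i\,j$ to the boundary word, written $(ij)$. In the TSSCPP case the slanted cut runs along hourglass edges (it passes along the long diagonals of lozenges); these hourglass edges are removed, and their endpoints become boundary vertices (keeping their color), each incident to the one simple edge going into the sector; the endpoint nearest $O$, whose simple edge crosses the vertical cut, is discarded together with that edge. **Trips.** In such a graph, a trip $\mathsf{trip}_t$ ($t=1,2,3$) walks along edges (hourglass strands counted as separate edges, and traversing a strand passes through the crossing): on arriving at a black vertex it leaves along the $t$-th edge to the right (the $t$-th edge counterclockwise from the arrival edge), and on arriving at a white vertex along the $t$-th edge to the left. It starts and ends at boundary vertices. For a simple edge $s$, $\mathsf{trip}_t(s)$ is the $t$-trip that traverses $s$ from its black to its white endpoint. **Boundary word.** For a simple edge $s$ let $F(s)$ be the face to the right of $s$ when travelling from its black to its white endpoint. The separation label is $\mathsf{sep}(s)=1+\#\{t\in\{1,2,3\}:\mathsf{trip}_t(s)\text{ separates }F(s)\text{ from }F_0\}$. The boundary word is the sequence of separation labels of the edges at the boundary vertices, read clockwise from $F_0$, where a label $j$ is written $j$ if the boundary vertex is black and $\overline{j}$ if it is white.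
   Formalization: In (3) the condition "0≤i≤a-m-1, position a-m to position a-m-i" is corrected to "0≤i≤a-2, position a-1 to position a-1-i" (positions from 0); as printed it fails, e.g. for a=3 it excludes the actual boundary word 1 1 1 2 (23) 2 (34) 4 (34). *)

theory Defs
  imports "HOL-Library.Multiset" "HOL-Library.Product_Plus"
begin

section \<open>Plane partitions\<close>

type_synonym pp = "(nat \<times> nat \<times> nat) set"

definition plane_partition :: "nat \<Rightarrow> nat \<Rightarrow> nat \<Rightarrow> pp \<Rightarrow> bool" where
  "plane_partition a b c p \<longleftrightarrow>
     p \<subseteq> {1..a} \<times> {1..b} \<times> {1..c} \<and>
     (\<forall>n m l i j k. (n, m, l) \<in> p \<and> 1 \<le> i \<and> i \<le> n \<and> 1 \<le> j \<and> j \<le> m \<and> 1 \<le> k \<and> k \<le> l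
        \<longrightarrow> (i, j, k) \<in> p)"

definition height :: "pp \<Rightarrow> nat \<Rightarrow> nat \<Rightarrow> nat" where
  "height p i j = card {k. (i, j, k) \<in> p}"

text \<open>The conjugate of the integer partition with parts l 1, ..., l n (zero parts allowed):
  its k-th part (for k at least 1) is the number of parts of l that are at least k.\<close>

definition conjugate_parts :: "nat \<Rightarrow> (nat \<Rightarrow> nat) \<Rightarrow> nat \<Rightarrow> nat" where
  "conjugate_parts n l k = card {j \<in> {1..n}. k \<le> l j}"

definition SPP :: "nat \<Rightarrow> nat \<Rightarrow> pp set" where
  "SPP a c = {p. plane_partition a a c p \<and> (\<forall>i\<in>{1..a}. \<forall>j\<in>{1..a}. height p i j = height p j i)}"

definition CSPP :: "nat \<Rightarrow> pp set" where
  "CSPP a = {p. plane_partition a a a p \<and>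
     (\<forall>i\<in>{1..a}. \<forall>k\<in>{1..a}. height p k i = conjugate_parts a (\<lambda>j. height p i j) k)}"

definition TSPP :: "nat \<Rightarrow> pp set" where
  "TSPP a = SPP a a \<inter> CSPP a"

definition TSSCPP :: "nat \<Rightarrow> pp set" where
  "TSSCPP a = {p \<in> TSPP a.
     \<forall>i\<in>{1..a}. \<forall>j\<in>{1..a}. height p i j + height p (a - i + 1) (a - j + 1) = a}"


section \<open>Hourglass plabic graphs, trips and boundary words\<close>

text \<open>
  A bipartite graph in a disk, given by its combinatorial embedding. An edge of weight m consists
  of m strands. The rotation at an interior vertex lists the incident edges counterclockwise.
  The faces on the right and on the left of an edge refer to travelling from its black to its
  white end; the small regions between the strands of an hourglass are not counted as faces.
  The boundary lists the edges at the boundary vertices clockwise from the base face, where the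
  edges obtained by splitting one hourglass are grouped together. Each boundary vertex has
  exactly one edge.
\<close>

record ('v, 'e, 'f) hourglass_graph =
  interior :: "'v set"
  edges :: "'e set"
  weight :: "'e \<Rightarrow> nat"
  black_end :: "'e \<Rightarrow> 'v"
  white_end :: "'e \<Rightarrow> 'v"
  rotation :: "'v \<Rightarrow> 'e list"
  right_face :: "'e \<Rightarrow> 'f"
  left_face :: "'e \<Rightarrow> 'f"
  base_face :: "'f"
  boundary :: "'e list list"

text \<open>Strand i of an hourglass is its i-th strand counterclockwise at both of its ends; for two
  strands this means that they cross once.\<close>

definition strands_at :: "('v, 'e, 'f) hourglass_graph \<Rightarrow> 'v \<Rightarrow> ('e \<times> nat) list" where
  "strands_at G v = concat (map (\<lambda>e. map (Pair e) [0..<weight G e]) (rotation G v))"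

definition nth_ccw :: "'s list \<Rightarrow> nat \<Rightarrow> 's \<Rightarrow> 's \<Rightarrow> bool" where
  "nth_ccw xs t x y \<longleftrightarrow> (\<exists>i<length xs. xs ! i = x \<and> xs ! ((i + t) mod length xs) = y)"

datatype heading = To_White | To_Black

type_synonym 'e dart = "('e \<times> nat) \<times> heading"

definition trip_step :: "('v, 'e, 'f) hourglass_graph \<Rightarrow> nat \<Rightarrow> ('e dart \<times> 'e dart) set" where
  "trip_step G t =
     {((s, To_Black), (s', To_White)) | s s'. black_end G (fst s) \<in> interior G \<and>
        nth_ccw (strands_at G (black_end G (fst s))) t s s'} \<union>
     {((s, To_White), (s', To_Black)) | s s'. white_end G (fst s) \<in> interior G \<and>
        nth_ccw (strands_at G (white_end G (fst s))) t s' s}"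

text \<open>The t-trip through a given dart, followed forwards and backwards.\<close>

definition trip :: "('v, 'e, 'f) hourglass_graph \<Rightarrow> nat \<Rightarrow> 'e dart \<Rightarrow> 'e dart set" where
  "trip G t x = {y. (x, y) \<in> (trip_step G t)\<^sup>* \<or> (y, x) \<in> (trip_step G t)\<^sup>*}"

text \<open>Two faces lie in the same component of the disk minus a trip iff one can pass from one to
  the other by crossing edges none of whose strands belong to the trip.\<close>

definition separates :: "('v, 'e, 'f) hourglass_graph \<Rightarrow> 'e dart set \<Rightarrow> 'f \<Rightarrow> 'f \<Rightarrow> bool" where
  "separates G T f g \<longleftrightarrow>
     (f, g) \<notin> (\<Union>e \<in> edges G - (fst \<circ> fst) ` T.
                {(right_face G e, left_face G e), (left_face G e, right_face G e)})\<^sup>*"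

definition sep_label :: "('v, 'e, 'f) hourglass_graph \<Rightarrow> 'e \<Rightarrow> nat" where
  "sep_label G e = 1 + card {t \<in> {1, 2, 3}.
     separates G (trip G t ((e, 0), To_White)) (right_face G e) (base_face G)}"

datatype letter = Plain nat | Barred nat

definition boundary_letter :: "('v, 'e, 'f) hourglass_graph \<Rightarrow> 'e \<Rightarrow> letter" where
  "boundary_letter G e =
     (if black_end G e \<in> interior G then Barred (sep_label G e) else Plain (sep_label G e))"

text \<open>A word is a list of blocks: a one-letter block is a letter of the word, and a two-letter
  block is a pair (i j) coming from a split hourglass. Concatenating the blocks yields the
  sequence of labels.\<close>

definition boundary_word :: "('v, 'e, 'f) hourglass_graph \<Rightarrow> letter list list" where
  "boundary_word G = map (map (boundary_letter G)) (boundary G)"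


section \<open>The triangular lattice\<close>

text \<open>Points of the plane are given in units of (sqrt 3)/2 horizontally and 1/2 vertically.\<close>

type_synonym point = "int \<times> int"

definition proj :: "int \<times> int \<times> int \<Rightarrow> point" where
  "proj = (\<lambda>(x, y, z). (x - y, 2 * z - x - y))"

datatype axis = E1 | E2 | E3

fun vec :: "axis \<Rightarrow> point" where
  "vec E1 = proj (1, 0, 0)"
| "vec E2 = proj (0, 1, 0)"
| "vec E3 = proj (0, 0, 1)"

text \<open>The vertical side of both White A and Black A is the segment from A to A + vec E3.\<close>

datatype triangle = White point | Black point

fun corners :: "triangle \<Rightarrow> point set" where
  "corners (White A) = {A, A + vec E3, A + vec E3 + vec E1}"
| "corners (Black A) = {A, A + vec E3, A + vec E3 + vec E2}"

text \<open>The pair (x, A) stands for the unit side from A to A + vec x. It has a white triangle on one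
  side and a black one on the other; crossing it from black to white, A is on the right.\<close>

type_synonym side = "axis \<times> point"

fun white_tri :: "side \<Rightarrow> triangle" where
  "white_tri (E1, A) = White (A - vec E3)"
| "white_tri (E2, A) = White (A + vec E2)"
| "white_tri (E3, A) = White A"

fun black_tri :: "side \<Rightarrow> triangle" where
  "black_tri (E1, A) = Black (A + vec E1)"
| "black_tri (E2, A) = Black (A - vec E3)"
| "black_tri (E3, A) = Black A"

text \<open>The sides of a triangle in counterclockwise order.\<close>

fun sides_ccw :: "triangle \<Rightarrow> side list" where
  "sides_ccw (White A) = [(E1, A + vec E3), (E3, A), (E2, A - vec E2)]"
| "sides_ccw (Black A) = [(E3, A), (E2, A + vec E3), (E1, A - vec E1)]"


section \<open>Webs of plane partitions\<close>

definition hexagon :: "nat \<Rightarrow> nat \<Rightarrow> nat \<Rightarrow> point set" where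
  "hexagon a b c = proj ` ({0..int a} \<times> {0..int b} \<times> {0..int c})"

text \<open>The visible unit faces of p and of the walls, each given by the projections of its four
  corners. There is one face over each of the unit squares of the three walls.\<close>

definition lozenges :: "nat \<Rightarrow> nat \<Rightarrow> nat \<Rightarrow> pp \<Rightarrow> point set set" where
  "lozenges a b c p =
     (\<lambda>(i, j). proj ` ({int i - 1, int i} \<times> {int j - 1, int j} \<times> {int (card {k. (i, j, k) \<in> p})}))
        ` ({1..a} \<times> {1..b}) \<union>
     (\<lambda>(i, k). proj ` ({int i - 1, int i} \<times> {int (card {j. (i, j, k) \<in> p})} \<times> {int k - 1, int k}))
        ` ({1..a} \<times> {1..c}) \<union>
     (\<lambda>(j, k). proj ` ({int (card {i. (i, j, k) \<in> p})} \<times> {int j - 1, int j} \<times> {int k - 1, int k}))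
        ` ({1..b} \<times> {1..c})"

definition hourglass_at :: "point set set \<Rightarrow> side \<Rightarrow> bool" where
  "hourglass_at L s \<longleftrightarrow> corners (white_tri s) \<union> corners (black_tri s) \<in> L"

text \<open>Every edge of a web crosses a unit side. An hourglass cut by the boundary of the domain is
  replaced by Split s 0 and Split s 1, numbered clockwise along the boundary. There is one face
  around each lattice point, and a further one between the two edges of a split hourglass.\<close>

datatype edge = Edge side | Split side nat

datatype vertex = Inner triangle | Outer edge

datatype face = Around point | Between side

fun side_of :: "edge \<Rightarrow> side" where
  "side_of (Edge s) = s"
| "side_of (Split s k) = s"

definition edges_across :: "point set set \<Rightarrow> triangle set \<Rightarrow> side \<Rightarrow> edge list" where
  "edges_across L D s =
     (if hourglass_at L s \<and> (white_tri s \<in> D \<longleftrightarrow> black_tri s \<notin> D)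
      then [Split s 0, Split s 1] else [Edge s])"

fun web_weight :: "point set set \<Rightarrow> edge \<Rightarrow> nat" where
  "web_weight L (Edge s) = (if hourglass_at L s then 2 else 1)"
| "web_weight L (Split s k) = 1"

definition web_end :: "triangle set \<Rightarrow> edge \<Rightarrow> triangle \<Rightarrow> vertex" where
  "web_end D e t = (if t \<in> D then Inner t else Outer e)"

fun web_rotation :: "point set set \<Rightarrow> triangle set \<Rightarrow> vertex \<Rightarrow> edge list" where
  "web_rotation L D (Inner t) = concat (map (\<lambda>s. rev (edges_across L D s)) (sides_ccw t))"
| "web_rotation L D (Outer e) = [e]"

fun web_right_face :: "triangle set \<Rightarrow> edge \<Rightarrow> face" where
  "web_right_face D (Edge (x, A)) = Around A"
| "web_right_face D (Split (x, A) k) =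
     (if k = 0 \<longleftrightarrow> white_tri (x, A) \<in> D then Around A else Between (x, A))"

fun web_left_face :: "triangle set \<Rightarrow> edge \<Rightarrow> face" where
  "web_left_face D (Edge (x, A)) = Around (A + vec x)"
| "web_left_face D (Split (x, A) k) =
     (if k = 0 \<longleftrightarrow> white_tri (x, A) \<in> D then Between (x, A) else Around (A + vec x))"

text \<open>The restriction to a set D of triangles of the web of a plane partition with lozenges L. If
  D consists of all the triangles of the hexagon, this is the web itself. The edges with an end in
  D are kept; an end outside D becomes a boundary vertex of the same colour. The boundary is
  given by the unit sides between D and its complement, clockwise from the point P around which
  the base face lies.\<close>

definition web :: "point set set \<Rightarrow> triangle set \<Rightarrow> point \<Rightarrow> side list
    \<Rightarrow> (vertex, edge, face) hourglass_graph" where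
  "web L D P ss =
     \<lparr> interior = Inner ` D,
       edges = (\<Union>s \<in> {s. white_tri s \<in> D \<or> black_tri s \<in> D}. set (edges_across L D s)),
       weight = web_weight L,
       black_end = (\<lambda>e. web_end D e (black_tri (side_of e))),
       white_end = (\<lambda>e. web_end D e (white_tri (side_of e))),
       rotation = web_rotation L D,
       right_face = web_right_face D,
       left_face = web_left_face D,
       base_face = Around P,
       boundary = map (edges_across L D) ss \<rparr>"


section \<open>Fundamental domains\<close>

definition triangles_in :: "point set \<Rightarrow> triangle set" where
  "triangles_in S = {t. corners t \<subseteq> S}"

datatype step = Fwd axis | Bwd axis

fun path_sides :: "point \<Rightarrow> step list \<Rightarrow> side list" where
  "path_sides A [] = []"
| "path_sides A (Fwd x # ss) = (x, A) # path_sides (A + vec x) ss"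
| "path_sides A (Bwd x # ss) = (x, A - vec x) # path_sides (A - vec x) ss"

definition restricted_web :: "nat \<Rightarrow> nat \<Rightarrow> nat \<Rightarrow> point set \<Rightarrow> step list \<Rightarrow> pp
    \<Rightarrow> (vertex, edge, face) hourglass_graph" where
  "restricted_web a b c S ss p =
     (let P = proj (0, 0, int c)
      in web (lozenges a b c p) (triangles_in (hexagon a b c \<inter> S)) P (path_sides P ss))"

text \<open>The top vertex of the hexagon is proj (0, 0, c). The vertical line through it has first
  coordinate 0, and for a = b = c the centre of the hexagon is the origin. The sectors below are
  bounded by this line and by the ray from the origin in the direction of vec E1 (120 degrees),
  - vec E2 (60 degrees) and vec E3 - vec E2 (30 degrees).\<close>

definition SPP_web :: "nat \<Rightarrow> nat \<Rightarrow> pp \<Rightarrow> (vertex, edge, face) hourglass_graph" where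
  "SPP_web a c = restricted_web a a c {(X, Y). 0 \<le> X}
     (replicate a (Fwd E1) @ replicate c (Bwd E3) @ replicate a (Fwd E2) @
      replicate (a + c) (Fwd E3))"

definition CSPP_web :: "nat \<Rightarrow> pp \<Rightarrow> (vertex, edge, face) hourglass_graph" where
  "CSPP_web a = restricted_web a a a {(X, Y). 0 \<le> X \<and> - X \<le> Y}
     (replicate a (Fwd E1) @ replicate a (Bwd E3) @ replicate a (Bwd E1) @ replicate a (Fwd E3))"

definition TSPP_web :: "nat \<Rightarrow> pp \<Rightarrow> (vertex, edge, face) hourglass_graph" where
  "TSPP_web a = restricted_web a a a {(X, Y). 0 \<le> X \<and> X \<le> Y}
     (replicate a (Fwd E1) @ replicate a (Fwd E2) @ replicate a (Fwd E3))"

text \<open>Here the slanted cut bisects triangles, paired up into lozenges. These triangles are not in the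
  domain, so their hourglass edges disappear, and they serve as boundary vertices. The zigzag in the
  path crosses their edges into the sector, except for the one next to the centre. Its edge
  would cross the side from the origin to vec E3, and has no end in the domain.\<close>

definition TSSCPP_web :: "nat \<Rightarrow> pp \<Rightarrow> (vertex, edge, face) hourglass_graph" where
  "TSSCPP_web d = restricted_web (2 * d) (2 * d) (2 * d) {(X, Y). 0 \<le> X \<and> 3 * X \<le> Y}
     (replicate d (Fwd E1) @ Fwd E2 # concat (replicate (d - 1) [Bwd E3, Fwd E2]) @
      replicate (2 * d - 1) (Fwd E3))"


section \<open>Words\<close>

definition yamanouchi :: "'b \<Rightarrow> 'b \<Rightarrow> 'b list \<Rightarrow> bool" where
  "yamanouchi x y w \<longleftrightarrow> (\<forall>n \<le> length w. count_list (take n w) y \<le> count_list (take n w) x)"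

definition SPP_words :: "nat \<Rightarrow> nat \<Rightarrow> letter list list set" where
  "SPP_words a c =
     {replicate a [Plain 1] @ replicate c [Barred 4] @ replicate a [Plain 2] @ w | w.
        mset w = replicate_mset c [Plain 4] + replicate_mset a [Plain 3, Plain 4]}"

definition CSPP_words :: "nat \<Rightarrow> letter list list set" where
  "CSPP_words a =
     {replicate a [Plain 1] @ replicate a [Barred 4] @ u @ v | u v m.
        m \<le> a \<and>
        mset u = replicate_mset m [Barred 3, Barred 1] + replicate_mset (a - m) [Barred 1] \<and>
        mset v = replicate_mset (a - m) [Plain 4] + replicate_mset m [Plain 3, Plain 4] \<and>
        (\<forall>i<a. u ! i = [Barred 3, Barred 1] \<longrightarrow> v ! (a - i - 1) = [Plain 3, Plain 4])}"

text \<open>In the last condition, positions are numbered from 0, and the letters of u in positions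
  a - 1, a - 2, ..., a - 1 - i (the i + 1 letters closest to the centre of the hexagon) are
  compared with the letters of v in positions 0, ..., i. For i = a - 1 both counts equal a - m.\<close>

definition TSPP_words :: "nat \<Rightarrow> letter list list set" where
  "TSPP_words a =
     {replicate a [Plain 1] @ u @ v | u v m.
        m \<le> a \<and>
        mset u = replicate_mset (a - m) [Plain 2, Plain 3] + replicate_mset m [Plain 2] \<and>
        mset v = replicate_mset (a - m) [Plain 4] + replicate_mset m [Plain 3, Plain 4] \<and>
        (\<forall>i<a - 1. card {j \<in> {a - 1 - i..a - 1}. u ! j = [Plain 2, Plain 3]}
                  \<le> card {j \<in> {0..i}. v ! j = [Plain 4]})}"

definition TSSCPP_words :: "nat \<Rightarrow> letter list list set" where
  "TSSCPP_words d =
     {replicate d [Plain 1] @ map (\<lambda>i. if even i then [Plain 2] else [Barred 4]) [0..<2 * d - 1] @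
      w @ [[Plain 3, Plain 4]] | w.
        mset w = replicate_mset (d - 1) [Plain 4] + replicate_mset (d - 1) [Plain 3, Plain 4] \<and>
        yamanouchi [Plain 4] [Plain 3, Plain 4] ([Plain 4] # w @ [[Plain 3, Plain 4]])}"

end

theory Submission
  imports Defs
begin

text \<open>
  The proof has two halves: the labels of the boundary edges are computed from the hourglasses that
  are cut by the boundary of the domain, and then the possible positions of these hourglasses
  are determined.

  For the labels, the key observation is that the trips of a web of lozenges are level sets. A
  1-trip runs in the strip between two neighbouring parallel lattice lines, whatever the lozenges
  are, and so does a 3-trip, in the opposite direction. A 2-trip separates the lattice points over
  which some coordinate of the surface of the plane partition is at most i from those over which
  it is greater: it is a level curve of that coordinate. So each trip comes from an integer
  function on the lattice points that changes by at most 1 along a side (locale \<open>family\<close>). The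
  boundaries of all four domains, read clockwise, only turn clockwise, up to the zigzag of the
  last one. Therefore each of these functions first moves in one direction along the boundary and
  then in the other one, and a level set enters the domain at most once. It follows that it
  consists of a single trip and that it cuts the disk into two parts only. So whether it separates
  the right face of a boundary edge from the base face depends only on the colour of the boundary
  vertex and on which of the two monotone stretches the edge lies on (\<open>trip_separates_iff\<close>). The
  only other trips bounce: they enter by one half of a split hourglass and leave at once by the
  other half (\<open>separates_split\<close>). As a result, the letters at a side depend only on its direction
  and on whether it cuts an hourglass (\<open>boundary_word_web\<close>): the directions \<open>E1\<close>, \<open>- E3\<close>,
  \<open>E2\<close>, \<open>- E1\<close>, \<open>E3\<close> give 1, barred 4, 2, barred 1 and 4, and cut hourglasses change the last
  three of these to (23), barred (31) and (34).

  For the positions, lift the lattice to the surface of the plane partition. The point of the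
  surface over (0, 2 t) on the vertical line is (n, n, n + t) for some n = n(t), and the point
  over (k, k), on the ray at 60 degrees from it, is (r + k, r, r + k) for some r = r(k). An
  hourglass crosses the side from t to t + 1 of the vertical line iff n drops there, and it crosses
  the side from k to k + 1 of the ray iff r does not drop there. Both functions drop by 0 or 1 in
  every step and are 0 at the border, and n(0) = r(0). This gives the multisets of letters. For
  CSPP, rotation carries the vertical cut to the slanted one, so the second subword determines the
  first. For TSPP, the condition on the two subwords says r \<open>\<le>\<close> n, which holds since a plane
  partition is an order ideal. For TSSCPP, complementation gives n(k) + r(k) = 2 d - k, so that the
  Yamanouchi condition again says r \<open>\<le>\<close> n.

  Conversely, a word prescribes n, and for TSPP and TSSCPP also r. For SPP, a partition is written
  down directly. In a cube, if r \<open>\<le>\<close> n, the totally symmetric order ideal generated by all the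
  points (n, n, n + t) and (r + k, r, r + k) has exactly these heights (locale \<open>cube_profile\<close>); for
  CSPP any such r will do. If moreover n(k) + r(k) = 2 d - k, this ideal contains no two
  complementary points, and it is made self-complementary by deciding the remaining pairs of
  complementary points by their coordinate sums (\<open>completed\<close>).
\<close>

section \<open>Trips along a threshold of the faces\<close>

text \<open>The faces on the two sides of a boundary edge in the clockwise order of the boundary; the end
  of the edge inside the domain is on the right of somebody who walks clockwise.\<close>

definition before_face :: "('v, 'e, 'f) hourglass_graph \<Rightarrow> 'e \<Rightarrow> 'f" where
  "before_face G e = (if black_end G e \<in> interior G then left_face G e else right_face G e)"

definition after_face :: "('v, 'e, 'f) hourglass_graph \<Rightarrow> 'e \<Rightarrow> 'f" where
  "after_face G e = (if black_end G e \<in> interior G then right_face G e else left_face G e)"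

fun face_chain :: "('v, 'e, 'f) hourglass_graph \<Rightarrow> 'f \<Rightarrow> 'e list \<Rightarrow> 'f \<Rightarrow> bool" where
  "face_chain G F [] F' \<longleftrightarrow> F = F'"
| "face_chain G F (e # es) F' \<longleftrightarrow> before_face G e = F \<and> face_chain G (after_face G e) es F'"

lemma face_chain_append:
  "face_chain G F (es @ es') F' \<longleftrightarrow> (\<exists>F''. face_chain G F es F'' \<and> face_chain G F'' es' F')"
  by (induction es arbitrary: F) auto

lemma face_chain_mono:
  assumes "face_chain G F es F'" and "\<forall>e\<in>set es. \<theta> (before_face G e) \<longrightarrow> \<theta> (after_face G e)" and "\<theta> F"
  shows "\<theta> F'"
  using assms by (induction es arbitrary: F) auto

fun right_of :: "('v, 'e, 'f) hourglass_graph \<Rightarrow> 'e dart \<Rightarrow> 'f" where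
  "right_of G (s, To_White) = right_face G (fst s)"
| "right_of G (s, To_Black) = left_face G (fst s)"

fun left_of :: "('v, 'e, 'f) hourglass_graph \<Rightarrow> 'e dart \<Rightarrow> 'f" where
  "left_of G (s, To_White) = left_face G (fst s)"
| "left_of G (s, To_Black) = right_face G (fst s)"

fun tail :: "('v, 'e, 'f) hourglass_graph \<Rightarrow> 'e dart \<Rightarrow> 'v" where
  "tail G (s, To_White) = black_end G (fst s)"
| "tail G (s, To_Black) = white_end G (fst s)"

abbreviation dart_edge :: "'e dart \<Rightarrow> 'e" where
  "dart_edge \<delta> \<equiv> fst (fst \<delta>)"

text \<open>Going backwards along a set of darts that is closed under steps, the measure decreases until
  the only dart without predecessor is reached. So all of the darts lie on one trip.\<close>

lemma trip_eq:
  fixes \<mu> :: "'e dart \<Rightarrow> int"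
  assumes fin: "finite \<Delta>"
    and closed: "\<And>x y. (x, y) \<in> trip_step G t \<Longrightarrow> x \<in> \<Delta> \<longleftrightarrow> y \<in> \<Delta>"
    and sv: "\<And>x y z. x \<in> \<Delta> \<Longrightarrow> (x, y) \<in> trip_step G t \<Longrightarrow> (x, z) \<in> trip_step G t \<Longrightarrow> y = z"
    and prev: "\<And>x. x \<in> \<Delta> \<Longrightarrow> x \<noteq> x0 \<Longrightarrow> \<exists>y. (y, x) \<in> trip_step G t \<and> \<mu> y < \<mu> x"
    and x: "x \<in> \<Delta>"
  shows "trip G t x = \<Delta>"
proof -
  let ?R = "(trip_step G t)\<^sup>*"
  have reach: "(x0, y) \<in> ?R" if "y \<in> \<Delta>" for y
    using that
  proof (induction "nat (\<mu> y - Min (\<mu> ` \<Delta>))" arbitrary: y rule: less_induct)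
    case less
    show ?case
    proof (cases "y = x0")
      case False
      then obtain z where z: "(z, y) \<in> trip_step G t" "\<mu> z < \<mu> y" using prev less.prems by blast
      then have "z \<in> \<Delta>" using closed less.prems by blast
      moreover have "Min (\<mu> ` \<Delta>) \<le> \<mu> z" using fin calculation by simp
      ultimately have "(x0, z) \<in> ?R" using less.hyps[of z] z(2) by linarith
      then show ?thesis using z(1) by simp
    qed simp
  qed
  have fwd: "y \<in> \<Delta>" if "(w, y) \<in> ?R" "w \<in> \<Delta>" for w y
    using that by (induction) (use closed in blast)+
  have bwd: "w \<in> \<Delta>" if "(w, y) \<in> ?R" "y \<in> \<Delta>" for w y
    using that by (induction) (use closed in blast)+
  have comparable: "(y, z) \<in> ?R \<or> (z, y) \<in> ?R" if "(w, y) \<in> ?R" "(w, z) \<in> ?R" "w \<in> \<Delta>" for w y z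
    using that
  proof (induction)
    case base
    then show ?case by simp
  next
    case (step u v)
    then have u: "u \<in> \<Delta>" using fwd by blast
    from step consider "(u, z) \<in> ?R" | "(z, u) \<in> ?R" by blast
    then show ?case
    proof cases
      case 1
      then show ?thesis
      proof (cases rule: converse_rtranclE)
        case base
        then show ?thesis using step by auto
      next
        case (step v')
        then show ?thesis using sv[OF u] \<open>(u, v) \<in> trip_step G t\<close> by blast
      qed
    next
      case 2
      then show ?thesis using step by (meson rtrancl.rtrancl_into_rtrancl)
    qed
  qed
  have "x0 \<in> \<Delta>" using bwd[OF reach[OF x] x] .
  show ?thesis
  proof
    show "trip G t x \<subseteq> \<Delta>" unfolding trip_def using fwd bwd x by blast
    show "\<Delta> \<subseteq> trip G t x"
      unfolding trip_def using comparable reach x \<open>x0 \<in> \<Delta>\<close> by blast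
  qed
qed

definition rises :: "('v, 'e, 'f) hourglass_graph \<Rightarrow> ('f \<Rightarrow> bool) \<Rightarrow> 'e \<Rightarrow> bool" where
  "rises G \<theta> e \<longleftrightarrow> \<not> \<theta> (before_face G e) \<and> \<theta> (after_face G e)"

definition falls :: "('v, 'e, 'f) hourglass_graph \<Rightarrow> ('f \<Rightarrow> bool) \<Rightarrow> 'e \<Rightarrow> bool" where
  "falls G \<theta> e \<longleftrightarrow> \<theta> (before_face G e) \<and> \<not> \<theta> (after_face G e)"

lemma rise_unique_if_no_fall:
  assumes "face_chain G F es F'" and "\<forall>e\<in>set es. \<not> falls G \<theta> e"
    and "rises G \<theta> e" "rises G \<theta> e'" "e \<in> set es" "e' \<in> set es"
  shows "e = e'"
proof (rule ccontr)
  assume ne: "e \<noteq> e'"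
  have no: "False" if ss: "es = as @ u # bs" "u' \<in> set bs" "rises G \<theta> u" "rises G \<theta> u'" for as u bs u'
  proof -
    from ss(2) obtain cs ds where "bs = cs @ u' # ds" using split_list by metis
    then have "face_chain G (after_face G u) cs (before_face G u')"
      using assms(1) ss(1) by (auto simp: face_chain_append)
    then have "\<theta> (before_face G u')"
      using face_chain_mono[of G "after_face G u" cs "before_face G u'" \<theta>] assms(2) ss \<open>bs = cs @ u' # ds\<close>
      by (auto simp: rises_def falls_def)
    then show False using ss(4) by (simp add: rises_def)
  qed
  obtain as bs where es: "es = as @ e # bs" using assms(5) split_list by metis
  then consider "e' \<in> set bs" | "e' \<in> set as" using ne assms(6) by auto
  then show False
  proof cases
    case 1
    then show ?thesis using no es assms by blast
  next
    case 2
    then obtain cs ds where "as = cs @ e' # ds" using split_list by metis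
    then show ?thesis using no[of cs e' "ds @ e # bs" e] es assms by auto
  qed
qed

text \<open>A predicate that becomes true on the first stretch of a closed walk and false on the second one,
  or vice versa, becomes true only once.\<close>

lemma rise_unique:
  assumes chain: "face_chain G F (es @ es') F'"
    and uni: "(\<forall>e\<in>set es. \<not> falls G \<theta> e) \<and> (\<forall>e\<in>set es'. \<not> rises G \<theta> e) \<or>
      (\<forall>e\<in>set es. \<not> rises G \<theta> e) \<and> (\<forall>e\<in>set es'. \<not> falls G \<theta> e)"
    and "rises G \<theta> e" "rises G \<theta> e'" "e \<in> set (es @ es')" "e' \<in> set (es @ es')"
  shows "e = e'"
  using chain uni assms(3-) rise_unique_if_no_fall[of G _ _ _ \<theta> e e'] unfolding face_chain_append
  by (metis Un_iff set_append)

lemma face_chain_not_separates: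
  assumes "face_chain G F es F'" and "\<forall>e\<in>set es. e \<in> edges G - dart_edge ` T"
  shows "\<not> separates G T F F' \<and> \<not> separates G T F' F"
proof -
  let ?R = "\<Union>e \<in> edges G - (fst \<circ> fst) ` T. {(right_face G e, left_face G e), (left_face G e, right_face G e)}"
  have "(F, F') \<in> ?R\<^sup>*" using assms
  proof (induction es arbitrary: F)
    case (Cons e es)
    then have "(before_face G e, after_face G e) \<in> ?R"
      by (auto simp: before_face_def after_face_def)
    moreover have "(after_face G e, F') \<in> ?R\<^sup>*" using Cons by auto
    ultimately show ?case using Cons.prems by (metis (no_types, lifting) converse_rtrancl_into_rtrancl face_chain.simps(2))
  qed simp
  moreover have "sym ?R" by (auto simp: sym_def)
  ultimately show ?thesis unfolding separates_def by (metis (no_types, lifting) sym_rtrancl symD)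
qed

lemma separates_if_threshold:
  assumes "\<And>e. e \<in> edges G \<Longrightarrow> e \<notin> dart_edge ` T \<Longrightarrow> \<theta> (right_face G e) \<longleftrightarrow> \<theta> (left_face G e)"
    and "\<theta> F \<noteq> \<theta> F'"
  shows "separates G T F F'"
proof (rule ccontr)
  assume "\<not> separates G T F F'"
  then have "(F, F') \<in> (\<Union>e \<in> edges G - (fst \<circ> fst) ` T.
     {(right_face G e, left_face G e), (left_face G e, right_face G e)})\<^sup>*"
    by (simp add: separates_def)
  then have "\<theta> F = \<theta> F'"
    by (induction) (use assms(1) in \<open>auto simp: image_iff\<close>)
  then show False using assms(2) by simp
qed

text \<open>Let \<open>\<Delta>\<close> be a set of darts that have the threshold \<open>\<theta>\<close> false on the right and true on the left,
  and that meets every edge at which \<open>\<theta>\<close> changes. Trips enter the graph where \<open>\<theta>\<close> rises along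
  the boundary. If \<open>\<theta>\<close> rises on one part of the boundary and falls on the other one, there is one
  entry, so \<open>\<Delta>\<close> is a trip. Its two sides are the sets of \<open>\<theta>\<close>: faces with the same value of \<open>\<theta>\<close>
  at the boundary are connected along it, as the threshold is crossed only once on each part. Hence
  only the part of the boundary on which an edge lies matters.\<close>

lemma trip_separates_iff:
  fixes \<mu> :: "'e dart \<Rightarrow> int" and \<theta> :: "'f \<Rightarrow> bool"
  assumes fin: "finite \<Delta>"
    and closed: "\<And>x y. (x, y) \<in> trip_step G t \<Longrightarrow> x \<in> \<Delta> \<longleftrightarrow> y \<in> \<Delta>"
    and sv: "\<And>x y z. x \<in> \<Delta> \<Longrightarrow> (x, y) \<in> trip_step G t \<Longrightarrow> (x, z) \<in> trip_step G t \<Longrightarrow> y = z"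
    and prev: "\<And>x. x \<in> \<Delta> \<Longrightarrow> tail G x \<in> interior G \<Longrightarrow> \<exists>y. (y, x) \<in> trip_step G t \<and> \<mu> y < \<mu> x"
    and side: "\<And>x. x \<in> \<Delta> \<Longrightarrow> \<not> \<theta> (right_of G x) \<and> \<theta> (left_of G x)"
    and cover: "\<And>e. e \<in> edges G \<Longrightarrow> \<theta> (right_face G e) \<noteq> \<theta> (left_face G e) \<Longrightarrow> e \<in> dart_edge ` \<Delta>"
    and uniq: "\<And>x y. x \<in> \<Delta> \<Longrightarrow> y \<in> \<Delta> \<Longrightarrow> dart_edge x = dart_edge y \<Longrightarrow> x = y"
    and chain: "face_chain G (base_face G) (es @ es') (base_face G)"
    and dist: "distinct (es @ es')"
    and bdry: "\<And>e. e \<in> set (es @ es') \<Longrightarrow> e \<in> edges G \<and> (black_end G e \<in> interior G \<longleftrightarrow> white_end G e \<notin> interior G)"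
    and entry: "\<And>x. x \<in> \<Delta> \<Longrightarrow> tail G x \<notin> interior G \<Longrightarrow> dart_edge x \<in> set (es @ es')"
    and uni: "(\<forall>e\<in>set es. \<not> falls G \<theta> e) \<and> (\<forall>e\<in>set es'. \<not> rises G \<theta> e) \<or>
      (\<forall>e\<in>set es. \<not> rises G \<theta> e) \<and> (\<forall>e\<in>set es'. \<not> falls G \<theta> e)"
    and x: "x \<in> \<Delta>" "dart_edge x = e" "e \<in> set (es @ es')"
  shows "separates G (trip G t x) (right_face G e) (base_face G) \<longleftrightarrow>
    (black_end G e \<in> interior G \<longleftrightarrow> e \<in> set es)"
proof -
  have entry_rises: "rises G \<theta> (dart_edge y)" if "y \<in> \<Delta>" "tail G y \<notin> interior G" for y
    using side[OF that(1)] that bdry[OF entry[OF that]]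
    by (cases "(G, y)" rule: tail.cases) (auto simp: rises_def before_face_def after_face_def)
  have "\<exists>x0. \<forall>y\<in>\<Delta>. y \<noteq> x0 \<longrightarrow> tail G y \<in> interior G"
    using rise_unique[OF chain uni] entry_rises entry uniq by metis
  then obtain x0 where "\<forall>y\<in>\<Delta>. y \<noteq> x0 \<longrightarrow> tail G y \<in> interior G" ..
  then have trip: "trip G t x = \<Delta>"
    by (intro trip_eq[where ?x0.0 = x0 and \<mu> = \<mu>]) (use fin closed sv prev x in blast)+
  have cross: "f \<in> dart_edge ` \<Delta> \<longleftrightarrow> rises G \<theta> f \<or> falls G \<theta> f" if f: "f \<in> edges G" for f
  proof
    assume "f \<in> dart_edge ` \<Delta>"
    then obtain y where y: "y \<in> \<Delta>" "f = dart_edge y" by blast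
    show "rises G \<theta> f \<or> falls G \<theta> f" using side[OF y(1)] y(2)
      by (cases "(G, y)" rule: tail.cases) (auto simp: rises_def falls_def before_face_def after_face_def)
  next
    assume "rises G \<theta> f \<or> falls G \<theta> f"
    then show "f \<in> dart_edge ` \<Delta>" using cover[OF f]
      by (auto simp: rises_def falls_def before_face_def after_face_def split: if_splits)
  qed
  have e: "rises G \<theta> e \<or> falls G \<theta> e" using cross[of e] x bdry by auto
  have sepI: "separates G \<Delta> F F'" if "\<theta> F \<noteq> \<theta> F'" for F F'
    using separates_if_threshold[of G \<Delta> \<theta>] cover that by blast
  \<comment> \<open>On a stretch between two faces on the same side of the threshold all edges are off the trip,
    so the stretch connects the two faces.\<close>
  have flat: "\<not> (rises G \<theta> f \<or> falls G \<theta> f)"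
    if "face_chain G F fs F'" "\<theta> F = \<theta> F'" "f \<in> set fs"
      "(\<forall>f\<in>set fs. \<not> falls G \<theta> f) \<or> (\<forall>f\<in>set fs. \<not> rises G \<theta> f)" for F fs F' f
  proof -
    from that(3) obtain gs hs where fs: "fs = gs @ f # hs" using split_list by metis
    then have ch: "face_chain G F gs (before_face G f)" "face_chain G (after_face G f) hs F'"
      using that(1) by (auto simp: face_chain_append)
    show ?thesis
      using that(4)
    proof
      assume "\<forall>f\<in>set fs. \<not> falls G \<theta> f"
      then show ?thesis
        using face_chain_mono[OF ch(1), of \<theta>] face_chain_mono[OF ch(2), of \<theta>] that(2) fs
        by (auto simp: rises_def falls_def)
    next
      assume "\<forall>f\<in>set fs. \<not> rises G \<theta> f"
      then show ?thesis
        using face_chain_mono[OF ch(1), of "\<lambda>F. \<not> \<theta> F"] face_chain_mono[OF ch(2), of "\<lambda>F. \<not> \<theta> F"] that(2) fs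
        by (auto simp: rises_def falls_def)
    qed
  qed
  have conn: "\<not> separates G \<Delta> F F' \<and> \<not> separates G \<Delta> F' F"
    if "face_chain G F fs F'" "\<theta> F = \<theta> F'" "set fs \<subseteq> set (es @ es')"
      "(\<forall>f\<in>set fs. \<not> falls G \<theta> f) \<or> (\<forall>f\<in>set fs. \<not> rises G \<theta> f)" for F fs F'
    using face_chain_not_separates[OF that(1), of \<Delta>] flat[OF that(1,2) _ that(4)] cross bdry that(3)
    by blast
  show ?thesis
  proof (cases "e \<in> set es")
    case True
    then obtain as bs where es: "es = as @ e # bs" using split_list by metis
    have ch: "face_chain G (base_face G) as (before_face G e)"
      using chain es by (auto simp: face_chain_append)
    have mono: "(\<forall>f\<in>set es. \<not> falls G \<theta> f) \<or> (\<forall>f\<in>set es. \<not> rises G \<theta> f)" using uni by blast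
    have eq: "\<theta> (base_face G) = \<theta> (before_face G e)"
      using mono
    proof
      assume "\<forall>f\<in>set es. \<not> falls G \<theta> f"
      then show ?thesis using face_chain_mono[OF ch, of \<theta>] e es by (auto simp: rises_def falls_def)
    next
      assume "\<forall>f\<in>set es. \<not> rises G \<theta> f"
      then show ?thesis using face_chain_mono[OF ch, of "\<lambda>F. \<not> \<theta> F"] e es by (auto simp: rises_def falls_def)
    qed
    have "\<not> separates G \<Delta> (before_face G e) (base_face G)"
      using conn[OF ch eq] mono es by auto
    moreover have "separates G \<Delta> (after_face G e) (base_face G)"
      using sepI e eq by (auto simp: rises_def falls_def)
    ultimately show ?thesis using True by (auto simp: trip before_face_def after_face_def split: if_splits)
  next
    case False
    then have "e \<in> set es'" using x by simp
    then obtain as bs where es: "es' = as @ e # bs" using split_list by metis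
    have ch: "face_chain G (after_face G e) bs (base_face G)"
      using chain es by (auto simp: face_chain_append)
    have mono: "(\<forall>f\<in>set es'. \<not> falls G \<theta> f) \<or> (\<forall>f\<in>set es'. \<not> rises G \<theta> f)" using uni by blast
    have eq: "\<theta> (after_face G e) = \<theta> (base_face G)"
      using mono
    proof
      assume "\<forall>f\<in>set es'. \<not> falls G \<theta> f"
      then show ?thesis using face_chain_mono[OF ch, of \<theta>] e es by (auto simp: rises_def falls_def)
    next
      assume "\<forall>f\<in>set es'. \<not> rises G \<theta> f"
      then show ?thesis using face_chain_mono[OF ch, of "\<lambda>F. \<not> \<theta> F"] e es by (auto simp: rises_def falls_def)
    qed
    have "\<not> separates G \<Delta> (after_face G e) (base_face G)"
      using conn[OF ch eq] mono es by auto
    moreover have "separates G \<Delta> (before_face G e) (base_face G)"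
      using sepI e eq by (auto simp: rises_def falls_def)
    ultimately show ?thesis using False by (auto simp: trip before_face_def after_face_def split: if_splits)
  qed
qed

section \<open>Triangles and their sides\<close>

text \<open>Counterclockwise around a triangle of either colour, the side of axis x is followed by the one
  of axis \<open>nxt x\<close>.\<close>

fun nxt :: "axis \<Rightarrow> axis" where
  "nxt E3 = E2" | "nxt E2 = E1" | "nxt E1 = E3"

fun prv :: "axis \<Rightarrow> axis" where
  "prv E3 = E1" | "prv E2 = E3" | "prv E1 = E2"

fun side_at :: "triangle \<Rightarrow> axis \<Rightarrow> side" where
  "side_at (White A) E1 = (E1, A + vec E3)"
| "side_at (White A) E2 = (E2, A - vec E2)"
| "side_at (White A) E3 = (E3, A)"
| "side_at (Black A) E1 = (E1, A - vec E1)"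
| "side_at (Black A) E2 = (E2, A + vec E3)"
| "side_at (Black A) E3 = (E3, A)"

fun is_white :: "triangle \<Rightarrow> bool" where
  "is_white (White A) = True" | "is_white (Black A) = False"

definition diff :: "(point \<Rightarrow> int) \<Rightarrow> side \<Rightarrow> int" where
  "diff f s = f (snd s + vec (fst s)) - f (snd s)"

definition low :: "(point \<Rightarrow> int) \<Rightarrow> side \<Rightarrow> int" where
  "low f s = min (f (snd s + vec (fst s))) (f (snd s))"

lemma vec_eq: "vec E1 = (1, -1)" "vec E2 = (-1, -1)" "vec E3 = (0, 2)"
  by (simp_all add: proj_def)

(* The coordinates of vec are the normal form from here on; proj is for points of space only. *)
declare vec.simps [simp del] vec_eq [simp]

lemma UNIV_axis: "(\<forall>x. Q x) \<longleftrightarrow> Q E1 \<and> Q E2 \<and> Q E3"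
  by (metis axis.exhaust)

lemma Ex_axis: "(\<exists>x. Q x) \<longleftrightarrow> Q E1 \<or> Q E2 \<or> Q E3"
  by (metis axis.exhaust)

lemma axis_cyclic [simp]: "nxt x \<noteq> x" "prv x \<noteq> x" "x \<noteq> nxt x" "x \<noteq> prv x" "nxt x \<noteq> prv x" "prv x \<noteq> nxt x"
  "nxt (nxt x) = prv x" "prv (prv x) = nxt x" "nxt (prv x) = x" "prv (nxt x) = x"
  by (cases x; simp)+

lemma axis_cases3: "x = y \<or> x = nxt y \<or> x = prv y"
  by (cases x; cases y) auto

lemma fst_side_at [simp]: "fst (side_at \<tau> x) = x"
  by (cases "(\<tau>, x)" rule: side_at.cases) auto

lemma side_at_eq_iff [simp]: "side_at \<tau> x = side_at \<tau> y \<longleftrightarrow> x = y"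
  by (metis fst_side_at)

lemma white_tri_side_at [simp]: "white_tri (side_at (White A) x) = White A"
  by (cases x) auto

lemma black_tri_side_at [simp]: "black_tri (side_at (Black A) x) = Black A"
  by (cases x) auto

lemma white_tri_exh: "\<exists>A. white_tri s = White A"
  by (cases s rule: white_tri.cases) auto

lemma black_tri_exh: "\<exists>A. black_tri s = Black A"
  by (cases s rule: black_tri.cases) auto

lemma side_at_white_tri [simp]: "side_at (white_tri s) (fst s) = s"
  by (cases s rule: white_tri.cases) auto

lemma side_at_black_tri [simp]: "side_at (black_tri s) (fst s) = s"
  by (cases s rule: black_tri.cases) auto

lemma sum_diff_triangle: "diff f (side_at \<tau> E1) + diff f (side_at \<tau> E2) + diff f (side_at \<tau> E3) = 0"
  by (cases \<tau>) (auto simp: diff_def algebra_simps)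

text \<open>Around a triangle a function returns to its value, so a unit step up and a unit step down
  cross the same level.\<close>

lemma low_triangle:
  assumes "\<And>x. \<bar>diff f (side_at \<tau> x)\<bar> \<le> 1" and "diff f (side_at \<tau> x) = 1" "diff f (side_at \<tau> x') = -1"
  shows "low f (side_at \<tau> x) = low f (side_at \<tau> x')"
  using assms(1)[of E1] assms(1)[of E2] assms(1)[of E3] assms(2,3)
  by (cases \<tau>; cases x; cases x') (auto simp: diff_def low_def algebra_simps)

lemma mod_add_cancel:
  fixes k k' t m :: nat
  assumes "(k + t) mod m = (k' + t) mod m" "k < m" "k' < m"
  shows "k = k'"
proof -
  have "int m dvd (int k + int t) - (int k' + int t)"
    using assms(1) by (metis mod_eq_dvd_iff of_nat_add zmod_int)
  then have "int k mod int m = int k' mod int m" by (simp add: mod_eq_dvd_iff)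
  then show ?thesis using assms(2,3) by simp
qed

lemma nth_ccw_rotate: "nth_ccw (rotate r xs) t x y \<longleftrightarrow> nth_ccw xs t x y"
proof -
  have imp: "nth_ccw xs t x y" if "nth_ccw (rotate r xs) t x y" for r and xs :: "'a list"
  proof -
    from that obtain i where i: "i < length xs" "rotate r xs ! i = x" "rotate r xs ! ((i + t) mod length xs) = y"
      by (auto simp: nth_ccw_def)
    let ?j = "(r + i) mod length xs"
    have pos: "0 < length xs" using i(1) by linarith
    have "xs ! ?j = x" "?j < length xs" using i pos by (auto simp: nth_rotate)
    moreover have "xs ! ((?j + t) mod length xs) = y"
      using i pos by (simp add: nth_rotate mod_simps add.assoc)
    ultimately show ?thesis unfolding nth_ccw_def by blast
  qed
  have "rotate (length xs - r mod length xs) (rotate r xs) = xs"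
  proof (cases "xs = []")
    case False
    then have "length xs - r mod length xs + r mod length xs = length xs"
      by (simp add: mod_le_divisor)
    then have "(length xs - r mod length xs + r) mod length xs = 0"
      by (metis mod_add_right_eq mod_self)
    then show ?thesis
      using rotate_conv_mod[of "length xs - r mod length xs + r" xs] by (simp add: rotate_rotate)
  qed simp
  then show ?thesis using imp[of r xs] imp[of "length xs - r mod length xs" "rotate r xs"] by auto
qed

section \<open>Webs whose boundary turns clockwise\<close>

text \<open>A side with its white triangle inside is traversed from A to A + \<open>vec x\<close> when the boundary is read
  clockwise, and backwards otherwise. The rank orders the directions as they occur in clockwise
  turns, starting from \<open>vec E1\<close>. The directions \<open>- vec E3\<close> and \<open>vec E2\<close> share a rank since they
  alternate in a zigzag.\<close>

fun turning_rank :: "triangle set \<Rightarrow> side \<Rightarrow> nat" where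
  "turning_rank D s = (if white_tri s \<in> D then (case fst s of E1 \<Rightarrow> 0 | E2 \<Rightarrow> 1 | E3 \<Rightarrow> 3)
     else (case fst s of E1 \<Rightarrow> 2 | E2 \<Rightarrow> 1 | E3 \<Rightarrow> 1))"
declare turning_rank.simps [simp del]

definition first_end :: "triangle set \<Rightarrow> side \<Rightarrow> point" where
  "first_end D s = (if white_tri s \<in> D then snd s else snd s + vec (fst s))"

definition last_end :: "triangle set \<Rightarrow> side \<Rightarrow> point" where
  "last_end D s = (if white_tri s \<in> D then snd s + vec (fst s) else snd s)"

fun side_chain :: "triangle set \<Rightarrow> point \<Rightarrow> side list \<Rightarrow> point \<Rightarrow> bool" where
  "side_chain D A [] B \<longleftrightarrow> A = B"
| "side_chain D A (s # ss) B \<longleftrightarrow> first_end D s = A \<and> side_chain D (last_end D s) ss B"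

text \<open>The properties of the four domains on which the computation of the labels depends. The value
  \<open>lft w A\<close> stands for the coordinate of axis w of a surface point over A. Along a side of axis x
  this point moves by the unit vector of axis x if the side is an edge of the surface, and by
  that vector minus (1, 1, 1) if the side is the short diagonal of a lozenge. By the last two
  assumptions the boundary never runs in the direction \<open>- vec E2\<close>, and it bisects no lozenge
  where it runs in the direction \<open>vec E1\<close> or \<open>- vec E3\<close>.\<close>

locale web_domain =
  fixes L :: "point set set" and D :: "triangle set" and P :: point and bd :: "side list"
    and lft :: "axis \<Rightarrow> point \<Rightarrow> int"
  assumes finite_D: "finite D"
    and lft_step: "\<And>\<tau> x w. \<tau> \<in> D \<Longrightarrow>
      diff (lft w) (side_at \<tau> x) = of_bool (x = w) - of_bool (hourglass_at L (side_at \<tau> x))"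
    and distinct_bd: "distinct bd"
    and bd_iff: "\<And>s. s \<in> set bd \<longleftrightarrow> (white_tri s \<in> D \<longleftrightarrow> black_tri s \<notin> D)"
    and closed_bd: "side_chain D P bd P"
    and sorted_bd: "sorted (map (turning_rank D) bd)"
    and no_E2: "\<And>s. s \<in> set bd \<Longrightarrow> fst s = E2 \<Longrightarrow> white_tri s \<in> D"
    and no_hg: "\<And>s. s \<in> set bd \<Longrightarrow> hourglass_at L s \<Longrightarrow>
      (fst s = E1 \<longrightarrow> white_tri s \<notin> D) \<and> (fst s = E3 \<longrightarrow> white_tri s \<in> D)"
begin

abbreviation hg :: "side \<Rightarrow> bool" where "hg \<equiv> hourglass_at L"
abbreviation G where "G \<equiv> web L D P bd"
abbreviation across :: "side \<Rightarrow> edge list" where "across \<equiv> edges_across L D"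

definition touches :: "side \<Rightarrow> bool" where
  "touches s \<longleftrightarrow> white_tri s \<in> D \<or> black_tri s \<in> D"

lemma interior_web: "interior G = Inner ` D"
  and black_end_web: "black_end G e = web_end D e (black_tri (side_of e))"
  and white_end_web: "white_end G e = web_end D e (white_tri (side_of e))"
  by (simp_all add: web_def)

text \<open>The k-th strand across a side in counterclockwise order as seen from a vertex of the web. The
  halves of a split hourglass are numbered clockwise along the boundary, which is clockwise also
  as seen from the vertex inside, so their numbers are reversed.\<close>

definition \<sigma> :: "side \<Rightarrow> nat \<Rightarrow> edge \<times> nat" where
  "\<sigma> s k = (if hg s \<and> s \<in> set bd then (Split s (1 - k), 0) else (Edge s, k))"

lemma across_eq: "across s = (if hg s \<and> s \<in> set bd then [Split s 0, Split s 1] else [Edge s])"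
  by (auto simp: edges_across_def bd_iff)

lemma \<sigma>_inject: "k \<le> 1 \<Longrightarrow> k' \<le> 1 \<Longrightarrow> \<sigma> s k = \<sigma> s' k' \<longleftrightarrow> s = s' \<and> k = k'"
  by (auto simp: \<sigma>_def)

lemma side_of_\<sigma> [simp]: "side_of (fst (\<sigma> s k)) = s"
  by (simp add: \<sigma>_def)

text \<open>The changes of the coordinate \<open>lft E1\<close> around a triangle add up to 0 on the one hand, and to 1
  minus the number of hourglasses at the triangle on the other hand.\<close>

lemma ex1_hourglass:
  assumes "\<tau> \<in> D"
  shows "\<exists>!y. hg (side_at \<tau> y)"
  using sum_diff_triangle[of "lft E1" \<tau>] lft_step[OF assms, of E1]
  by (auto simp: Ex1_def UNIV_axis Ex_axis of_bool_def split: if_splits)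

text \<open>The counterclockwise sequence of the four strands at a triangle with hourglass on the side of
  axis y, up to rotation. Starting with the hourglass treats all triangles alike.\<close>

definition around :: "triangle \<Rightarrow> axis \<Rightarrow> (edge \<times> nat) list" where
  "around \<tau> y = [\<sigma> (side_at \<tau> y) 0, \<sigma> (side_at \<tau> y) 1, \<sigma> (side_at \<tau> (nxt y)) 0, \<sigma> (side_at \<tau> (prv y)) 0]"

lemma distinct_around: "distinct (around \<tau> y)"
  by (auto simp: around_def \<sigma>_inject)

lemma strands_across:
  "concat (map (\<lambda>e. map (Pair e) [0..<web_weight L e]) (rev (across s))) =
    (if hg s then [\<sigma> s 0, \<sigma> s 1] else [\<sigma> s 0])"
  by (auto simp: across_eq \<sigma>_def numeral_2_eq_2)

lemma concat_map_concat: "concat (map f (concat xss)) = concat (map (\<lambda>xs. concat (map f xs)) xss)"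
  by (induction xss) auto

lemma strands_at_triangle:
  assumes "\<tau> \<in> D" "hg (side_at \<tau> y)"
  shows "\<exists>r. strands_at G (Inner \<tau>) = rotate r (around \<tau> y)"
proof -
  have no: "\<not> hg (side_at \<tau> (nxt y))" "\<not> hg (side_at \<tau> (prv y))"
    using ex1_hourglass[OF assms(1)] assms(2) axis_cyclic by metis+
  have "strands_at G (Inner \<tau>) = concat (map (\<lambda>s. if hg s then [\<sigma> s 0, \<sigma> s 1] else [\<sigma> s 0]) (sides_ccw \<tau>))"
    unfolding strands_at_def by (simp add: web_def concat_map_concat strands_across o_def)
  also have "\<exists>r\<in>{0, 2, 3}. \<dots> = rotate r (around \<tau> y)"
  proof -
    have rot: "rotate 2 [p, q, u, v] = [u, v, p, q]" "rotate 3 [p, q, u, v] = [v, p, q, u]"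
      for p q u v :: "edge \<times> nat"
      by (simp_all add: numeral_eq_Suc)
    show ?thesis using assms(2) no by (cases \<tau>; cases y) (simp_all add: around_def rot)
  qed
  finally show ?thesis by blast
qed

lemma ccw_at_triangle:
  assumes "\<tau> \<in> D" "hg (side_at \<tau> y)"
  shows "nth_ccw (strands_at G (Inner \<tau>)) t s s' \<longleftrightarrow>
    (\<exists>i<4. s = around \<tau> y ! i \<and> s' = around \<tau> y ! ((i + t) mod 4))"
proof -
  have len: "length (around \<tau> y) = 4" by (simp add: around_def)
  obtain r where "strands_at G (Inner \<tau>) = rotate r (around \<tau> y)" using strands_at_triangle[OF assms] ..
  then have "nth_ccw (strands_at G (Inner \<tau>)) t s s' \<longleftrightarrow> nth_ccw (around \<tau> y) t s s'"
    by (simp add: nth_ccw_rotate)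
  then show ?thesis by (auto simp: nth_ccw_def len)
qed

lemma step_at_black:
  assumes "\<tau> \<in> D" "hg (side_at \<tau> y)" "black_tri (side_of (fst s)) = \<tau>" "k < 4"
    "s = around \<tau> y ! k" "s' = around \<tau> y ! ((k + t) mod 4)"
  shows "((s, To_Black), (s', To_White)) \<in> trip_step G t"
proof -
  have v: "black_end G (fst s) = Inner \<tau>" using assms(1,3) by (simp add: black_end_web web_end_def)
  have "black_end G (fst s) \<in> interior G" using assms(1) by (simp add: v interior_web)
  moreover have "nth_ccw (strands_at G (black_end G (fst s))) t s s'"
    unfolding v ccw_at_triangle[OF assms(1,2)] using assms(4-6) by blast
  ultimately show ?thesis unfolding trip_step_def by blast
qed

lemma step_at_white:
  assumes "\<tau> \<in> D" "hg (side_at \<tau> y)" "white_tri (side_of (fst s)) = \<tau>" "k < 4"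
    "s' = around \<tau> y ! k" "s = around \<tau> y ! ((k + t) mod 4)"
  shows "((s, To_White), (s', To_Black)) \<in> trip_step G t"
proof -
  have v: "white_end G (fst s) = Inner \<tau>" using assms(1,3) by (simp add: white_end_web web_end_def)
  have "white_end G (fst s) \<in> interior G" using assms(1) by (simp add: v interior_web)
  moreover have "nth_ccw (strands_at G (white_end G (fst s))) t s' s"
    unfolding v ccw_at_triangle[OF assms(1,2)] using assms(4-6) by blast
  ultimately show ?thesis unfolding trip_step_def by blast
qed

lemma step_cases:
  assumes "(a, b) \<in> trip_step G t"
  obtains \<tau> y k where "\<tau> \<in> D" "hg (side_at \<tau> y)" "k < 4" "is_white \<tau>"
      "a = (around \<tau> y ! ((k + t) mod 4), To_White)" "b = (around \<tau> y ! k, To_Black)"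
      "\<tau> = white_tri (side_of (dart_edge a))"
  | \<tau> y k where "\<tau> \<in> D" "hg (side_at \<tau> y)" "k < 4" "\<not> is_white \<tau>"
      "a = (around \<tau> y ! k, To_Black)" "b = (around \<tau> y ! ((k + t) mod 4), To_White)"
      "\<tau> = black_tri (side_of (dart_edge a))"
proof -
  consider (bl) s s' where "a = (s, To_Black)" "b = (s', To_White)" "black_tri (side_of (fst s)) \<in> D"
        "nth_ccw (strands_at G (Inner (black_tri (side_of (fst s))))) t s s'"
      | (wh) s s' where "a = (s, To_White)" "b = (s', To_Black)" "white_tri (side_of (fst s)) \<in> D"
        "nth_ccw (strands_at G (Inner (white_tri (side_of (fst s))))) t s' s"
    using assms by (auto simp: trip_step_def web_def web_end_def split: if_splits)
  then show thesis
  proof cases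
    case bl
    let ?\<tau> = "black_tri (side_of (fst s))"
    obtain y where y: "hg (side_at ?\<tau> y)" using ex1_hourglass[OF bl(3)] by blast
    obtain A where "?\<tau> = Black A" using black_tri_exh by blast
    then show ?thesis using bl ccw_at_triangle[OF bl(3) y] that(2)[OF bl(3) y] by auto
  next
    case wh
    let ?\<tau> = "white_tri (side_of (fst s))"
    obtain y where y: "hg (side_at ?\<tau> y)" using ex1_hourglass[OF wh(3)] by blast
    obtain A where "?\<tau> = White A" using white_tri_exh by blast
    then show ?thesis using wh ccw_at_triangle[OF wh(3) y] that(1)[OF wh(3) y] by auto
  qed
qed

lemma step_unique:
  assumes "(a, b) \<in> trip_step G t" "(a, b') \<in> trip_step G t"
  shows "b = b'"
proof -
  have inj: "k = k'" if "around \<tau> y ! k = around \<tau> y ! k'" "k < 4" "k' < 4" for \<tau> y and k k' :: nat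
    using that nth_eq_iff_index_eq[OF distinct_around, of k \<tau> y k'] by (simp add: around_def)
  have hg1: "y = y'" if "\<tau> \<in> D" "hg (side_at \<tau> y)" "hg (side_at \<tau> y')" for \<tau> y y'
    using ex1_hourglass[OF that(1)] that(2,3) by metis
  show ?thesis
    using assms(1)
  proof (cases rule: step_cases)
    case (1 \<tau> y k)
    note a = this
    show ?thesis using assms(2)
    proof (cases rule: step_cases)
      case (1 \<tau>' y' k')
      have [simp]: "\<tau>' = \<tau>" using 1(7) a(7) by (rule trans[OF _ sym])
      have [simp]: "y' = y" using hg1[OF a(1), of y' y] 1(2) a(2) by simp
      have "around \<tau> y ! ((k + t) mod 4) = around \<tau> y ! ((k' + t) mod 4)"
        using trans[OF a(5)[symmetric] 1(5)] by simp
      then have "(k + t) mod 4 = (k' + t) mod 4" using inj[of \<tau> y "(k + t) mod 4" "(k' + t) mod 4"] by simp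
      then have "k = k'" by (rule mod_add_cancel[OF _ a(3) 1(3)])
      then show ?thesis using a(6) 1(6) by simp
    next
      case (2 \<tau>' y' k')
      show ?thesis using trans[OF a(5)[symmetric] 2(5)] by simp
    qed
  next
    case (2 \<tau> y k)
    note a = this
    show ?thesis using assms(2)
    proof (cases rule: step_cases)
      case (1 \<tau>' y' k')
      show ?thesis using trans[OF a(5)[symmetric] 1(5)] by simp
    next
      case (2 \<tau>' y' k')
      have [simp]: "\<tau>' = \<tau>" using 2(7) a(7) by (rule trans[OF _ sym])
      have [simp]: "y' = y" using hg1[OF a(1), of y' y] 2(2) a(2) by simp
      have "around \<tau> y ! k = around \<tau> y ! k'"
        using trans[OF a(5)[symmetric] 2(5)] by simp
      then have "k = k'" by (rule inj[OF _ a(3) 2(3)])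
      then show ?thesis using a(6) 2(6) by simp
    qed
  qed
qed

section \<open>Trips along the levels of a function\<close>

text \<open>A family of trips that belongs to the axis w passes through a triangle by two of its three
  sides. At an hourglass it has to use one of two strands: the second one if the side has the
  axis \<open>nxt w\<close>, and the first one otherwise. This is the position of the strand in use on
  the side of axis x in the list \<open>around\<close> of a triangle with hourglass on the side of axis y.\<close>

definition slot :: "axis \<Rightarrow> axis \<Rightarrow> axis \<Rightarrow> nat" where
  "slot w y x = (if x = y then (if y = nxt w then 1 else 0) else if x = nxt y then 2 else 3)"

definition strand :: "axis \<Rightarrow> side \<Rightarrow> edge \<times> nat" where
  "strand w s = \<sigma> s (if hg s \<and> fst s = nxt w then 1 else 0)"

definition turn :: "(point \<Rightarrow> int) \<Rightarrow> side \<Rightarrow> int" where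
  "turn f s = f (last_end D s) - f (first_end D s)"

lemma strand_edge_inject: "fst (strand w s) = fst (strand w s') \<Longrightarrow> s = s'"
  by (metis side_of_\<sigma> strand_def)

lemma slot_less: "slot w y x < 4"
  by (simp add: slot_def)

lemma around_slot:
  assumes "\<tau> \<in> D" "hg (side_at \<tau> y)"
  shows "around \<tau> y ! slot w y x = strand w (side_at \<tau> x)"
proof -
  have "hg (side_at \<tau> x) \<longleftrightarrow> x = y" using ex1_hourglass[OF assms(1)] assms(2) by blast
  then show ?thesis using axis_cases3[of x y] by (auto simp: around_def slot_def strand_def)
qed

lemma around_strand:
  assumes "\<tau> \<in> D" "hg (side_at \<tau> y)" "i < 4" "around \<tau> y ! i = strand w s"
  shows "\<exists>x. s = side_at \<tau> x \<and> i = slot w y x"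
proof -
  have "\<exists>x k. around \<tau> y ! i = \<sigma> (side_at \<tau> x) k \<and> k \<le> 1"
    using assms(3)
    by (auto simp: around_def numeral_eq_Suc less_Suc_eq)
      (metis le0 order_refl One_nat_def)+
  then obtain x where "s = side_at \<tau> x"
    using assms(4) by (auto simp: strand_def \<sigma>_inject split: if_splits)
  moreover have "i = slot w y x"
    using assms(3,4) around_slot[OF assms(1,2), of w x] slot_less[of w y x] calculation
      nth_eq_iff_index_eq[OF distinct_around, of i \<tau> y "slot w y x"]
    by (simp add: around_def)
  ultimately show ?thesis by blast
qed

end

text \<open>An integer function f on the lattice whose levels are t-trips. If f goes up across one side of
  a triangle and down across another, the strands in use on these sides are t positions apart, in
  the order that makes the t-trip enter by one of them and leave by the other; and \<open>\<mu>\<close> increases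
  from the entry to the exit. The family does not cross hourglasses on sides of axis w. Along the
  boundary, \<open>sg * f\<close> increases weakly on the sides of rank below c and decreases weakly on the
  others.\<close>

locale family = web_domain +
  fixes f :: "point \<Rightarrow> int" and w :: axis and t :: nat and \<mu> :: "side \<Rightarrow> int"
    and sg :: int and c :: nat
  assumes diff_le: "\<And>\<tau> x. \<tau> \<in> D \<Longrightarrow> \<bar>diff f (side_at \<tau> x)\<bar> \<le> 1"
    and diff_hg: "\<And>\<tau>. \<tau> \<in> D \<Longrightarrow> hg (side_at \<tau> w) \<Longrightarrow> diff f (side_at \<tau> w) = 0"
    and turns: "\<And>\<tau> x x' y. \<tau> \<in> D \<Longrightarrow> hg (side_at \<tau> y) \<Longrightarrow> diff f (side_at \<tau> x) = 1 \<Longrightarrow>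
      diff f (side_at \<tau> x') = -1 \<Longrightarrow> (slot w y x' + t) mod 4 = slot w y x \<and>
      (if is_white \<tau> then \<mu> (side_at \<tau> x) < \<mu> (side_at \<tau> x') else \<mu> (side_at \<tau> x') < \<mu> (side_at \<tau> x))"
    and sg: "sg = 1 \<or> sg = -1"
    and unimodal: "\<And>s. s \<in> set bd \<Longrightarrow>
      (if turning_rank D s < c then 0 \<le> sg * turn f s else sg * turn f s \<le> 0)"
begin

text \<open>The darts that separate the values i and i + 1, with i on the right.\<close>

definition darts :: "int \<Rightarrow> edge dart set" where
  "darts i = {(strand w s, if diff f s = 1 then To_White else To_Black) | s.
     touches s \<and> diff f s \<noteq> 0 \<and> low f s = i}"

text \<open>The face between the halves of a split hourglass gets the value of the neighbour from which it is
  separated by the half that the family does not use. So f changes only at the other half.\<close>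

fun face_value :: "face \<Rightarrow> int" where
  "face_value (Around A) = f A"
| "face_value (Between (x, A)) = (if x = nxt w \<longleftrightarrow> white_tri (x, A) \<in> D then f (A + vec x) else f A)"

lemma touches_iff: "touches s \<longleftrightarrow> (\<exists>\<tau>\<in>D. s = side_at \<tau> (fst s))"
proof
  assume "touches s"
  then show "\<exists>\<tau>\<in>D. s = side_at \<tau> (fst s)"
    unfolding touches_def by (metis side_at_white_tri side_at_black_tri)
next
  assume "\<exists>\<tau>\<in>D. s = side_at \<tau> (fst s)"
  then obtain \<tau> where "\<tau> \<in> D" "s = side_at \<tau> (fst s)" ..
  then show "touches s" unfolding touches_def by (cases \<tau>) (metis white_tri_side_at, metis black_tri_side_at)
qed

lemma touches_side_at: "\<tau> \<in> D \<Longrightarrow> touches (side_at \<tau> x)"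
  by (metis touches_iff fst_side_at)

lemma diff_cases:
  assumes "touches s"
  shows "diff f s = 1 \<or> diff f s = 0 \<or> diff f s = -1"
proof -
  have "\<bar>diff f s\<bar> \<le> 1" using assms diff_le by (metis touches_iff)
  then show ?thesis by arith
qed

lemma in_darts:
  assumes "\<tau> \<in> D" "hg (side_at \<tau> y)" "k < 4"
  shows "(around \<tau> y ! k, h) \<in> darts i \<longleftrightarrow>
    (\<exists>x. k = slot w y x \<and> diff f (side_at \<tau> x) = (if h = To_White then 1 else -1) \<and> low f (side_at \<tau> x) = i)"
    (is "?l \<longleftrightarrow> ?r")
proof
  assume ?l
  then obtain s where s: "around \<tau> y ! k = strand w s" "touches s" "diff f s \<noteq> 0" "low f s = i"
    "h = (if diff f s = 1 then To_White else To_Black)" by (auto simp: darts_def)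
  then obtain x where "s = side_at \<tau> x" "k = slot w y x" using around_strand[OF assms] by blast
  then show ?r using s diff_cases[OF s(2)] by auto
next
  assume ?r
  then obtain x where "k = slot w y x" "diff f (side_at \<tau> x) = (if h = To_White then 1 else -1)"
    "low f (side_at \<tau> x) = i" by blast
  then show ?l using around_slot[OF assms(1,2), of w x] touches_side_at[OF assms(1), of x]
    unfolding darts_def by (cases h) fastforce+
qed

text \<open>The values of f at the corners of a triangle are within 1 of each other. So a level either
  avoids the triangle or is crossed by exactly one step up and one step down.\<close>

lemma opposite:
  assumes "\<tau> \<in> D"
  shows "(\<exists>x. diff f (side_at \<tau> x) = 1 \<and> low f (side_at \<tau> x) = i) \<longleftrightarrow>
    (\<exists>x'. diff f (side_at \<tau> x') = -1 \<and> low f (side_at \<tau> x') = i)"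
proof -
  have "p = -1 \<or> p = 0 \<or> p = 1" if "\<bar>p\<bar> \<le> 1" for p :: int
    using that by arith
  note this[OF diff_le[OF assms]]
  from this[of E1] this[of E2] this[of E3] sum_diff_triangle[of f \<tau>]
  have "(\<exists>x. diff f (side_at \<tau> x) = 1) \<longleftrightarrow> (\<exists>x'. diff f (side_at \<tau> x') = -1)"
    unfolding Ex_axis by (elim disjE) simp_all
  then show ?thesis using low_triangle[OF diff_le[OF assms]] by metis
qed

lemma unique_sign:
  assumes "\<tau> \<in> D" "diff f (side_at \<tau> x) = v" "diff f (side_at \<tau> x') = v" "v = 1 \<or> v = -1"
  shows "x = x'"
  using sum_diff_triangle[of f \<tau>] diff_le[OF assms(1), of E1] diff_le[OF assms(1), of E2]
    diff_le[OF assms(1), of E3] assms(2-4)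
  by (cases x; cases x') auto

lemma step_in_darts:
  assumes "\<tau> \<in> D" "hg (side_at \<tau> y)" "k < 4"
  shows "(around \<tau> y ! ((k + t) mod 4), To_White) \<in> darts i \<longleftrightarrow> (around \<tau> y ! k, To_Black) \<in> darts i"
proof -
  have lt: "(k + t) mod 4 < 4" by simp
  have canc: "k = k'" if "(k + t) mod 4 = (k' + t) mod 4" "k' < 4" for k'
    using mod_add_cancel that assms(3) by blast
  show ?thesis
    unfolding in_darts[OF assms(1,2) lt] in_darts[OF assms]
    using opposite[OF assms(1), of i] turns[OF assms(1,2)] canc slot_less unique_sign[OF assms(1)]
    by (simp) metis
qed

lemma darts_closed:
  assumes "(a, b) \<in> trip_step G t"
  shows "a \<in> darts i \<longleftrightarrow> b \<in> darts i"
  using assms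
proof (cases rule: step_cases)
  case (1 \<tau> y k)
  then show ?thesis using step_in_darts[OF 1(1-3)] by metis
next
  case (2 \<tau> y k)
  then show ?thesis using step_in_darts[OF 2(1-3)] by metis
qed

lemma darts_previous:
  assumes "a \<in> darts i" "tail G a \<in> interior G"
  shows "\<exists>b. (b, a) \<in> trip_step G t \<and> \<mu> (side_of (dart_edge b)) < \<mu> (side_of (dart_edge a))"
proof -
  obtain s where s: "a = (strand w s, if diff f s = 1 then To_White else To_Black)"
    "touches s" "diff f s \<noteq> 0" "low f s = i" using assms(1) by (auto simp: darts_def)
  have side: "side_of (fst (strand w s')) = s'" for s' by (simp add: strand_def)
  consider "diff f s = 1" | "diff f s = -1" using s diff_cases by blast
  then show ?thesis
  proof cases
    case 1
    let ?\<tau> = "black_tri s"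
    have \<tau>: "?\<tau> \<in> D" using assms(2) s(1) 1 by (auto simp: side web_def web_end_def split: if_splits)
    obtain y where y: "hg (side_at ?\<tau> y)" using ex1_hourglass[OF \<tau>] by blast
    have sd: "side_at ?\<tau> (fst s) = s" by simp
    have bt: "black_tri (side_at ?\<tau> x) = ?\<tau>" for x
      by (metis black_tri_exh black_tri_side_at)
    have wh: "is_white ?\<tau> \<longleftrightarrow> False"
      by (metis black_tri_exh is_white.simps)
    obtain x' where x': "diff f (side_at ?\<tau> x') = -1"
      using opposite[OF \<tau>, of i] 1 s(4) by (metis side_at_black_tri)
    have tr: "(slot w y x' + t) mod 4 = slot w y (fst s)" "\<mu> (side_at ?\<tau> x') < \<mu> s"
      using turns[OF \<tau> y, of "fst s" x'] 1 x' wh unfolding sd by simp_all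
    have "((strand w (side_at ?\<tau> x'), To_Black), (strand w s, To_White)) \<in> trip_step G t"
      using step_at_black[OF \<tau> y, where k = "slot w y x'" and t = t]
        around_slot[OF \<tau> y, of w x'] around_slot[OF \<tau> y, of w "fst s", unfolded sd] slot_less[of w y x'] tr(1)
      by (simp add: side bt)
    then have "((strand w (side_at ?\<tau> x'), To_Black), a) \<in> trip_step G t"
      using s(1) 1 by simp
    then show ?thesis using tr(2) s(1) by (intro exI[of _ "(strand w (side_at ?\<tau> x'), To_Black)"]) (simp add: side)
  next
    case 2
    let ?\<tau> = "white_tri s"
    have \<tau>: "?\<tau> \<in> D" using assms(2) s(1) 2 by (auto simp: side web_def web_end_def split: if_splits)
    obtain y where y: "hg (side_at ?\<tau> y)" using ex1_hourglass[OF \<tau>] by blast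
    have sd: "side_at ?\<tau> (fst s) = s" by simp
    have bt: "white_tri (side_at ?\<tau> x) = ?\<tau>" for x
      by (metis white_tri_exh white_tri_side_at)
    have wh: "is_white ?\<tau> \<longleftrightarrow> True"
      by (metis white_tri_exh is_white.simps)
    obtain x' where x': "diff f (side_at ?\<tau> x') = 1"
      using opposite[OF \<tau>, of i] 2 s(4) by (metis side_at_white_tri)
    have tr: "(slot w y (fst s) + t) mod 4 = slot w y x'" "\<mu> (side_at ?\<tau> x') < \<mu> s"
      using turns[OF \<tau> y, of x' "fst s"] 2 x' wh unfolding sd by simp_all
    have "((strand w (side_at ?\<tau> x'), To_White), (strand w s, To_Black)) \<in> trip_step G t"
      using step_at_white[OF \<tau> y, where k = "slot w y (fst s)" and t = t]
        around_slot[OF \<tau> y, of w x'] around_slot[OF \<tau> y, of w "fst s", unfolded sd] slot_less[of w y "fst s"] tr(1)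
      by (simp add: side bt)
    then have "((strand w (side_at ?\<tau> x'), To_White), a) \<in> trip_step G t"
      using s(1) 2 by simp
    then show ?thesis using tr(2) s(1) by (intro exI[of _ "(strand w (side_at ?\<tau> x'), To_White)"]) (simp add: side)
  qed
qed

end

lemma face_chain_web:
  assumes "\<And>s. s \<in> set ss \<Longrightarrow> white_tri s \<in> D \<longleftrightarrow> black_tri s \<notin> D"
  shows "face_chain (web L D P bd) (Around A) (concat (map (edges_across L D) ss)) (Around B) \<longleftrightarrow> side_chain D A ss B"
  using assms
proof (induction ss arbitrary: A)
  case (Cons s ss)
  have s: "white_tri s \<in> D \<longleftrightarrow> black_tri s \<notin> D" using Cons.prems by simp
  obtain x C where sC: "s = (x, C)" by (cases s)
  have "face_chain (web L D P bd) (Around A) (edges_across L D s) F \<longleftrightarrow>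
      first_end D s = A \<and> F = Around (last_end D s)" for F
    using s unfolding sC
    by (cases "hourglass_at L (x, C)"; cases "white_tri (x, C) \<in> D")
      (auto simp: edges_across_def before_face_def after_face_def web_def web_end_def
        first_end_def last_end_def image_iff)
  then show ?case using Cons by (simp add: face_chain_append)
qed simp

lemma face_web [simp]:
  "right_face (web L D P bd) = web_right_face D"
  "left_face (web L D P bd) = web_left_face D"
  "base_face (web L D P bd) = Around P"
  "boundary (web L D P bd) = map (edges_across L D) bd"
  by (simp_all add: web_def)

context web_domain
begin

abbreviation boundary_edges :: "edge list" where
  "boundary_edges \<equiv> concat (map across bd)"

lemma side_of_across: "e \<in> set (across s) \<Longrightarrow> side_of e = s"
  by (auto simp: across_eq split: if_splits)

lemma distinct_across: "distinct ss \<Longrightarrow> distinct (concat (map across ss))"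
proof (induction ss)
  case (Cons s ss)
  have "distinct (across s)" by (simp add: across_eq)
  moreover have "set (across s) \<inter> set (concat (map across ss)) = {}"
    using Cons.prems by (auto dest!: side_of_across)
  ultimately show ?case using Cons by simp
qed simp

lemma boundary_end:
  assumes "e \<in> set (across s)" "s \<in> set bd"
  shows "black_end G e \<in> interior G \<longleftrightarrow> white_tri s \<notin> D" "white_end G e \<in> interior G \<longleftrightarrow> white_tri s \<in> D"
  using assms bd_iff[of s] side_of_across[OF assms(1)]
  by (auto simp: interior_web black_end_web white_end_web web_end_def)

lemma edges_web: "edges G = (\<Union>s\<in>{s. touches s}. set (across s))"
  by (simp add: web_def touches_def)

lemma bd_touches: "s \<in> set bd \<Longrightarrow> touches s"
  by (auto simp: bd_iff touches_def)

lemma boundary_edge: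
  assumes "e \<in> set boundary_edges"
  shows "e \<in> edges G" "black_end G e \<in> interior G \<longleftrightarrow> white_end G e \<notin> interior G"
proof -
  obtain s where s: "s \<in> set bd" "e \<in> set (across s)" using assms by auto
  show "e \<in> edges G" unfolding edges_web using s bd_touches by blast
  show "black_end G e \<in> interior G \<longleftrightarrow> white_end G e \<notin> interior G"
    using boundary_end[OF s(2,1)] by simp
qed

lemma chain_boundary: "face_chain G (Around P) boundary_edges (Around P)"
  using closed_bd face_chain_web[of bd D L P bd P P] bd_iff by blast

lemma finite_touches: "finite {s. touches s}"
proof -
  have "{s. touches s} \<subseteq> (\<lambda>(\<tau>, x). side_at \<tau> x) ` (D \<times> {E1, E2, E3})"
  proof
    fix s assume "s \<in> {s. touches s}"
    moreover have "fst s \<in> {E1, E2, E3}" by (cases "fst s") auto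
    moreover have "s = (\<lambda>(\<tau>, x). side_at \<tau> x) (white_tri s, fst s)"
      "s = (\<lambda>(\<tau>, x). side_at \<tau> x) (black_tri s, fst s)" by simp_all
    ultimately show "s \<in> (\<lambda>(\<tau>, x). side_at \<tau> x) ` (D \<times> {E1, E2, E3})"
      unfolding touches_def by blast
  qed
  then show ?thesis using finite_D by (meson finite.emptyI finite_SigmaI finite_imageI finite_insert finite_subset)
qed

lemma dart_entry:
  assumes "touches s" "tail G ((e, k), h) \<notin> interior G" "e \<in> set (across s)"
  shows "e \<in> set boundary_edges"
proof -
  have "s \<in> set bd"
    using assms(1,2) side_of_across[OF assms(3)] bd_iff
    by (cases h) (auto simp: interior_web black_end_web white_end_web web_end_def touches_def split: if_splits)
  then show ?thesis using assms(3) by auto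
qed

lemma step_cases_target:
  assumes "(a, b) \<in> trip_step G t"
  shows "snd a = To_White \<and> snd b = To_Black \<and> white_tri (side_of (dart_edge b)) = white_tri (side_of (dart_edge a)) \<and>
      white_tri (side_of (dart_edge a)) \<in> D \<or>
    snd a = To_Black \<and> snd b = To_White \<and> black_tri (side_of (dart_edge b)) = black_tri (side_of (dart_edge a)) \<and>
      black_tri (side_of (dart_edge a)) \<in> D"
proof -
  have side: "\<exists>x. side_of (fst (around \<tau> y ! i)) = side_at \<tau> x" if "i < 4" for \<tau> y and i :: nat
    using that by (auto simp: around_def numeral_eq_Suc less_Suc_eq)
  from assms show ?thesis
  proof (cases rule: step_cases)
    case (1 \<tau> y k)
    obtain A where A: "\<tau> = White A" using 1(4) by (cases \<tau>) auto
    have "white_tri (side_of (dart_edge b)) = \<tau>" using side[OF 1(3), of \<tau> y] 1(6) A by auto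
    then have "white_tri (side_of (dart_edge b)) = white_tri (side_of (dart_edge a))" using 1(7) by (rule trans)
    moreover have "snd a = To_White" "snd b = To_Black" using 1(5,6) by simp_all
    moreover have "white_tri (side_of (dart_edge a)) \<in> D" using 1(1) unfolding 1(7) .
    ultimately show ?thesis by blast
  next
    case (2 \<tau> y k)
    obtain A where A: "\<tau> = Black A" using 2(4) by (cases \<tau>) auto
    have "(k + t) mod 4 < 4" by simp
    then have "black_tri (side_of (dart_edge b)) = \<tau>" using side[of "(k + t) mod 4" \<tau> y] 2(6) A by auto
    then have "black_tri (side_of (dart_edge b)) = black_tri (side_of (dart_edge a))" using 2(7) by (rule trans)
    moreover have "snd a = To_Black" "snd b = To_White" using 2(5,6) by simp_all
    moreover have "black_tri (side_of (dart_edge a)) \<in> D" using 2(1) unfolding 2(7) .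
    ultimately show ?thesis by blast
  qed
qed

lemma step_unique_source:
  assumes "(a, b) \<in> trip_step G t" "(a', b) \<in> trip_step G t"
  shows "a = a'"
proof -
  have inj: "k = k'" if "around \<tau> y ! k = around \<tau> y ! k'" "k < 4" "k' < 4" for \<tau> y and k k' :: nat
    using that nth_eq_iff_index_eq[OF distinct_around, of k \<tau> y k'] by (simp add: around_def)
  have hg1: "y = y'" if "\<tau> \<in> D" "hg (side_at \<tau> y)" "hg (side_at \<tau> y')" for \<tau> y y'
    using ex1_hourglass[OF that(1)] that(2,3) by metis
  note target = step_cases_target[OF assms(1)] step_cases_target[OF assms(2)]
  show ?thesis
    using assms(1)
  proof (cases rule: step_cases)
    case (1 \<tau> y k)
    note a = this
    show ?thesis using assms(2)
    proof (cases rule: step_cases)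
      case (1 \<tau>' y' k')
      have "white_tri (side_of (dart_edge a)) = white_tri (side_of (dart_edge a'))"
        using target a(6) by auto
      then have [simp]: "\<tau>' = \<tau>" using 1(7) a(7) by metis
      have [simp]: "y' = y" using hg1[OF a(1), of y' y] 1(2) a(2) by simp
      have "around \<tau> y ! k = around \<tau> y ! k'"
        using trans[OF a(6)[symmetric] 1(6)] by simp
      then have "k = k'" by (rule inj[OF _ a(3) 1(3)])
      then show ?thesis using a(5) 1(5) by simp
    next
      case (2 \<tau>' y' k')
      show ?thesis using trans[OF a(6)[symmetric] 2(6)] by simp
    qed
  next
    case (2 \<tau> y k)
    note a = this
    show ?thesis using assms(2)
    proof (cases rule: step_cases)
      case (1 \<tau>' y' k')
      show ?thesis using trans[OF a(6)[symmetric] 1(6)] by simp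
    next
      case (2 \<tau>' y' k')
      have "black_tri (side_of (dart_edge a)) = black_tri (side_of (dart_edge a'))"
        using target a(6) by auto
      then have [simp]: "\<tau>' = \<tau>" using 2(7) a(7) by metis
      have [simp]: "y' = y" using hg1[OF a(1), of y' y] 2(2) a(2) by simp
      have "around \<tau> y ! ((k + t) mod 4) = around \<tau> y ! ((k' + t) mod 4)"
        using trans[OF a(6)[symmetric] 2(6)] by simp
      then have "(k + t) mod 4 = (k' + t) mod 4" using inj[of \<tau> y "(k + t) mod 4" "(k' + t) mod 4"] by simp
      then have "k = k'" by (rule mod_add_cancel[OF _ a(3) 2(3)])
      then show ?thesis using a(5) 2(5) by simp
    qed
  qed
qed

end

context family
begin

lemma finite_darts: "finite (darts i)"
proof -
  have "darts i \<subseteq> (\<lambda>s. (strand w s, if diff f s = 1 then To_White else To_Black)) ` {s. touches s}"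
    by (auto simp: darts_def)
  then show ?thesis using finite_touches finite_surj by blast
qed

lemma strand_across: "fst (strand w s) \<in> set (across s)"
  by (auto simp: strand_def \<sigma>_def across_eq)

lemma axis_moves:
  assumes "touches s" "hg s" "diff f s \<noteq> 0"
  shows "fst s \<noteq> w"
  using assms diff_hg unfolding touches_iff by metis

lemma dart_sides:
  assumes "a \<in> darts i"
  shows "\<not> i < face_value (right_of G a)" "i < face_value (left_of G a)"
proof -
  from assms obtain s where s: "a = (strand w s, if diff f s = 1 then To_White else To_Black)"
    "touches s" "diff f s \<noteq> 0" "low f s = i" by (auto simp: darts_def)
  obtain x A where sx: "s = (x, A)" by (cases s)
  have dc: "diff f s = 1 \<or> diff f s = -1" using s diff_cases by blast
  have "\<not> i < face_value (right_of G a) \<and> i < face_value (left_of G a)"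
  proof (cases "hg s \<and> s \<in> set bd")
    case True
    have "x \<noteq> w" using axis_moves[OF s(2) _ s(3)] True sx by simp
    then show ?thesis
      using True dc s(4) unfolding s(1) sx
      by (auto simp: strand_def \<sigma>_def diff_def low_def)
  next
    case False
    then show ?thesis
      using dc s(4) unfolding s(1) sx
      by (auto simp: strand_def \<sigma>_def diff_def low_def)
  qed
  then show "\<not> i < face_value (right_of G a)" "i < face_value (left_of G a)" by blast+
qed

lemma crossing_in_darts:
  assumes "e \<in> edges G" "(i < face_value (web_right_face D e)) \<noteq> (i < face_value (web_left_face D e))"
  shows "e \<in> dart_edge ` darts i"
proof -
  obtain s where s: "touches s" "e \<in> set (across s)" using assms(1) by (auto simp: edges_web)
  obtain x A where sx: "s = (x, A)" by (cases s)
  have d: "diff f s \<noteq> 0 \<and> low f s = i" if "(i < f (A + vec x)) \<noteq> (i < f A)"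
    using that diff_cases[OF s(1)] unfolding sx by (auto simp: diff_def low_def)
  have "e = fst (strand w s) \<and> diff f s \<noteq> 0 \<and> low f s = i"
  proof (cases "hg s \<and> s \<in> set bd")
    case True
    then have ne: "(i < f (A + vec x)) \<noteq> (i < f A)"
      using assms(2) s(2) sx by (auto simp: across_eq split: if_splits)
    have "x \<noteq> w" using axis_moves[OF s(1)] True d[OF ne] sx by auto
    then show ?thesis
      using True d[OF ne] assms(2) s(2) unfolding sx
      by (auto simp: across_eq strand_def \<sigma>_def split: if_splits)
  next
    case False
    then show ?thesis using d assms(2) s(2) unfolding sx
      by (auto simp: across_eq strand_def \<sigma>_def)
  qed
  then have "(strand w s, if diff f s = 1 then To_White else To_Black) \<in> darts i" "e = fst (strand w s)"
    using s(1) unfolding darts_def by blast+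
  then show ?thesis by (metis fst_conv image_eqI)
qed

lemma turn_across:
  assumes "e \<in> set (across s)" "s \<in> set bd"
  shows "rises G (\<lambda>F. i < face_value F) e \<Longrightarrow> 0 < turn f s"
    "falls G (\<lambda>F. i < face_value F) e \<Longrightarrow> turn f s < 0"
proof -
  obtain x A where sx: "s = (x, A)" by (cases s)
  have "(face_value (before_face G e), face_value (after_face G e)) \<in>
    {(f (first_end D s), f (last_end D s)), (f (first_end D s), f (first_end D s)), (f (last_end D s), f (last_end D s))}"
    using assms boundary_end[OF assms] unfolding sx
    by (auto simp: across_eq before_face_def after_face_def first_end_def last_end_def split: if_splits)
  then show "rises G (\<lambda>F. i < face_value F) e \<Longrightarrow> 0 < turn f s"
    "falls G (\<lambda>F. i < face_value F) e \<Longrightarrow> turn f s < 0"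
    by (auto simp: rises_def falls_def turn_def)
qed

lemma boundary_split:
  "boundary_edges = concat (map across (filter (\<lambda>s. turning_rank D s < c) bd)) @
     concat (map across (filter (\<lambda>s. \<not> turning_rank D s < c) bd))"
proof -
  have "ss = filter (\<lambda>s. turning_rank D s < c) ss @ filter (\<lambda>s. \<not> turning_rank D s < c) ss"
    if "sorted (map (turning_rank D) ss)" for ss
    using that
  proof (induction ss)
    case (Cons s ss)
    then have "filter (\<lambda>s. turning_rank D s < c) ss = []" if "\<not> turning_rank D s < c"
      using that by (auto simp: filter_empty_conv not_less dest: order_trans)
    then show ?case using Cons by auto
  qed simp
  from this[OF sorted_bd] show ?thesis by (metis concat_append map_append)
qed

text \<open>All of the darts at the level form one trip, and the two monotone stretches of the boundary
  are the sides of rank below c and the others.\<close>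

lemma separates_family:
  assumes s: "s \<in> set bd" "strand w s = (e, 0)" "diff f s = 1"
  shows "separates G (trip G t ((e, 0), To_White)) (web_right_face D e) (Around P) \<longleftrightarrow>
    (white_tri s \<in> D \<longleftrightarrow> \<not> turning_rank D s < c)"
proof -
  let ?i = "low f s"
  let ?\<theta> = "\<lambda>F. ?i < face_value F"
  let ?es = "concat (map across (filter (\<lambda>s. turning_rank D s < c) bd))"
  let ?es' = "concat (map across (filter (\<lambda>s. \<not> turning_rank D s < c) bd))"
  have e: "e \<in> set (across s)" using strand_across[of s] s(2) by simp
  have uni: "(\<forall>e\<in>set ?es. \<not> falls G ?\<theta> e) \<and> (\<forall>e\<in>set ?es'. \<not> rises G ?\<theta> e) \<or>
      (\<forall>e\<in>set ?es. \<not> rises G ?\<theta> e) \<and> (\<forall>e\<in>set ?es'. \<not> falls G ?\<theta> e)"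
  proof -
    have "0 \<le> sg * turn f u" if "u \<in> set bd" "turning_rank D u < c" for u
      using unimodal[OF that(1)] that(2) by simp
    moreover have "sg * turn f u \<le> 0" if "u \<in> set bd" "\<not> turning_rank D u < c" for u
      using unimodal[OF that(1)] that(2) by simp
    moreover have "\<exists>u\<in>set bd. e \<in> set (across u) \<and> turning_rank D u < c" if "e \<in> set ?es" for e
      using that by auto
    moreover have "\<exists>u\<in>set bd. e \<in> set (across u) \<and> \<not> turning_rank D u < c" if "e \<in> set ?es'" for e
      using that by auto
    ultimately have "(\<forall>e\<in>set ?es. \<exists>u. (rises G ?\<theta> e \<longrightarrow> 0 < turn f u) \<and> (falls G ?\<theta> e \<longrightarrow> turn f u < 0) \<and> 0 \<le> sg * turn f u)"
      "(\<forall>e\<in>set ?es'. \<exists>u. (rises G ?\<theta> e \<longrightarrow> 0 < turn f u) \<and> (falls G ?\<theta> e \<longrightarrow> turn f u < 0) \<and> sg * turn f u \<le> 0)"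
      using turn_across[of _ _ ?i] by blast+
    then show ?thesis using sg by (elim disjE) fastforce+
  qed
  have a: "((e, 0), To_White) \<in> darts ?i"
    unfolding darts_def using s(2,3) bd_touches[OF s(1)] by (intro CollectI exI[of _ s]) simp
  have "separates G (trip G t ((e, 0), To_White)) (right_face G e) (base_face G) \<longleftrightarrow>
    (black_end G e \<in> interior G \<longleftrightarrow> e \<in> set ?es)"
  proof (rule trip_separates_iff[where \<Delta> = "darts ?i" and \<theta> = ?\<theta> and es' = ?es' and \<mu> = "\<lambda>a. \<mu> (side_of (dart_edge a))"])
    show "finite (darts ?i)" by (rule finite_darts)
    show "x \<in> darts ?i \<longleftrightarrow> y \<in> darts ?i" if "(x, y) \<in> trip_step G t" for x y
      using darts_closed[OF that] .
    show "y = z" if "x \<in> darts ?i" "(x, y) \<in> trip_step G t" "(x, z) \<in> trip_step G t" for x y z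
      using step_unique that by blast
    show "\<exists>y. (y, x) \<in> trip_step G t \<and> \<mu> (side_of (dart_edge y)) < \<mu> (side_of (dart_edge x))"
      if "x \<in> darts ?i" "tail G x \<in> interior G" for x
      using darts_previous[OF that] .
    show "\<not> ?\<theta> (right_of G x) \<and> ?\<theta> (left_of G x)" if "x \<in> darts ?i" for x
      using dart_sides[OF that] by blast
    show "e \<in> dart_edge ` darts ?i" if "e \<in> edges G" "?\<theta> (right_face G e) \<noteq> ?\<theta> (left_face G e)" for e
      using crossing_in_darts[OF that(1)] that(2) by simp
    show "x = y" if "x \<in> darts ?i" "y \<in> darts ?i" "dart_edge x = dart_edge y" for x y
    proof -
      obtain u v where "x = (strand w u, if diff f u = 1 then To_White else To_Black)"
        "y = (strand w v, if diff f v = 1 then To_White else To_Black)"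
        using \<open>x \<in> darts ?i\<close> \<open>y \<in> darts ?i\<close> unfolding darts_def by blast
      then show ?thesis using strand_edge_inject[of w u v] \<open>dart_edge x = dart_edge y\<close> by auto
    qed
    show "face_chain G (base_face G) (?es @ ?es') (base_face G)"
      using chain_boundary boundary_split by simp
    show "distinct (?es @ ?es')"
      using distinct_across[OF distinct_bd] boundary_split by simp
    show "e \<in> edges G \<and> (black_end G e \<in> interior G \<longleftrightarrow> white_end G e \<notin> interior G)" if "e \<in> set (?es @ ?es')" for e
      using boundary_edge that unfolding boundary_split[symmetric] by blast
    show "dart_edge x \<in> set (?es @ ?es')" if "x \<in> darts ?i" "tail G x \<notin> interior G" for x
    proof -
      obtain u where u: "x = (strand w u, if diff f u = 1 then To_White else To_Black)" "touches u"
        using \<open>x \<in> darts ?i\<close> unfolding darts_def by blast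
      obtain e' k where ek: "strand w u = (e', k)" by (cases "strand w u")
      show ?thesis
        unfolding boundary_split[symmetric]
        using dart_entry[OF u(2), of e' k] that(2) strand_across[of u] u(1) ek by auto
    qed
    show "e \<in> set (?es @ ?es')" unfolding boundary_split[symmetric] using e s(1) by auto
  qed (use uni a in auto)
  moreover have "e \<in> set ?es \<longleftrightarrow> turning_rank D s < c"
  proof -
    have "e \<in> set ?es \<longleftrightarrow> (\<exists>u\<in>set bd. turning_rank D u < c \<and> e \<in> set (across u))" by auto
    then show ?thesis using e s(1) side_of_across by metis
  qed
  ultimately show ?thesis using boundary_end[OF e s(1)] by auto
qed

end

section \<open>Trips that bounce at a split hourglass\<close>

context web_domain
begin

text \<open>The two halves of a split hourglass are consecutive at the vertex where they end. So a 1-trip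
  or a 3-trip that enters by a suitable half leaves at once by the other half, and these two darts
  are the whole trip. It separates the face between the two halves from all the others.\<close>

lemma separates_split:
  assumes s: "s \<in> set bd" "hg s" and j: "j \<le> 1"
  shows "separates G (trip G (1 + 2 * j) ((Split s j, 0), To_White)) (web_right_face D (Split s j)) (Around P)
    \<longleftrightarrow> (white_tri s \<in> D \<longleftrightarrow> j = 1)"
proof -
  let ?t = "1 + 2 * j"
  let ?p = "((Split s j, 0), To_White)" and ?q = "((Split s (1 - j), 0), To_Black)"
  let ?\<Delta> = "{?p, ?q}"
  \<comment> \<open>The face between the halves is the left side of the trip in two of the four cases.\<close>
  let ?\<theta> = "\<lambda>F. F = Between s \<longleftrightarrow> white_tri s \<in> D \<longleftrightarrow> j = 0"
  have j01: "j = 0 \<or> j = 1" using j by auto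
  obtain x A where sx: "s = (x, A)" by (cases s)
  have across_s: "across s = [Split s 0, Split s 1]" using s by (simp add: across_eq)
  have \<sigma>s: "\<sigma> s k = (Split s (1 - k), 0)" for k using s by (simp add: \<sigma>_def)
  have ends: "black_end G (Split s k) \<in> interior G \<longleftrightarrow> white_tri s \<notin> D"
    "white_end G (Split s k) \<in> interior G \<longleftrightarrow> white_tri s \<in> D" if "k \<le> 1" for k
  proof -
    have "k = 0 \<or> k = 1" using that by auto
    then have "Split s k \<in> set (across s)" unfolding across_s by auto
    from boundary_end[OF this s(1)] show "black_end G (Split s k) \<in> interior G \<longleftrightarrow> white_tri s \<notin> D"
      "white_end G (Split s k) \<in> interior G \<longleftrightarrow> white_tri s \<in> D" .
  qed
  have ar0: "around \<tau> (fst s) ! 0 = (Split s 1, 0)" "around \<tau> (fst s) ! 1 = (Split s 0, 0)"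
    if "side_at \<tau> (fst s) = s" for \<tau>
    unfolding around_def that \<sigma>s by simp_all
  have ar: "around \<tau> (fst s) ! j = (Split s (1 - j), 0)" "around \<tau> (fst s) ! ((j + ?t) mod 4) = (Split s j, 0)"
    if "side_at \<tau> (fst s) = s" for \<tau>
  proof -
    have "(j + ?t) mod 4 = 1 - j" using j01 by (elim disjE) simp_all
    moreover have "around \<tau> (fst s) ! j = (Split s (1 - j), 0) \<and> around \<tau> (fst s) ! (1 - j) = (Split s j, 0)"
      using j01
    proof
      assume "j = 0"
      then show ?thesis using ar0[OF that] by (simp del: One_nat_def)
    next
      assume "j = 1"
      then show ?thesis using ar0[OF that] by (simp del: One_nat_def)
    qed
    ultimately show "around \<tau> (fst s) ! j = (Split s (1 - j), 0)" "around \<tau> (fst s) ! ((j + ?t) mod 4) = (Split s j, 0)"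
      by (simp_all only:)
  qed
  have step: "(?p, ?q) \<in> trip_step G ?t" if "white_tri s \<in> D"
    by (rule step_at_white[OF that _ _ _ ar(1)[OF side_at_white_tri, symmetric] ar(2)[OF side_at_white_tri, symmetric]])
      (use s(2) j in simp_all)
  have step': "(?q, ?p) \<in> trip_step G ?t" if "white_tri s \<notin> D"
  proof -
    have "black_tri s \<in> D" using that s(1) bd_iff by blast
    then show ?thesis
      by (rule step_at_black[OF _ _ _ _ ar(1)[OF side_at_black_tri, symmetric] ar(2)[OF side_at_black_tri, symmetric]])
        (use s(2) j in simp_all)
  qed
  have no_step: "white_tri s \<notin> D \<Longrightarrow> (?p, y) \<notin> trip_step G ?t" "white_tri s \<in> D \<Longrightarrow> (?q, y) \<notin> trip_step G ?t"
      "white_tri s \<notin> D \<Longrightarrow> (y, ?q) \<notin> trip_step G ?t" "white_tri s \<in> D \<Longrightarrow> (y, ?p) \<notin> trip_step G ?t" for y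
    using step_cases_target[of ?p y ?t] step_cases_target[of ?q y ?t] step_cases_target[of y ?q ?t]
      step_cases_target[of y ?p ?t] s(1) bd_iff[of s] by auto
  obtain as bs where bd: "bd = as @ s # bs" using s(1) split_list by metis
  let ?es = "concat (map across as) @ [Split s 0]"
  let ?es' = "Split s 1 # concat (map across bs)"
  have all: "boundary_edges = ?es @ ?es'" using bd across_s by simp
  have other: "before_face G e \<noteq> Between s \<and> after_face G e \<noteq> Between s" if "e \<in> set (across u)" "u \<noteq> s" for e u
    using that by (cases u) (auto simp: across_eq before_face_def after_face_def split: if_splits)
  have ne: "u \<noteq> s" if "u \<in> set as \<or> u \<in> set bs" for u
    using that distinct_bd bd by auto
  have uni: "(\<forall>e\<in>set ?es. \<not> falls G ?\<theta> e) \<and> (\<forall>e\<in>set ?es'. \<not> rises G ?\<theta> e) \<or>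
      (\<forall>e\<in>set ?es. \<not> rises G ?\<theta> e) \<and> (\<forall>e\<in>set ?es'. \<not> falls G ?\<theta> e)"
  proof -
    have "\<not> rises G ?\<theta> e \<and> \<not> falls G ?\<theta> e" if "e \<in> set (concat (map across as)) \<union> set (concat (map across bs))" for e
      using that other ne unfolding rises_def falls_def by auto
    moreover have "before_face G (Split s 0) \<noteq> Between s" "after_face G (Split s 0) = Between s"
       "before_face G (Split s 1) = Between s" "after_face G (Split s 1) \<noteq> Between s"
      using ends[of 0] ends[of 1] unfolding before_face_def after_face_def sx by auto
    ultimately show ?thesis unfolding rises_def falls_def by (cases "white_tri s \<in> D \<longleftrightarrow> j = 0") auto
  qed
  have "separates G (trip G ?t ?p) (right_face G (Split s j)) (base_face G) \<longleftrightarrow>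
    (black_end G (Split s j) \<in> interior G \<longleftrightarrow> Split s j \<in> set ?es)"
  proof (rule trip_separates_iff[where \<Delta> = ?\<Delta> and \<theta> = ?\<theta> and es' = ?es' and
        \<mu> = "\<lambda>a. if white_tri s \<in> D \<longleftrightarrow> a = ?q then 1 else 0"])
    show "x \<in> ?\<Delta> \<longleftrightarrow> y \<in> ?\<Delta>" if "(x, y) \<in> trip_step G ?t" for x y
      using that step step' no_step step_unique[OF that] step_unique_source[OF that] by (metis insert_iff empty_iff)
    show "y = z" if "(x, y) \<in> trip_step G ?t" "(x, z) \<in> trip_step G ?t" for x y z
      using step_unique that by blast
    show "\<exists>y. (y, x) \<in> trip_step G ?t \<and> (if white_tri s \<in> D \<longleftrightarrow> y = ?q then 1 else 0 :: int) < (if white_tri s \<in> D \<longleftrightarrow> x = ?q then 1 else 0)"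
      if "x \<in> ?\<Delta>" "tail G x \<in> interior G" for x
    proof (cases "white_tri s \<in> D")
      case True
      then have "x = ?q" using that ends[of j] j by auto
      then show ?thesis using step[OF True] True by (intro exI[of _ ?p]) simp
    next
      case False
      then have "x = ?p" using that ends[of "1 - j"] by auto
      then show ?thesis using step'[OF False] False by (intro exI[of _ ?q]) simp
    qed
    show "\<not> ?\<theta> (right_of G x) \<and> ?\<theta> (left_of G x)" if "x \<in> ?\<Delta>" for x
      using that j01 unfolding sx by (auto split: if_splits)
    show "e \<in> dart_edge ` ?\<Delta>" if "e \<in> edges G" "?\<theta> (right_face G e) \<noteq> ?\<theta> (left_face G e)" for e
    proof -
      from that(1) obtain u where u: "e \<in> set (across u)" unfolding edges_web by blast
      have "before_face G e = Between s \<or> after_face G e = Between s"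
      proof -
        have "right_face G e = Between s \<or> left_face G e = Between s" using that(2) by blast
        then show ?thesis unfolding before_face_def after_face_def
          by (cases "black_end G e \<in> interior G") auto
      qed
      then have "u = s" using other[OF u] by blast
      then show ?thesis using u across_s j01 by auto
    qed
    show "x = y" if "x \<in> ?\<Delta>" "y \<in> ?\<Delta>" "dart_edge x = dart_edge y" for x y
      using that j01 by auto
    show "face_chain G (base_face G) (?es @ ?es') (base_face G)"
      using chain_boundary unfolding all by simp
    show "distinct (?es @ ?es')" using distinct_across[OF distinct_bd] unfolding all .
    show "e \<in> edges G \<and> (black_end G e \<in> interior G \<longleftrightarrow> white_end G e \<notin> interior G)" if "e \<in> set (?es @ ?es')" for e
      using boundary_edge that unfolding all by blast
    show "dart_edge x \<in> set (?es @ ?es')" if "x \<in> ?\<Delta>" for x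
      using that j01 by auto
    show "Split s j \<in> set (?es @ ?es')" using j01 by auto
  qed (use uni in auto)
  moreover have "Split s 1 \<notin> set ?es"
  proof
    assume "Split s 1 \<in> set ?es"
    then obtain u where "u \<in> set as" "Split s 1 \<in> set (across u)" by auto
    then show False using side_of_across[of "Split s 1" u] ne[of u] by simp
  qed
  ultimately show ?thesis using ends[OF j] j01 by auto
qed

end

section \<open>Strips and level curves\<close>

text \<open>The lattice lines of direction \<open>vec w\<close> are numbered from left to right, as seen in that
  direction.\<close>

fun zeta :: "axis \<Rightarrow> point \<Rightarrow> int" where
  "zeta E1 (X, Y) = - ((X + Y) div 2)"
| "zeta E2 (X, Y) = (Y - X) div 2"
| "zeta E3 (X, Y) = X"

lemma zeta_step: "zeta w (A + vec x) - zeta w A = (if x = prv w then 1 else if x = nxt w then -1 else 0)"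
  by (cases A; cases w; cases x) auto

text \<open>Twice the midpoint, so as to stay within the integers.\<close>

definition mid :: "side \<Rightarrow> point" where
  "mid s = snd s + snd s + vec (fst s)"

text \<open>The scalar product with \<open>vec w\<close>, up to the factor 4 that makes it an integer in the units of
  length sqrt 3 / 2 and 1 / 2. It measures the progress of a trip in a strip of direction w.\<close>

definition along :: "axis \<Rightarrow> point \<Rightarrow> int" where
  "along w A = 3 * fst (vec w) * fst A + snd (vec w) * snd A"

lemma along_turn:
  "along w (mid (side_at \<tau> (nxt w))) < along w (mid (side_at \<tau> (prv w))) \<longleftrightarrow> is_white \<tau>"
  "along w (mid (side_at \<tau> (prv w))) < along w (mid (side_at \<tau> (nxt w))) \<longleftrightarrow> \<not> is_white \<tau>"
  by (cases \<tau>; cases w; auto simp: along_def mid_def algebra_simps)+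

lemma zeta_turn:
  assumes "x \<noteq> w"
  shows "zeta w (mid (side_at \<tau> w)) < zeta w (mid (side_at \<tau> x)) \<longleftrightarrow> is_white \<tau>"
    "zeta w (mid (side_at \<tau> x)) < zeta w (mid (side_at \<tau> w)) \<longleftrightarrow> \<not> is_white \<tau>"
proof -
  have "zeta w (mid (side_at \<tau> x)) - zeta w (mid (side_at \<tau> w)) = (if is_white \<tau> then 1 else -1)"
  proof (cases \<tau>)
    case (White A)
    then show ?thesis using assms
      by (cases A; cases w; cases x; simp add: mid_def; presburger?)
  next
    case (Black A)
    then show ?thesis using assms
      by (cases A; cases w; cases x; simp add: mid_def; presburger?)
  qed
  then show "zeta w (mid (side_at \<tau> w)) < zeta w (mid (side_at \<tau> x)) \<longleftrightarrow> is_white \<tau>"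
    "zeta w (mid (side_at \<tau> x)) < zeta w (mid (side_at \<tau> w)) \<longleftrightarrow> \<not> is_white \<tau>"
    by (auto split: if_splits)
qed

text \<open>The turning rank at which \<open>zeta w\<close> starts to move the other way along the boundary. For the
  coordinate of axis w this happens at \<open>phase (nxt w)\<close>.\<close>

fun phase :: "axis \<Rightarrow> nat" where
  "phase E1 = 3" | "phase E2 = 2" | "phase E3 = 1"

context web_domain
begin

lemma diff_zeta: "diff (zeta w) s = (if fst s = prv w then 1 else if fst s = nxt w then -1 else 0)"
  by (simp add: diff_def zeta_step)

lemma diff_lft:
  assumes "touches s"
  shows "diff (lft w) s = of_bool (fst s = w) - of_bool (hg s)"
  using assms lft_step[of "white_tri s" w "fst s"] lft_step[of "black_tri s" w "fst s"]
  unfolding touches_def by auto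

lemma diff_uminus: "diff (\<lambda>A. - f A) s = - diff f s"
  by (simp add: diff_def)

lemma turn_diff: "turn f s = (if white_tri s \<in> D then diff f s else - diff f s)"
  by (simp add: turn_def diff_def first_end_def last_end_def)

text \<open>In a strip of direction w, a triangle has one side on the border of the strip and is passed
  through the other two. The choice of the strands in \<open>slot\<close> makes the positions of these two
  consecutive, wherever the hourglass is.\<close>

lemma family_zeta: "family L D P bd lft (zeta w) w 1 (\<lambda>s. - along w (mid s)) (if w = E2 then -1 else 1) (phase w)"
proof
  fix \<tau> x x' y
  assume "\<tau> \<in> D" "hg (side_at \<tau> y)" and d: "diff (zeta w) (side_at \<tau> x) = 1" "diff (zeta w) (side_at \<tau> x') = -1"
  have "x = prv w" "x' = nxt w" using d by (auto simp: diff_zeta split: if_splits)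
  then show "(slot w y x' + 1) mod 4 = slot w y x \<and>
      (if is_white \<tau> then - along w (mid (side_at \<tau> x)) < - along w (mid (side_at \<tau> x'))
       else - along w (mid (side_at \<tau> x')) < - along w (mid (side_at \<tau> x)))"
    by (cases w; cases y) (auto simp: slot_def along_turn[of E1, simplified] along_turn[of E2, simplified] along_turn[of E3, simplified])
next
  fix s assume s: "s \<in> set bd"
  then show "if turning_rank D s < phase w then 0 \<le> (if w = E2 then -1 else 1) * turn (zeta w) s
        else (if w = E2 then -1 else 1) * turn (zeta w) s \<le> 0"
    using no_E2[OF s]
    by (cases w; cases "fst s") (auto simp: turn_diff diff_zeta turning_rank.simps)
qed (auto simp: diff_zeta)

lemma family_zeta_reversed:
  "family L D P bd lft (\<lambda>A. - zeta w A) w 3 (\<lambda>s. along w (mid s)) (if w = E2 then 1 else -1) (phase w)"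
proof
  fix \<tau> x x' y
  assume "\<tau> \<in> D" "hg (side_at \<tau> y)" and d: "diff (\<lambda>A. - zeta w A) (side_at \<tau> x) = 1" "diff (\<lambda>A. - zeta w A) (side_at \<tau> x') = -1"
  have "x' = prv w" "x = nxt w" using d by (auto simp: diff_zeta diff_uminus split: if_splits)
  then show "(slot w y x' + 3) mod 4 = slot w y x \<and>
      (if is_white \<tau> then along w (mid (side_at \<tau> x)) < along w (mid (side_at \<tau> x'))
       else along w (mid (side_at \<tau> x')) < along w (mid (side_at \<tau> x)))"
    by (cases w; cases y) (auto simp: slot_def along_turn[of E1, simplified] along_turn[of E2, simplified] along_turn[of E3, simplified])
next
  fix s assume s: "s \<in> set bd"
  then show "if turning_rank D s < phase w then 0 \<le> (if w = E2 then 1 else -1) * turn (\<lambda>A. - zeta w A) s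
        else (if w = E2 then 1 else -1) * turn (\<lambda>A. - zeta w A) s \<le> 0"
    using no_E2[OF s]
    by (cases w; cases "fst s") (auto simp: turn_diff diff_zeta diff_uminus turning_rank.simps)
qed (auto simp: diff_zeta diff_uminus)

lemma slot_opposite:
  "y \<noteq> w \<Longrightarrow> (slot w y w + 2) mod 4 = slot w y y \<and> (slot w y y + 2) mod 4 = slot w y w"
  by (cases w; cases y) (simp_all add: slot_def)

text \<open>A level curve of the coordinate of axis w crosses a lozenge through its two sides of axis w; a
  lozenge without such sides is not met. In each of the two triangles the curve goes between
  the side of axis w and the hourglass, which are opposite strands by the choice in \<open>slot\<close>. It
  always crosses the lattice lines of direction w in the same sense, so \<open>zeta w\<close> measures its
  progress.\<close>

lemma family_lift:
  "family L D P bd lft (lft w) w 2 (\<lambda>s. zeta w (mid s)) (if w = E3 then -1 else 1) (phase (nxt w))"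
proof
  fix \<tau> x assume "\<tau> \<in> D"
  then show "\<bar>diff (lft w) (side_at \<tau> x)\<bar> \<le> 1" by (simp add: lft_step)
next
  fix \<tau> assume "\<tau> \<in> D" "hg (side_at \<tau> w)"
  then show "diff (lft w) (side_at \<tau> w) = 0" by (simp add: lft_step)
next
  fix \<tau> x x' y
  assume t: "\<tau> \<in> D" "hg (side_at \<tau> y)" and d: "diff (lft w) (side_at \<tau> x) = 1" "diff (lft w) (side_at \<tau> x') = -1"
  have "x = w" "hg (side_at \<tau> x')" "x' \<noteq> w" using d t(1) by (auto simp: lft_step of_bool_def split: if_splits)
  moreover have "x' = y" using ex1_hourglass[OF t(1)] t(2) calculation(2) by metis
  ultimately show "(slot w y x' + 2) mod 4 = slot w y x \<and>
      (if is_white \<tau> then zeta w (mid (side_at \<tau> x)) < zeta w (mid (side_at \<tau> x'))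
       else zeta w (mid (side_at \<tau> x')) < zeta w (mid (side_at \<tau> x)))"
    using slot_opposite[of y w] zeta_turn[of y w \<tau>] by simp
next
  fix s assume s: "s \<in> set bd"
  then show "if turning_rank D s < phase (nxt w) then 0 \<le> (if w = E3 then -1 else 1) * turn (lft w) s
        else (if w = E3 then -1 else 1) * turn (lft w) s \<le> 0"
    using no_E2[OF s] no_hg[OF s] bd_touches[OF s]
    by (cases w; cases "fst s") (auto simp: turn_diff diff_lft turning_rank.simps)
qed (auto)

lemma family_lift_reversed:
  "family L D P bd lft (\<lambda>A. - lft w A) w 2 (\<lambda>s. - zeta w (mid s)) (if w = E3 then 1 else -1) (phase (nxt w))"
proof
  fix \<tau> x assume "\<tau> \<in> D"
  then show "\<bar>diff (\<lambda>A. - lft w A) (side_at \<tau> x)\<bar> \<le> 1" by (simp add: lft_step diff_uminus)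
next
  fix \<tau> assume "\<tau> \<in> D" "hg (side_at \<tau> w)"
  then show "diff (\<lambda>A. - lft w A) (side_at \<tau> w) = 0" by (simp add: lft_step diff_uminus)
next
  fix \<tau> x x' y
  assume t: "\<tau> \<in> D" "hg (side_at \<tau> y)" and d: "diff (\<lambda>A. - lft w A) (side_at \<tau> x) = 1" "diff (\<lambda>A. - lft w A) (side_at \<tau> x') = -1"
  have "x' = w" "hg (side_at \<tau> x)" "x \<noteq> w" using d t(1) by (auto simp: lft_step diff_uminus of_bool_def split: if_splits)
  moreover have "x = y" using ex1_hourglass[OF t(1)] t(2) calculation(2) by metis
  ultimately show "(slot w y x' + 2) mod 4 = slot w y x \<and>
      (if is_white \<tau> then - zeta w (mid (side_at \<tau> x)) < - zeta w (mid (side_at \<tau> x'))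
       else - zeta w (mid (side_at \<tau> x')) < - zeta w (mid (side_at \<tau> x)))"
    using slot_opposite[of y w] zeta_turn[of y w \<tau>] by simp
next
  fix s assume s: "s \<in> set bd"
  then show "if turning_rank D s < phase (nxt w) then 0 \<le> (if w = E3 then 1 else -1) * turn (\<lambda>A. - lft w A) s
        else (if w = E3 then 1 else -1) * turn (\<lambda>A. - lft w A) s \<le> 0"
    using no_E2[OF s] no_hg[OF s] bd_touches[OF s]
    by (cases w; cases "fst s") (auto simp: turn_diff diff_lft diff_uminus turning_rank.simps)
qed (auto)

text \<open>
  The following three lemmas assign the trips through a boundary edge to families. A simple edge
  across a side of axis x belongs to the strips of the directions \<open>nxt x\<close> and \<open>prv x\<close> and to a
  level curve of the coordinate of axis x. Of the two odd trips through a half of a split hourglass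
  one bounces. The other one and the 2-trip belong to the axis for which this half is the strand
  in use.
\<close>

abbreviation separated :: "nat \<Rightarrow> edge \<Rightarrow> bool" where
  "separated t e \<equiv> separates G (trip G t ((e, 0), To_White)) (web_right_face D e) (Around P)"

lemma separated_simple:
  assumes s: "s \<in> set bd" "\<not> hg s"
  shows "separated 1 (Edge s) \<longleftrightarrow> (white_tri s \<in> D \<longleftrightarrow> \<not> turning_rank D s < phase (nxt (fst s)))"
    "separated 2 (Edge s) \<longleftrightarrow> (white_tri s \<in> D \<longleftrightarrow> \<not> turning_rank D s < phase (nxt (fst s)))"
    "separated 3 (Edge s) \<longleftrightarrow> (white_tri s \<in> D \<longleftrightarrow> \<not> turning_rank D s < phase (prv (fst s)))"
proof -
  have str: "strand w s = (Edge s, 0)" for w using s by (simp add: strand_def \<sigma>_def)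
  show "separated 1 (Edge s) \<longleftrightarrow> (white_tri s \<in> D \<longleftrightarrow> \<not> turning_rank D s < phase (nxt (fst s)))"
    by (rule family.separates_family[OF family_zeta s(1) str]) (simp add: diff_zeta)
  show "separated 2 (Edge s) \<longleftrightarrow> (white_tri s \<in> D \<longleftrightarrow> \<not> turning_rank D s < phase (nxt (fst s)))"
    by (rule family.separates_family[OF family_lift s(1) str]) (simp add: diff_lft[OF bd_touches[OF s(1)]] s(2))
  show "separated 3 (Edge s) \<longleftrightarrow> (white_tri s \<in> D \<longleftrightarrow> \<not> turning_rank D s < phase (prv (fst s)))"
    by (rule family.separates_family[OF family_zeta_reversed s(1) str]) (simp add: diff_zeta diff_uminus)
qed

lemma separated_split_first:
  assumes s: "s \<in> set bd" "hg s"
  shows "separated 1 (Split s 0) \<longleftrightarrow> white_tri s \<notin> D"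
    "separated 2 (Split s 0) \<longleftrightarrow> (white_tri s \<in> D \<longleftrightarrow> \<not> turning_rank D s < phase (fst s))"
    "separated 3 (Split s 0) \<longleftrightarrow> (white_tri s \<in> D \<longleftrightarrow> \<not> turning_rank D s < phase (prv (fst s)))"
proof -
  have str: "strand (prv (fst s)) s = (Split s 0, 0)" using s by (simp add: strand_def \<sigma>_def)
  show "separated 1 (Split s 0) \<longleftrightarrow> white_tri s \<notin> D"
    using separates_split[OF s, of 0] by simp
  show "separated 2 (Split s 0) \<longleftrightarrow> (white_tri s \<in> D \<longleftrightarrow> \<not> turning_rank D s < phase (fst s))"
    using family.separates_family[OF family_lift_reversed s(1) str]
    by (simp add: diff_lft[OF bd_touches[OF s(1)]] diff_uminus s(2))
  show "separated 3 (Split s 0) \<longleftrightarrow> (white_tri s \<in> D \<longleftrightarrow> \<not> turning_rank D s < phase (prv (fst s)))"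
    using family.separates_family[OF family_zeta_reversed s(1) str]
    by (simp add: diff_zeta diff_uminus)
qed

lemma separated_split_second:
  assumes s: "s \<in> set bd" "hg s"
  shows "separated 1 (Split s 1) \<longleftrightarrow> (white_tri s \<in> D \<longleftrightarrow> \<not> turning_rank D s < phase (nxt (fst s)))"
    "separated 2 (Split s 1) \<longleftrightarrow> (white_tri s \<in> D \<longleftrightarrow> \<not> turning_rank D s < phase (prv (fst s)))"
    "separated 3 (Split s 1) \<longleftrightarrow> white_tri s \<in> D"
proof -
  have str: "strand (nxt (fst s)) s = (Split s 1, 0)" using s by (simp add: strand_def \<sigma>_def)
  show "separated 1 (Split s 1) \<longleftrightarrow> (white_tri s \<in> D \<longleftrightarrow> \<not> turning_rank D s < phase (nxt (fst s)))"
    using family.separates_family[OF family_zeta s(1) str] by (simp add: diff_zeta)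
  show "separated 2 (Split s 1) \<longleftrightarrow> (white_tri s \<in> D \<longleftrightarrow> \<not> turning_rank D s < phase (prv (fst s)))"
    using family.separates_family[OF family_lift_reversed s(1) str]
    by (simp add: diff_lft[OF bd_touches[OF s(1)]] diff_uminus s(2))
  show "separated 3 (Split s 1) \<longleftrightarrow> white_tri s \<in> D"
    using separates_split[OF s, of 1] by (simp add: numeral_3_eq_3)
qed

lemma sep_label_eq:
  "sep_label G e = 1 + of_bool (separated 1 e) + of_bool (separated 2 e) + of_bool (separated 3 e)"
proof -
  have "card {t \<in> {1, 2, 3}. Q t} = of_bool (Q 1) + of_bool (Q 2) + of_bool (Q 3)" for Q :: "nat \<Rightarrow> bool"
  proof -
    have "{t \<in> {1, 2, 3}. Q t} = (if Q 1 then {1} else {}) \<union> (if Q 2 then {2} else {}) \<union> (if Q 3 then {3} else {})"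
      by auto
    then show ?thesis by auto
  qed
  from this[of "\<lambda>t. separated t e"] show ?thesis by (simp add: sep_label_def)
qed

end

section \<open>The letters at a side\<close>

definition side_letters :: "point set set \<Rightarrow> triangle set \<Rightarrow> side \<Rightarrow> letter list" where
  "side_letters L D s = (if white_tri s \<in> D
     then (case fst s of E1 \<Rightarrow> [Plain 1]
       | E2 \<Rightarrow> if hourglass_at L s then [Plain 2, Plain 3] else [Plain 2]
       | E3 \<Rightarrow> if hourglass_at L s then [Plain 3, Plain 4] else [Plain 4])
     else (case fst s of E1 \<Rightarrow> if hourglass_at L s then [Barred 3, Barred 1] else [Barred 1]
       | _ \<Rightarrow> [Barred 4]))"

text \<open>The label of an edge counts the separating trips. By the lemmas above these are found by
  comparing the rank of the side with the phases of the three axes.\<close>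

lemma (in web_domain) boundary_word_web: "boundary_word G = map (side_letters L D) bd"
proof -
  have "map (boundary_letter G) (across s) = side_letters L D s" if s: "s \<in> set bd" for s
  proof (cases "hg s")
    case True
    have b: "boundary_letter G (Split s k) = (if white_tri s \<in> D then Plain else Barred) (sep_label G (Split s k))" if "k \<in> {0, 1}" for k
      using boundary_end(1)[of "Split s k" s] s True that by (auto simp: boundary_letter_def across_eq)
    show ?thesis
      using s True b[of 0] b[of 1] no_E2[OF s] no_hg[OF s True]
        separated_split_first[OF s True] separated_split_second[OF s True]
      by (cases "fst s") (auto simp: across_eq side_letters_def sep_label_eq turning_rank.simps)
  next
    case False
    have b: "boundary_letter G (Edge s) = (if white_tri s \<in> D then Plain else Barred) (sep_label G (Edge s))"
      using boundary_end(1)[of "Edge s" s] s False by (auto simp: boundary_letter_def across_eq)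
    show ?thesis
      using s False b no_E2[OF s] separated_simple[OF s False]
      by (cases "fst s") (auto simp: across_eq side_letters_def sep_label_eq turning_rank.simps)
  qed
  then show ?thesis by (simp add: boundary_word_def)
qed

section \<open>The surface of a plane partition\<close>

text \<open>The plane partition together with the walls and everything behind them, so that the walls of the
  box need no case distinction.\<close>

definition solid :: "pp \<Rightarrow> (int \<times> int \<times> int) set" where
  "solid p = {(x, y, z). x \<le> 0 \<or> y \<le> 0 \<or> z \<le> 0 \<or> (nat x, nat y, nat z) \<in> p}"

text \<open>The points where the diagonal lines leave the solid. Each diagonal projects to one point of the
  plane and leaves the solid once, so these points correspond to the lattice points.\<close>

definition surf :: "pp \<Rightarrow> int \<times> int \<times> int \<Rightarrow> bool" where
  "surf p v \<longleftrightarrow> v \<in> solid p \<and> v + (1, 1, 1) \<notin> solid p"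

fun unit :: "axis \<Rightarrow> int \<times> int \<times> int" where
  "unit E1 = (1, 0, 0)" | "unit E2 = (0, 1, 0)" | "unit E3 = (0, 0, 1)"

fun crd :: "axis \<Rightarrow> int \<times> int \<times> int \<Rightarrow> int" where
  "crd E1 (x, y, z) = x" | "crd E2 (x, y, z) = y" | "crd E3 (x, y, z) = z"

definition lift :: "pp \<Rightarrow> point \<Rightarrow> int \<times> int \<times> int" where
  "lift p A = (THE v. surf p v \<and> proj v = A)"

text \<open>The corners of the rhombus of which the side is the short diagonal.\<close>

definition quad :: "side \<Rightarrow> point set" where
  "quad s = corners (white_tri s) \<union> corners (black_tri s)"

lemma proj_eq: "proj (x, y, z) = (x - y, 2 * z - x - y)"
  by (simp add: proj_def)

lemma proj_unit: "proj (v + unit x) = proj v + vec x" "proj (v + unit x - (1, 1, 1)) = proj v + vec x"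
  by (cases v; cases x; simp add: proj_eq)+

lemma initial_segment:
  fixes S :: "nat set"
  assumes "S \<subseteq> {1..c}" and down: "\<And>k l. l \<in> S \<Longrightarrow> 1 \<le> k \<Longrightarrow> k \<le> l \<Longrightarrow> k \<in> S"
  shows "k \<in> S \<longleftrightarrow> 1 \<le> k \<and> k \<le> card S"
proof -
  have fin: "finite S" using assms(1) finite_subset by blast
  have "S = {1..card S}"
  proof (cases "S = {}")
    case False
    have "S = {1..Max S}"
    proof
      show "S \<subseteq> {1..Max S}" using assms(1) fin by auto
      show "{1..Max S} \<subseteq> S" using down[OF Max_in[OF fin False]] by auto
    qed
    then show ?thesis by (metis card_atLeastAtMost diff_Suc_1)
  qed simp
  then show ?thesis by (metis atLeastAtMost_iff)
qed

locale boxed_partition =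
  fixes a b c :: nat and p :: pp
  assumes pp: "plane_partition a b c p"
begin

lemma in_box: "(i, j, k) \<in> p \<Longrightarrow> 1 \<le> i \<and> i \<le> a \<and> 1 \<le> j \<and> j \<le> b \<and> 1 \<le> k \<and> k \<le> c"
  using pp unfolding plane_partition_def by fastforce

lemma down: "(n, m, l) \<in> p \<Longrightarrow> 1 \<le> i \<Longrightarrow> i \<le> n \<Longrightarrow> 1 \<le> j \<Longrightarrow> j \<le> m \<Longrightarrow> 1 \<le> k \<Longrightarrow> k \<le> l \<Longrightarrow> (i, j, k) \<in> p"
  using pp unfolding plane_partition_def by blast

lemma columns:
  "1 \<le> i \<Longrightarrow> 1 \<le> j \<Longrightarrow> (i, j, k) \<in> p \<longleftrightarrow> 1 \<le> k \<and> k \<le> card {k. (i, j, k) \<in> p}"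
  "1 \<le> i \<Longrightarrow> 1 \<le> k \<Longrightarrow> (i, j, k) \<in> p \<longleftrightarrow> 1 \<le> j \<and> j \<le> card {j. (i, j, k) \<in> p}"
  "1 \<le> j \<Longrightarrow> 1 \<le> k \<Longrightarrow> (i, j, k) \<in> p \<longleftrightarrow> 1 \<le> i \<and> i \<le> card {i. (i, j, k) \<in> p}"
proof -
  have k: "{k. (i, j, k) \<in> p} \<subseteq> {1..c}" and j: "{j. (i, j, k) \<in> p} \<subseteq> {1..b}"
    and i: "{i. (i, j, k) \<in> p} \<subseteq> {1..a}"
    using in_box by auto
  show "(i, j, k) \<in> p \<longleftrightarrow> 1 \<le> k \<and> k \<le> card {k. (i, j, k) \<in> p}" if "1 \<le> i" "1 \<le> j"
    using initial_segment[OF k, of k] down[of i j _ i j] that by simp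
  show "(i, j, k) \<in> p \<longleftrightarrow> 1 \<le> j \<and> j \<le> card {j. (i, j, k) \<in> p}" if "1 \<le> i" "1 \<le> k"
    using initial_segment[OF j, of j] down[of i _ k i _ k] that by simp
  show "(i, j, k) \<in> p \<longleftrightarrow> 1 \<le> i \<and> i \<le> card {i. (i, j, k) \<in> p}" if "1 \<le> j" "1 \<le> k"
    using initial_segment[OF i, of i] down[of _ j k _ j k] that by simp
qed

lemma solid_down:
  assumes "(x, y, z) \<in> solid p" "x' \<le> x" "y' \<le> y" "z' \<le> z"
  shows "(x', y', z') \<in> solid p"
proof (cases "x' \<le> 0 \<or> y' \<le> 0 \<or> z' \<le> 0")
  case False
  then have "(nat x, nat y, nat z) \<in> p" using assms by (auto simp: solid_def)
  then have "(nat x', nat y', nat z') \<in> p" by (rule down) (use False assms in auto)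
  then show ?thesis by (simp add: solid_def)
qed (auto simp: solid_def)

lemma solid_box: "(x, y, z) \<in> solid p \<Longrightarrow> x \<le> 0 \<or> y \<le> 0 \<or> z \<le> 0 \<or> x \<le> int a \<and> y \<le> int b \<and> z \<le> int c"
  using in_box[of "nat x" "nat y" "nat z"] by (auto simp: solid_def)

lemma surf_unique:
  assumes "surf p v" "surf p v'" "proj v = proj v'"
  shows "v = v'"
proof -
  have le: "y' \<le> y" if "surf p (x, y, z)" "surf p (x', y', z')" "x - y = x' - y'" "z - y = z' - y'" for x y z x' y' z'
  proof (rule ccontr)
    assume "\<not> y' \<le> y"
    then have "x + 1 \<le> x'" "y + 1 \<le> y'" "z + 1 \<le> z'" using that(3,4) by linarith+
    moreover have "(x', y', z') \<in> solid p" using that(2) by (simp add: surf_def)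
    ultimately have "(x + 1, y + 1, z + 1) \<in> solid p" by (rule solid_down[rotated])
    then show False using that(1) by (simp add: surf_def)
  qed
  obtain x y z x' y' z' where xyz: "v = (x, y, z)" "v' = (x', y', z')" by (cases v, cases v')
  have eq: "x - y = x' - y'" "z - y = z' - y'" using assms(3) unfolding xyz by (simp_all add: proj_eq)
  have "y' \<le> y" by (rule le[OF assms(1,2)[unfolded xyz] eq])
  moreover have "y \<le> y'" by (rule le[OF assms(2,1)[unfolded xyz] eq[symmetric]])
  ultimately show ?thesis using eq unfolding xyz by simp
qed

lemma surf_exists:
  assumes "even (X + Y)"
  shows "\<exists>v. surf p v \<and> proj v = (X, Y)"
proof -
  define H where "H = (X + Y) div 2"
  define u where "u = (\<lambda>k. (X + int k, int k, int k + H))"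
  let ?m = "Suc (b + nat (abs X) + nat (abs H))"
  have "u ?m \<notin> solid p"
  proof
    assume "u ?m \<in> solid p"
    then show False using solid_box[of "X + int ?m" "int ?m" "int ?m + H"] by (auto simp: u_def)
  qed
  moreover have "u 0 \<in> solid p" by (simp add: u_def solid_def)
  ultimately obtain k where "u k \<in> solid p" "u (Suc k) \<notin> solid p"
    using ex_least_nat_less[of "\<lambda>k. u k \<notin> solid p" ?m] by auto
  moreover have "u (Suc k) = u k + (1, 1, 1)" by (simp add: u_def)
  moreover have "proj (u k) = (X, Y)" using assms by (simp add: u_def proj_eq H_def)
  ultimately show ?thesis unfolding surf_def by metis
qed

lemma lift_eqI: "surf p v \<Longrightarrow> proj v = A \<Longrightarrow> lift p A = v"
  unfolding lift_def by (rule the_equality) (simp, metis surf_unique)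

lemma lift_surf: "even (fst A + snd A) \<Longrightarrow> surf p (lift p A) \<and> proj (lift p A) = A"
  using surf_exists[of "fst A" "snd A"] lift_eqI by (metis prod.collapse)

text \<open>The unit square orthogonal to axis x with greatest corner v belongs to the boundary of the solid.\<close>

definition exposed :: "axis \<Rightarrow> int \<times> int \<times> int \<Rightarrow> bool" where
  "exposed x v \<longleftrightarrow> v \<in> solid p \<and> v + unit x \<notin> solid p"

lemma exposed_iff: "exposed x v \<longleftrightarrow> surf p v \<and> surf p (v + unit x - (1, 1, 1))"
proof -
  obtain i j k where v: "v = (i, j, k)" by (cases v)
  have lower: "(i, j, k) \<in> solid p \<Longrightarrow> (i, j - 1, k - 1) \<in> solid p"
    "(i, j, k) \<in> solid p \<Longrightarrow> (i - 1, j, k - 1) \<in> solid p"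
    "(i, j, k) \<in> solid p \<Longrightarrow> (i - 1, j - 1, k) \<in> solid p"
    by (erule solid_down; simp)+
  have upper: "(i + 1, j + 1, k + 1) \<in> solid p \<Longrightarrow> (i + 1, j, k) \<in> solid p"
    "(i + 1, j + 1, k + 1) \<in> solid p \<Longrightarrow> (i, j + 1, k) \<in> solid p"
    "(i + 1, j + 1, k + 1) \<in> solid p \<Longrightarrow> (i, j, k + 1) \<in> solid p"
    by (erule solid_down; simp)+
  show ?thesis
    unfolding v exposed_def surf_def using lower upper by (cases x; simp; blast)
qed

lemma surf_step:
  assumes "surf p v" "\<not> exposed x v"
  shows "surf p (v + unit x)"
proof -
  obtain i j k where v: "v = (i, j, k)" by (cases v)
  have "v + unit x + (1, 1, 1) \<notin> solid p"
  proof
    assume "v + unit x + (1, 1, 1) \<in> solid p"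
    then have "v + (1, 1, 1) \<in> solid p" unfolding v
      by (cases x) (simp_all, (erule solid_down; simp)+)
    then show False using assms(1) by (simp add: surf_def)
  qed
  then show ?thesis using assms by (simp add: exposed_def surf_def)
qed

text \<open>A diagonal over the hexagon passes through the box, and it does not meet the solid beyond
  the box.\<close>

lemma surf_in_box:
  assumes "surf p (x, y, z)" "proj (x, y, z) \<in> hexagon a b c"
  shows "0 \<le> x \<and> x \<le> int a \<and> 0 \<le> y \<and> y \<le> int b \<and> 0 \<le> z \<and> z \<le> int c"
proof -
  from assms(2) obtain i j k where ijk: "0 \<le> i" "i \<le> int a" "0 \<le> j" "j \<le> int b" "0 \<le> k" "k \<le> int c"
    "proj (x, y, z) = proj (i, j, k)" by (auto simp: hexagon_def)
  define t where "t = x - i"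
  have t: "x = i + t" "y = j + t" "z = k + t" using ijk(7) by (auto simp: t_def proj_eq)
  have pos: "0 \<le> x" "0 \<le> y" "0 \<le> z" using assms(1) by (auto simp: surf_def solid_def)
  show ?thesis
  proof (cases "t \<le> 0")
    case False
    then have "(x, y, z) \<in> solid p \<and> 0 < x \<and> 0 < y \<and> 0 < z" using assms(1) t ijk by (simp add: surf_def)
    then show ?thesis using solid_box[of x y z] by linarith
  qed (use t ijk pos in linarith)
qed

lemma exposed_E3:
  "exposed E3 (x, y, z) \<and> x \<le> int a \<and> y \<le> int b \<longleftrightarrow>
    (\<exists>i\<in>{1..a}. \<exists>j\<in>{1..b}. x = int i \<and> y = int j \<and> z = int (card {k. (i, j, k) \<in> p}))" (is "?l \<longleftrightarrow> ?r")
proof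
  assume l: ?l
  then have pos: "1 \<le> x" "1 \<le> y" "0 \<le> z" and np: "(nat x, nat y, nat (z + 1)) \<notin> p"
    and ip: "z = 0 \<or> (nat x, nat y, nat z) \<in> p"
    by (auto simp: exposed_def solid_def)
  have n: "1 \<le> nat x" "1 \<le> nat y" using pos by auto
  have "nat z = card {k. (nat x, nat y, k) \<in> p}"
    using np ip columns(1)[OF n, of "Suc (nat z)"] columns(1)[OF n, of "nat z"] pos
    by (auto simp: nat_add_distrib)
  then show ?r using pos l by (intro bexI[of _ "nat x"] bexI[of _ "nat y"]) auto
next
  assume ?r
  then obtain i j where ij: "i \<in> {1..a}" "j \<in> {1..b}" "x = int i" "y = int j"
    "z = int (card {k. (i, j, k) \<in> p})" by blast
  let ?n = "card {k. (i, j, k) \<in> p}"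
  have "?n = 0 \<or> (i, j, ?n) \<in> p" "(i, j, Suc ?n) \<notin> p"
    using columns(1)[of i j ?n] columns(1)[of i j "Suc ?n"] ij(1,2) by auto
  then show ?l using ij by (simp add: exposed_def solid_def nat_add_distrib)
qed

lemma exposed_E2:
  "exposed E2 (x, y, z) \<and> x \<le> int a \<and> z \<le> int c \<longleftrightarrow>
    (\<exists>i\<in>{1..a}. \<exists>k\<in>{1..c}. x = int i \<and> z = int k \<and> y = int (card {j. (i, j, k) \<in> p}))" (is "?l \<longleftrightarrow> ?r")
proof
  assume l: ?l
  then have pos: "1 \<le> x" "1 \<le> z" "0 \<le> y" and np: "(nat x, nat (y + 1), nat z) \<notin> p"
    and ip: "y = 0 \<or> (nat x, nat y, nat z) \<in> p"
    by (auto simp: exposed_def solid_def)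
  have n: "1 \<le> nat x" "1 \<le> nat z" using pos by auto
  have "nat y = card {j. (nat x, j, nat z) \<in> p}"
    using np ip columns(2)[OF n, of "Suc (nat y)"] columns(2)[OF n, of "nat y"] pos
    by (auto simp: nat_add_distrib)
  then show ?r using pos l by (intro bexI[of _ "nat x"] bexI[of _ "nat z"]) auto
next
  assume ?r
  then obtain i k where ij: "i \<in> {1..a}" "k \<in> {1..c}" "x = int i" "z = int k"
    "y = int (card {j. (i, j, k) \<in> p})" by blast
  let ?n = "card {j. (i, j, k) \<in> p}"
  have "?n = 0 \<or> (i, ?n, k) \<in> p" "(i, Suc ?n, k) \<notin> p"
    using columns(2)[of i k ?n] columns(2)[of i k "Suc ?n"] ij(1,2) by auto
  then show ?l using ij by (simp add: exposed_def solid_def nat_add_distrib)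
qed

lemma exposed_E1:
  "exposed E1 (x, y, z) \<and> y \<le> int b \<and> z \<le> int c \<longleftrightarrow>
    (\<exists>j\<in>{1..b}. \<exists>k\<in>{1..c}. y = int j \<and> z = int k \<and> x = int (card {i. (i, j, k) \<in> p}))" (is "?l \<longleftrightarrow> ?r")
proof
  assume l: ?l
  then have pos: "1 \<le> y" "1 \<le> z" "0 \<le> x" and np: "(nat (x + 1), nat y, nat z) \<notin> p"
    and ip: "x = 0 \<or> (nat x, nat y, nat z) \<in> p"
    by (auto simp: exposed_def solid_def)
  have n: "1 \<le> nat y" "1 \<le> nat z" using pos by auto
  have "nat x = card {i. (i, nat y, nat z) \<in> p}"
    using np ip columns(3)[OF n, of "Suc (nat x)"] columns(3)[OF n, of "nat x"] pos
    by (auto simp: nat_add_distrib)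
  then show ?r using pos l by (intro bexI[of _ "nat y"] bexI[of _ "nat z"]) auto
next
  assume ?r
  then obtain j k where ij: "j \<in> {1..b}" "k \<in> {1..c}" "y = int j" "z = int k"
    "x = int (card {i. (i, j, k) \<in> p})" by blast
  let ?n = "card {i. (i, j, k) \<in> p}"
  have "?n = 0 \<or> (?n, j, k) \<in> p" "(Suc ?n, j, k) \<notin> p"
    using columns(3)[of j k ?n] columns(3)[of j k "Suc ?n"] ij(1,2) by auto
  then show ?l using ij by (simp add: exposed_def solid_def nat_add_distrib)
qed

end

lemma quad_eq:
  "quad (E1, (X, Y)) = {(X, Y), (X + 1, Y - 1), (X, Y - 2), (X + 1, Y + 1)}"
  "quad (E2, (X, Y)) = {(X, Y), (X - 1, Y - 1), (X - 1, Y + 1), (X, Y - 2)}"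
  "quad (E3, (X, Y)) = {(X, Y), (X, Y + 2), (X + 1, Y + 1), (X - 1, Y + 1)}"
  by (auto simp: quad_def)

lemma sum_quad:
  "sum fst (quad (x, (X, Y))) = 4 * X + (case x of E1 \<Rightarrow> 2 | E2 \<Rightarrow> -2 | E3 \<Rightarrow> 0)"
  "sum snd (quad (x, (X, Y))) = 4 * Y + (case x of E1 \<Rightarrow> -2 | E2 \<Rightarrow> -2 | E3 \<Rightarrow> 4)"
  by (cases x; simp add: quad_eq)+

lemma quad_inject: "quad (x, A) = quad (y, B) \<longleftrightarrow> x = y \<and> A = B"
proof
  assume eq: "quad (x, A) = quad (y, B)"
  obtain X Y X' Y' where AB: "A = (X, Y)" "B = (X', Y')" by (cases A, cases B)
  \<comment> \<open>Equal coordinate sums leave, apart from equality, only a rhombus of axis E1 at A and one of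
    axis E2 at A + (1, 0). These have no corner in common, by parity.\<close>
  have sums: "4 * X + (case x of E1 \<Rightarrow> 2 | E2 \<Rightarrow> -2 | E3 \<Rightarrow> 0) = 4 * X' + (case y of E1 \<Rightarrow> 2 | E2 \<Rightarrow> -2 | E3 \<Rightarrow> 0)"
    "4 * Y + (case x of E1 \<Rightarrow> -2 | E2 \<Rightarrow> -2 | E3 \<Rightarrow> 4) = 4 * Y' + (case y of E1 \<Rightarrow> -2 | E2 \<Rightarrow> -2 | E3 \<Rightarrow> 4)"
    using arg_cong[OF eq, of "sum fst"] arg_cong[OF eq, of "sum snd"] unfolding AB sum_quad by blast+
  have self: "C \<in> quad (z, C)" for z C by (cases z; cases C; simp add: quad_eq)
  have "A \<in> quad (y, B)" "B \<in> quad (x, A)" using self eq by metis+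
  then show "x = y \<and> A = B"
    using sums unfolding AB by (cases x; cases y; simp add: quad_eq; presburger?)
qed simp

lemma quad_faces:
  "proj ` ({i - 1, i} \<times> {j - 1, j} \<times> {k}) = quad (E3, proj (i, j, k))"
  "proj ` ({i - 1, i} \<times> {j} \<times> {k - 1, k}) = quad (E2, proj (i, j, k))"
  "proj ` ({i} \<times> {j - 1, j} \<times> {k - 1, k}) = quad (E1, proj (i, j, k))"
  by (auto simp: quad_eq proj_eq)

text \<open>A lozenge is the projection of a visible unit square, and its short diagonal starts at the
  projection of the greatest corner of the square.\<close>

lemma (in boxed_partition) hourglass_iff:
  assumes "surf p v" "proj v \<in> hexagon a b c"
  shows "hourglass_at (lozenges a b c p) (x, proj v) \<longleftrightarrow> exposed x v"
proof -
  obtain i j k where v: "v = (i, j, k)" by (cases v)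
  note box = surf_in_box[OF assms[unfolded v]]
  have un: "proj v = proj v' \<and> exposed x v' \<longleftrightarrow> v = v' \<and> exposed x v" for v' x
    using surf_unique[OF assms(1)] exposed_iff by blast
  have "hourglass_at (lozenges a b c p) (x, proj v) \<longleftrightarrow> quad (x, proj v) \<in> lozenges a b c p"
    by (simp add: hourglass_at_def quad_def)
  also have "\<dots> \<longleftrightarrow> (case x of
      E3 \<Rightarrow> \<exists>i\<in>{1..a}. \<exists>j\<in>{1..b}. proj v = proj (int i, int j, int (card {k. (i, j, k) \<in> p}))
    | E2 \<Rightarrow> \<exists>i\<in>{1..a}. \<exists>k\<in>{1..c}. proj v = proj (int i, int (card {j. (i, j, k) \<in> p}), int k)
    | E1 \<Rightarrow> \<exists>j\<in>{1..b}. \<exists>k\<in>{1..c}. proj v = proj (int (card {i. (i, j, k) \<in> p}), int j, int k))"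
    unfolding lozenges_def quad_faces
    by (cases x) (simp_all add: image_iff case_prod_beta split_paired_Bex_Sigma quad_inject)
  also have "\<dots> \<longleftrightarrow> exposed x v"
  proof (cases x)
    case E1
    have "exposed E1 (int (card {i. (i, j, k) \<in> p}), int j, int k)" if "j \<in> {1..b}" "k \<in> {1..c}" for j k
      using exposed_E1[of "int (card {i. (i, j, k) \<in> p})" "int j" "int k"] that by auto
    then show ?thesis using un[of _ E1] exposed_E1[of i j k] box unfolding E1 v axis.case
      by (metis (no_types, lifting))
  next
    case E2
    have "exposed E2 (int i, int (card {j. (i, j, k) \<in> p}), int k)" if "i \<in> {1..a}" "k \<in> {1..c}" for i k
      using exposed_E2[of "int i" "int (card {j. (i, j, k) \<in> p})" "int k"] that by auto
    then show ?thesis using un[of _ E2] exposed_E2[of i j k] box unfolding E2 v axis.case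
      by (metis (no_types, lifting))
  next
    case E3
    have "exposed E3 (int i, int j, int (card {k. (i, j, k) \<in> p}))" if "i \<in> {1..a}" "j \<in> {1..b}" for i j
      using exposed_E3[of "int i" "int j" "int (card {k. (i, j, k) \<in> p})"] that by auto
    then show ?thesis using un[of _ E3] exposed_E3[of i j k] box unfolding E3 v axis.case
      by (metis (no_types, lifting))
  qed
  finally show ?thesis .
qed

section \<open>Domains in the hexagon\<close>

lemma hexagon_iff:
  "(X, Y) \<in> hexagon a b c \<longleftrightarrow> even (X + Y) \<and> - int b \<le> X \<and> X \<le> int a \<and>
     - (2 * int b) \<le> X + Y \<and> X - Y \<le> 2 * int a \<and> X + Y \<le> 2 * int c \<and> Y - X \<le> 2 * int c"
  (is "?l \<longleftrightarrow> ?r")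
proof
  assume ?l
  then obtain x y z where "0 \<le> x" "x \<le> int a" "0 \<le> y" "y \<le> int b" "0 \<le> z" "z \<le> int c" "X = x - y" "Y = 2 * z - x - y"
    by (auto simp: hexagon_def proj_eq)
  then show ?r by auto
next
  assume r: ?r
  define H where "H = (X + Y) div 2"
  have H: "X + Y = 2 * H" using r by (simp add: H_def)
  define y where "y = max 0 (max (- X) (- H))"
  have "(X, Y) = proj (X + y, y, y + H)" using H by (simp add: proj_eq)
  moreover have "X + y \<in> {0..int a}" "y \<in> {0..int b}" "y + H \<in> {0..int c}" using r H by (auto simp: y_def)
  ultimately show ?l unfolding hexagon_def by blast
qed

lemma hexagon_even: "A \<in> hexagon a b c \<Longrightarrow> even (fst A + snd A)"
  by (cases A) (auto simp: hexagon_iff)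

lemma finite_triangles_in:
  assumes "finite S"
  shows "finite (triangles_in S)"
proof -
  have "triangles_in S \<subseteq> White ` S \<union> Black ` S"
  proof
    fix t assume "t \<in> triangles_in S"
    then show "t \<in> White ` S \<union> Black ` S" by (cases t) (auto simp: triangles_in_def)
  qed
  then show ?thesis using assms finite_subset by blast
qed

lemma side_at_corner: "snd (side_at \<tau> x) \<in> corners \<tau>"
  by (cases \<tau>; cases x; simp; simp add: algebra_simps prod_eq_iff)

definition lift_coordinate :: "pp \<Rightarrow> axis \<Rightarrow> point \<Rightarrow> int" where
  "lift_coordinate p w A = crd w (lift p A)"

lemma crd_simps: "crd w (v + v') = crd w v + crd w v'" "crd w (v - v') = crd w v - crd w v'"
  "crd w (unit x) = of_bool (x = w)" "crd w (1, 1, 1) = 1"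
proof -
  show "crd w (v + v') = crd w v + crd w v'" "crd w (v - v') = crd w v - crd w v'"
    by (cases v; cases v'; cases w; simp)+
  show "crd w (unit x) = of_bool (x = w)" by (cases w; cases x; simp)
  show "crd w (1, 1, 1) = 1" by (cases w; simp)
qed

context boxed_partition
begin

text \<open>Along an edge of the surface the lifted point moves by a unit vector. Along the short diagonal of
  a lozenge it moves from the greatest corner of a square to the least one.\<close>

lemma lift_step_cases:
  assumes "A \<in> hexagon a b c"
  shows "lift_coordinate p w (A + vec x) - lift_coordinate p w A =
    of_bool (x = w) - of_bool (hourglass_at (lozenges a b c p) (x, A))"
proof -
  have v: "surf p (lift p A)" "proj (lift p A) = A" using lift_surf hexagon_even assms by blast+
  have hg: "hourglass_at (lozenges a b c p) (x, A) \<longleftrightarrow> exposed x (lift p A)"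
    using hourglass_iff[of "lift p A" x] v assms by simp
  show ?thesis
  proof (cases "exposed x (lift p A)")
    case True
    then have "lift p (A + vec x) = lift p A + unit x - (1, 1, 1)"
      using exposed_iff proj_unit v by (intro lift_eqI) auto
    then show ?thesis using hg True by (simp add: lift_coordinate_def crd_simps)
  next
    case False
    then have "lift p (A + vec x) = lift p A + unit x"
      using surf_step proj_unit v by (intro lift_eqI) auto
    then show ?thesis using hg False by (simp add: lift_coordinate_def crd_simps)
  qed
qed

lemma web_domainI:
  assumes D_def: "D = triangles_in (hexagon a b c \<inter> S)"
    and "distinct bd"
    and "\<And>s. s \<in> set bd \<longleftrightarrow> (white_tri s \<in> D \<longleftrightarrow> black_tri s \<notin> D)"
    and "side_chain D P bd P"
    and "sorted (map (turning_rank D) bd)"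
    and "\<And>s. s \<in> set bd \<Longrightarrow> fst s = E2 \<Longrightarrow> white_tri s \<in> D"
    and "\<And>s. s \<in> set bd \<Longrightarrow> hourglass_at (lozenges a b c p) s \<Longrightarrow>
      (fst s = E1 \<longrightarrow> white_tri s \<notin> D) \<and> (fst s = E3 \<longrightarrow> white_tri s \<in> D)"
  shows "web_domain (lozenges a b c p) D P bd (lift_coordinate p)"
proof
  show "finite D" unfolding D_def by (intro finite_triangles_in finite_Int) (simp add: hexagon_def)
  show "diff (lift_coordinate p w) (side_at \<tau> x) = of_bool (x = w) - of_bool (hourglass_at (lozenges a b c p) (side_at \<tau> x))"
    if "\<tau> \<in> D" for \<tau> x w
  proof -
    have "snd (side_at \<tau> x) \<in> hexagon a b c"
      using that side_at_corner[of \<tau> x] by (auto simp: D_def triangles_in_def)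
    moreover have "side_at \<tau> x = (x, snd (side_at \<tau> x))" using fst_side_at by (metis prod.collapse)
    ultimately show ?thesis using lift_step_cases[of "snd (side_at \<tau> x)" w x] by (simp add: diff_def)
  qed
qed (fact assms)+

end

section \<open>Lattice paths\<close>

definition stride :: "point \<Rightarrow> nat \<Rightarrow> point \<Rightarrow> point" where
  "stride A n v = (fst A + int n * fst v, snd A + int n * snd v)"

lemma stride_simps [simp]: "stride A 0 v = A" "stride (A + v) n v = stride A (Suc n) v" "stride (A - v) n (- v) = stride A (Suc n) (- v)"
  by (auto simp: stride_def algebra_simps prod_eq_iff)

lemma stride_pair: "stride (X, Y) n (x, y) = (X + int n * x, Y + int n * y)"
  by (simp add: stride_def)

fun path_end :: "point \<Rightarrow> step list \<Rightarrow> point" where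
  "path_end A [] = A"
| "path_end A (Fwd x # ss) = path_end (A + vec x) ss"
| "path_end A (Bwd x # ss) = path_end (A - vec x) ss"

text \<open>The domain is on the right of the path: forward sides have their white triangle in the domain,
  backward sides do not.\<close>

fun oriented :: "triangle set \<Rightarrow> point \<Rightarrow> step list \<Rightarrow> bool" where
  "oriented D A [] \<longleftrightarrow> True"
| "oriented D A (Fwd x # ss) \<longleftrightarrow> white_tri (x, A) \<in> D \<and> oriented D (A + vec x) ss"
| "oriented D A (Bwd x # ss) \<longleftrightarrow> white_tri (x, A - vec x) \<notin> D \<and> oriented D (A - vec x) ss"

definition run_fwd :: "axis \<Rightarrow> point \<Rightarrow> nat \<Rightarrow> side list" where
  "run_fwd x A n = map (\<lambda>i. (x, stride A i (vec x))) [0..<n]"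

definition run_bwd :: "axis \<Rightarrow> point \<Rightarrow> nat \<Rightarrow> side list" where
  "run_bwd x A n = map (\<lambda>i. (x, stride A (Suc i) (- vec x))) [0..<n]"

lemma run_fwd_Suc: "run_fwd x A (Suc n) = (x, A) # run_fwd x (A + vec x) n"
  unfolding run_fwd_def upt_conv_Cons[OF zero_less_Suc] map_Suc_upt[symmetric]
  by (simp del: upt_Suc vec_eq)

lemma run_bwd_Suc: "run_bwd x A (Suc n) = (x, A - vec x) # run_bwd x (A - vec x) n"
  unfolding run_bwd_def upt_conv_Cons[OF zero_less_Suc] map_Suc_upt[symmetric]
  by (simp del: upt_Suc vec_eq) (simp add: stride_def prod_eq_iff)

lemma path_sides_fwd [simp]:
  "path_sides A (replicate n (Fwd x) @ ss) = run_fwd x A n @ path_sides (stride A n (vec x)) ss"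
  by (induction n arbitrary: A) (simp add: run_fwd_def, simp add: run_fwd_Suc)

lemma path_sides_bwd [simp]:
  "path_sides A (replicate n (Bwd x) @ ss) = run_bwd x A n @ path_sides (stride A n (- vec x)) ss"
  by (induction n arbitrary: A) (simp add: run_bwd_def, simp add: run_bwd_Suc)

lemma path_end_fwd [simp]: "path_end A (replicate n (Fwd x) @ ss) = path_end (stride A n (vec x)) ss"
  by (induction n arbitrary: A) simp_all

lemma path_end_bwd [simp]: "path_end A (replicate n (Bwd x) @ ss) = path_end (stride A n (- vec x)) ss"
  by (induction n arbitrary: A) simp_all

lemma side_chain_path: "oriented D A ss \<Longrightarrow> side_chain D A (path_sides A ss) (path_end A ss)"
proof (induction ss arbitrary: A)
  case (Cons st ss)
  then show ?case by (cases st) (auto simp: first_end_def last_end_def)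
qed simp

lemma oriented_fwd [simp]: "oriented D A (replicate n (Fwd x) @ ss) \<longleftrightarrow>
    (\<forall>s\<in>set (run_fwd x A n). white_tri s \<in> D) \<and> oriented D (stride A n (vec x)) ss"
  by (induction n arbitrary: A) (simp add: run_fwd_def, simp add: run_fwd_Suc)

lemma oriented_bwd [simp]: "oriented D A (replicate n (Bwd x) @ ss) \<longleftrightarrow>
    (\<forall>s\<in>set (run_bwd x A n). white_tri s \<notin> D) \<and> oriented D (stride A n (- vec x)) ss"
  by (induction n arbitrary: A) (simp add: run_bwd_def, simp add: run_bwd_Suc)

lemma in_run:
  "(y, X', Y') \<in> set (run_fwd E1 (X, Y) n) \<longleftrightarrow> y = E1 \<and> X \<le> X' \<and> X' < X + int n \<and> X' + Y' = X + Y"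
  "(y, X', Y') \<in> set (run_fwd E2 (X, Y) n) \<longleftrightarrow> y = E2 \<and> X - int n < X' \<and> X' \<le> X \<and> X' - Y' = X - Y"
  "(y, X', Y') \<in> set (run_fwd E3 (X, Y) n) \<longleftrightarrow> y = E3 \<and> X' = X \<and> Y \<le> Y' \<and> Y' < Y + 2 * int n \<and> even (Y' - Y)"
  "(y, X', Y') \<in> set (run_bwd E1 (X, Y) n) \<longleftrightarrow> y = E1 \<and> X - int n \<le> X' \<and> X' < X \<and> X' + Y' = X + Y"
  "(y, X', Y') \<in> set (run_bwd E3 (X, Y) n) \<longleftrightarrow> y = E3 \<and> X' = X \<and> Y - 2 * int n \<le> Y' \<and> Y' < Y \<and> even (Y' - Y)"
proof -
  have nat_ex: "(\<exists>i. i < n \<and> k = int i) \<longleftrightarrow> 0 \<le> k \<and> k < int n" for k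
    by (metis nonneg_int_cases of_nat_0_le_iff of_nat_less_iff)
  have mem_fwd: "(y, A') \<in> set (run_fwd x A n) \<longleftrightarrow> y = x \<and> (\<exists>k. (\<exists>i. i < n \<and> k = int i) \<and> A' = (fst A + k * fst (vec x), snd A + k * snd (vec x)))" for x A A'
  proof -
    have "(y, A') \<in> set (run_fwd x A n) \<longleftrightarrow> (\<exists>i<n. (y, A') = (x, stride A i (vec x)))"
      unfolding run_fwd_def by auto
    then show ?thesis unfolding stride_def by blast
  qed
  have mem_bwd: "(y, A') \<in> set (run_bwd x A n) \<longleftrightarrow> y = x \<and> (\<exists>k. (\<exists>i. i < n \<and> k = int i) \<and> A' = (fst A - (1 + k) * fst (vec x), snd A - (1 + k) * snd (vec x)))" for x A A'
  proof -
    have "stride A (Suc i) (- vec x) = (fst A - (1 + int i) * fst (vec x), snd A - (1 + int i) * snd (vec x))" for i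
      by (simp add: stride_def algebra_simps)
    moreover have "(y, A') \<in> set (run_bwd x A n) \<longleftrightarrow> (\<exists>i<n. (y, A') = (x, stride A (Suc i) (- vec x)))"
      unfolding run_bwd_def by auto
    ultimately show ?thesis by (metis (no_types, lifting) Pair_inject)
  qed
  show "(y, X', Y') \<in> set (run_fwd E1 (X, Y) n) \<longleftrightarrow> y = E1 \<and> X \<le> X' \<and> X' < X + int n \<and> X' + Y' = X + Y"
    unfolding mem_fwd nat_ex by (auto intro: exI[of _ "X' - X"])
  show "(y, X', Y') \<in> set (run_fwd E2 (X, Y) n) \<longleftrightarrow> y = E2 \<and> X - int n < X' \<and> X' \<le> X \<and> X' - Y' = X - Y"
    unfolding mem_fwd nat_ex by (auto intro: exI[of _ "X - X'"])
  show "(y, X', Y') \<in> set (run_fwd E3 (X, Y) n) \<longleftrightarrow> y = E3 \<and> X' = X \<and> Y \<le> Y' \<and> Y' < Y + 2 * int n \<and> even (Y' - Y)"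
    unfolding mem_fwd nat_ex by (auto intro!: exI[of _ "(Y' - Y) div 2"])
  show "(y, X', Y') \<in> set (run_bwd E1 (X, Y) n) \<longleftrightarrow> y = E1 \<and> X - int n \<le> X' \<and> X' < X \<and> X' + Y' = X + Y"
    unfolding mem_bwd nat_ex by (auto intro: exI[of _ "X - X' - 1"])
  show "(y, X', Y') \<in> set (run_bwd E3 (X, Y) n) \<longleftrightarrow> y = E3 \<and> X' = X \<and> Y - 2 * int n \<le> Y' \<and> Y' < Y \<and> even (Y' - Y)"
    unfolding mem_bwd nat_ex by (auto intro!: exI[of _ "(Y - Y') div 2 - 1"]; presburger)
qed

lemma distinct_run: "distinct (run_fwd x A n)" "distinct (run_bwd x A n)"
  unfolding run_fwd_def run_bwd_def distinct_map
  by (cases x; auto intro!: inj_onI simp: stride_def)+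

lemma sorted_constant: "(\<And>s. s \<in> set ss \<Longrightarrow> f s = r) \<Longrightarrow> sorted (map f ss)" for r :: nat
  by (induction ss) auto

lemma White_in: "White (X, Y) \<in> triangles_in (hexagon a b c \<inter> S) \<longleftrightarrow>
    {(X, Y), (X, Y + 2), (X + 1, Y + 1)} \<subseteq> hexagon a b c \<inter> S"
  by (simp add: triangles_in_def add.commute[of Y 1])

lemma Black_in: "Black (X, Y) \<in> triangles_in (hexagon a b c \<inter> S) \<longleftrightarrow>
    {(X, Y), (X, Y + 2), (X - 1, Y + 1)} \<subseteq> hexagon a b c \<inter> S"
  by (simp add: triangles_in_def add.commute[of Y 1])

lemma length_run [simp]: "length (run_fwd x A n) = n" "length (run_bwd x A n) = n"
  by (simp_all add: run_fwd_def run_bwd_def)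

lemma run_axis: "s \<in> set (run_fwd x A n) \<Longrightarrow> fst s = x" "s \<in> set (run_bwd x A n) \<Longrightarrow> fst s = x"
  by (auto simp: run_fwd_def run_bwd_def)

lemma map_constant:
  assumes "\<And>s. s \<in> set ss \<Longrightarrow> f s = x"
  shows "map f ss = replicate (length ss) x"
  using assms by (induction ss) auto

section \<open>Heights along the cuts\<close>

context boxed_partition
begin

lemma exposed_pos: "exposed x (i, j, k) \<Longrightarrow> (x \<noteq> E1 \<longrightarrow> 1 \<le> i) \<and> (x \<noteq> E2 \<longrightarrow> 1 \<le> j) \<and> (x \<noteq> E3 \<longrightarrow> 1 \<le> k)"
  by (cases x) (auto simp: exposed_def solid_def)

lemma hourglass_iff_exposed:
  assumes "A \<in> hexagon a b c"
  shows "hourglass_at (lozenges a b c p) (x, A) \<longleftrightarrow> exposed x (lift p A)"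
  using hourglass_iff[of "lift p A" x] lift_surf hexagon_even assms by metis

text \<open>One of the two triangles at such a side lies outside of the hexagon.\<close>

lemma no_hourglass_on_border:
  assumes "(X, Y) \<in> hexagon a b c"
    and "x = E1 \<and> X + Y = 2 * int c \<or> x = E3 \<and> X = int a \<or> x = E2 \<and> X - Y = 2 * int a"
  shows "\<not> hourglass_at (lozenges a b c p) (x, (X, Y))"
proof -
  obtain i j k where v: "lift p (X, Y) = (i, j, k)" by (cases "lift p (X, Y)")
  then have "surf p (i, j, k)" "proj (i, j, k) = (X, Y)" using lift_surf[of "(X, Y)"] hexagon_even[OF assms(1)] by simp_all
  moreover from this have "0 \<le> i \<and> i \<le> int a \<and> 0 \<le> j \<and> j \<le> int b \<and> 0 \<le> k \<and> k \<le> int c"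
    using surf_in_box assms(1) by simp
  ultimately show ?thesis
    using assms(2) exposed_pos[of x i j k] unfolding hourglass_iff_exposed[OF assms(1)] v
    by (auto simp: proj_eq)
qed

text \<open>The heights of the surface over the vertical cut and over the ray at 60 degrees from it. The
  surface points are (n, n, n + t) and (r + k, r, r + k).\<close>

definition n_cut :: "int \<Rightarrow> int" where
  "n_cut t = lift_coordinate p E1 (0, 2 * t)"

definition r_cut :: "int \<Rightarrow> int" where
  "r_cut k = lift_coordinate p E2 (k, k)"

lemma hourglass_vertical:
  assumes "(0, 2 * t) \<in> hexagon a b c"
  shows "of_bool (hourglass_at (lozenges a b c p) (E3, (0, 2 * t))) = n_cut t - n_cut (t + 1)"
  using lift_step_cases[OF assms, of E1 E3] by (simp add: n_cut_def algebra_simps)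

lemma hourglass_slanted:
  assumes "(k + 1, k + 1) \<in> hexagon a b c"
  shows "of_bool (hourglass_at (lozenges a b c p) (E2, (k + 1, k + 1))) = 1 - (r_cut k - r_cut (k + 1))"
  using lift_step_cases[OF assms, of E2 E2] by (simp add: r_cut_def algebra_simps)

end

lemma path_sides_fwd' [simp]: "path_sides A (replicate n (Fwd x)) = run_fwd x A n"
  using path_sides_fwd[of A n x "[]"] by simp

lemma path_end_fwd' [simp]: "path_end A (replicate n (Fwd x)) = stride A n (vec x)"
  using path_end_fwd[of A n x "[]"] by simp

lemma oriented_fwd' [simp]: "oriented D A (replicate n (Fwd x)) \<longleftrightarrow> (\<forall>s\<in>set (run_fwd x A n). white_tri s \<in> D)"
  using oriented_fwd[of D A n x "[]"] by simp

section \<open>The boundary words in terms of the heights\<close>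

definition SPP_domain :: "nat \<Rightarrow> nat \<Rightarrow> triangle set" where
  "SPP_domain a c = triangles_in (hexagon a a c \<inter> {(X, Y). 0 \<le> X})"

definition SPP_boundary :: "nat \<Rightarrow> nat \<Rightarrow> side list" where
  "SPP_boundary a c = run_fwd E1 (0, 2 * int c) a @ run_bwd E3 (int a, 2 * int c - int a) c @
     run_fwd E2 (int a, - int a) a @ run_fwd E3 (0, - 2 * int a) (a + c)"

lemma SPP_White: "White (X, Y) \<in> SPP_domain a c \<longleftrightarrow>
  even (X + Y) \<and> 0 \<le> X \<and> X < int a \<and> X - Y \<le> 2 * int a \<and> X + Y < 2 * int c"
  unfolding SPP_domain_def White_in by (simp add: hexagon_iff; auto; presburger)

lemma SPP_Black: "Black (X, Y) \<in> SPP_domain a c \<longleftrightarrow>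
  even (X + Y) \<and> 1 \<le> X \<and> X \<le> int a \<and> X - Y \<le> 2 * int a \<and> X + Y < 2 * int c"
  unfolding SPP_domain_def Black_in by (simp add: hexagon_iff; auto; presburger)

lemma SPP_boundary_iff:
  assumes "1 \<le> a"
  shows "s \<in> set (SPP_boundary a c) \<longleftrightarrow> (white_tri s \<in> SPP_domain a c \<longleftrightarrow> black_tri s \<notin> SPP_domain a c)"
proof -
  obtain x X Y where s: "s = (x, X, Y)" by (cases s)
  show ?thesis using assms unfolding s SPP_boundary_def set_append Un_iff in_run
    by (cases x; simp add: SPP_White SPP_Black; auto; presburger)
qed

definition SPP_path :: "nat \<Rightarrow> nat \<Rightarrow> step list" where
  "SPP_path a c = replicate a (Fwd E1) @ replicate c (Bwd E3) @ replicate a (Fwd E2) @ replicate (a + c) (Fwd E3)"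

lemma SPP_white_sides:
  assumes "1 \<le> a"
  shows "s \<in> set (run_bwd E3 (int a, 2 * int c - int a) c) \<Longrightarrow> white_tri s \<notin> SPP_domain a c"
  "s \<in> set (run_fwd E1 (0, 2 * int c) a) \<Longrightarrow> white_tri s \<in> SPP_domain a c"
  "s \<in> set (run_fwd E2 (int a, - int a) a) \<Longrightarrow> white_tri s \<in> SPP_domain a c"
  "s \<in> set (run_fwd E3 (0, - 2 * int a) (a + c)) \<Longrightarrow> white_tri s \<in> SPP_domain a c"
proof -
  obtain x X Y where s: "s = (x, X, Y)" by (cases s)
  show "s \<in> set (run_bwd E3 (int a, 2 * int c - int a) c) \<Longrightarrow> white_tri s \<notin> SPP_domain a c"
    unfolding s in_run using assms by (elim conjE; simp add: SPP_White; presburger?)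
  show "s \<in> set (run_fwd E1 (0, 2 * int c) a) \<Longrightarrow> white_tri s \<in> SPP_domain a c"
    unfolding s in_run using assms by (elim conjE; simp add: SPP_White; presburger?)
  show "s \<in> set (run_fwd E2 (int a, - int a) a) \<Longrightarrow> white_tri s \<in> SPP_domain a c"
    unfolding s in_run using assms by (elim conjE; simp add: SPP_White; presburger?)
  show "s \<in> set (run_fwd E3 (0, - 2 * int a) (a + c)) \<Longrightarrow> white_tri s \<in> SPP_domain a c"
    unfolding s in_run using assms by (elim conjE; simp add: SPP_White; presburger?)
qed

lemma SPP_path_sides: "path_sides (0, 2 * int c) (SPP_path a c) = SPP_boundary a c"
  by (simp add: SPP_path_def SPP_boundary_def stride_pair algebra_simps)

lemma SPP_chain:
  assumes "1 \<le> a"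
  shows "side_chain (SPP_domain a c) (0, 2 * int c) (SPP_boundary a c) (0, 2 * int c)"
proof -
  have "path_end (0, 2 * int c) (SPP_path a c) = (0, 2 * int c)"
    by (simp add: SPP_path_def stride_pair algebra_simps)
  moreover have "oriented (SPP_domain a c) (0, 2 * int c) (SPP_path a c)"
    using SPP_white_sides[OF assms, where c = c] by (simp add: SPP_path_def stride_pair algebra_simps)
  ultimately show ?thesis using side_chain_path SPP_path_sides by metis
qed

lemma SPP_ranks:
  assumes "1 \<le> a"
  shows "s \<in> set (run_fwd E1 (0, 2 * int c) a) \<Longrightarrow> turning_rank (SPP_domain a c) s = 0"
  "s \<in> set (run_bwd E3 (int a, 2 * int c - int a) c) \<Longrightarrow> turning_rank (SPP_domain a c) s = 1"
  "s \<in> set (run_fwd E2 (int a, - int a) a) \<Longrightarrow> turning_rank (SPP_domain a c) s = 1"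
  "s \<in> set (run_fwd E3 (0, - 2 * int a) (a + c)) \<Longrightarrow> turning_rank (SPP_domain a c) s = 3"
  by (simp_all add: turning_rank.simps SPP_white_sides[OF assms] run_axis del: white_tri.simps)

lemma sorted_appendI:
  "sorted xs \<Longrightarrow> sorted ys \<Longrightarrow> (\<And>x y. x \<in> set xs \<Longrightarrow> y \<in> set ys \<Longrightarrow> x \<le> y) \<Longrightarrow> sorted (xs @ ys)" for xs :: "nat list"
  by (simp add: sorted_append)

context boxed_partition
begin

definition vertical_letters :: "int \<Rightarrow> letter list" where
  "vertical_letters t = (if n_cut t \<noteq> n_cut (t + 1) then [Plain 3, Plain 4] else [Plain 4])"

definition slanted_letters :: "int \<Rightarrow> letter list" where
  "slanted_letters k = (if r_cut k = r_cut (k + 1) then [Plain 2, Plain 3] else [Plain 2])"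

lemma map_vertical_letters:
  assumes "\<And>s. s \<in> set (run_fwd E3 (0, 2 * t) m) \<Longrightarrow> white_tri s \<in> D"
    and "\<And>i. i < m \<Longrightarrow> (0, 2 * (t + int i)) \<in> hexagon a b c"
  shows "map (side_letters (lozenges a b c p) D) (run_fwd E3 (0, 2 * t) m) = map (\<lambda>i. vertical_letters (t + int i)) [0..<m]"
proof -
  have "side_letters (lozenges a b c p) D (E3, stride (0, 2 * t) i (vec E3)) = vertical_letters (t + int i)" if i: "i < m" for i
  proof -
    let ?s = "(E3, stride (0, 2 * t) i (vec E3))"
    have s: "?s = (E3, (0, 2 * (t + int i)))" by (simp add: stride_pair)
    have "?s \<in> set (run_fwd E3 (0, 2 * t) m)" using i by (auto simp: run_fwd_def)
    from assms(1)[OF this] have w: "white_tri ?s \<in> D" .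
    have "hourglass_at (lozenges a b c p) ?s \<longleftrightarrow> n_cut (t + int i) \<noteq> n_cut (t + int i + 1)"
      using hourglass_vertical[OF assms(2)[OF i]] unfolding s by (auto simp: of_bool_def split: if_splits)
    then show ?thesis using w by (simp add: side_letters_def vertical_letters_def del: white_tri.simps)
  qed
  then show ?thesis by (simp add: run_fwd_def)
qed

lemma SPP_no_hourglass:
  assumes "b = a"
  shows "s \<in> set (run_fwd E1 (0, 2 * int c) a) \<Longrightarrow> \<not> hourglass_at (lozenges a b c p) s"
    "s \<in> set (run_bwd E3 (int a, 2 * int c - int a) c) \<Longrightarrow> \<not> hourglass_at (lozenges a b c p) s"
    "s \<in> set (run_fwd E2 (int a, - int a) a) \<Longrightarrow> \<not> hourglass_at (lozenges a b c p) s"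
proof -
  obtain x X Y where s: "s = (x, X, Y)" by (cases s)
  show "s \<in> set (run_fwd E1 (0, 2 * int c) a) \<Longrightarrow> \<not> hourglass_at (lozenges a b c p) s"
    "s \<in> set (run_bwd E3 (int a, 2 * int c - int a) c) \<Longrightarrow> \<not> hourglass_at (lozenges a b c p) s"
    "s \<in> set (run_fwd E2 (int a, - int a) a) \<Longrightarrow> \<not> hourglass_at (lozenges a b c p) s"
    unfolding s in_run by (rule no_hourglass_on_border; auto simp: hexagon_iff assms; presburger?)+
qed

lemma SPP_web_domain:
  assumes "b = a" "1 \<le> a"
  shows "web_domain (lozenges a b c p) (SPP_domain a c) (0, 2 * int c) (SPP_boundary a c) (lift_coordinate p)"
proof (rule web_domainI)
  show "SPP_domain a c = triangles_in (hexagon a b c \<inter> {(X, Y). 0 \<le> X})"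
    by (simp add: SPP_domain_def assms)
  show "distinct (SPP_boundary a c)"
    unfolding SPP_boundary_def using assms(2) by (auto simp: distinct_run in_run)
  show "s \<in> set (SPP_boundary a c) \<longleftrightarrow> (white_tri s \<in> SPP_domain a c \<longleftrightarrow> black_tri s \<notin> SPP_domain a c)" for s
    by (rule SPP_boundary_iff[OF assms(2)])
  show "side_chain (SPP_domain a c) (0, 2 * int c) (SPP_boundary a c) (0, 2 * int c)" by (rule SPP_chain[OF assms(2)])
  show "sorted (map (turning_rank (SPP_domain a c)) (SPP_boundary a c))"
    unfolding SPP_boundary_def map_append
    by (intro sorted_appendI sorted_constant) (auto simp: SPP_ranks[OF assms(2)])
  show "white_tri s \<in> SPP_domain a c" if "s \<in> set (SPP_boundary a c)" "fst s = E2" for s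
    using that(1) unfolding SPP_boundary_def set_append
    by (elim UnE) (use that(2) in \<open>simp_all add: SPP_white_sides[OF assms(2)] run_axis del: white_tri.simps\<close>)
  show "(fst s = E1 \<longrightarrow> white_tri s \<notin> SPP_domain a c) \<and> (fst s = E3 \<longrightarrow> white_tri s \<in> SPP_domain a c)"
    if "s \<in> set (SPP_boundary a c)" "hourglass_at (lozenges a b c p) s" for s
    using that(1) unfolding SPP_boundary_def set_append
    by (elim UnE) (use that(2) in \<open>simp_all add: SPP_white_sides[OF assms(2)] run_axis SPP_no_hourglass[OF assms(1)] del: white_tri.simps\<close>)
qed

text \<open>Hourglasses are cut only on the vertical line, at the drops of \<open>n_cut\<close>.\<close>

lemma SPP_word:
  assumes "b = a" "1 \<le> a"
  shows "boundary_word (SPP_web a c p) =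
    replicate a [Plain 1] @ replicate c [Barred 4] @ replicate a [Plain 2] @
    map (\<lambda>i. vertical_letters (- int a + int i)) [0..<a + c]"
proof -
  interpret web_domain "lozenges a b c p" "SPP_domain a c" "(0, 2 * int c)" "SPP_boundary a c" "lift_coordinate p"
    using SPP_web_domain[OF assms] .
  have "SPP_web a c p = web (lozenges a b c p) (SPP_domain a c) (0, 2 * int c) (SPP_boundary a c)"
    unfolding SPP_web_def restricted_web_def Let_def SPP_path_def[symmetric] assms
    by (simp add: proj_eq SPP_path_sides SPP_domain_def)
  then have "boundary_word (SPP_web a c p) = map (side_letters (lozenges a b c p) (SPP_domain a c)) (SPP_boundary a c)"
    using boundary_word_web by simp
  moreover have "side_letters (lozenges a b c p) (SPP_domain a c) s = [Plain 1]" if "s \<in> set (run_fwd E1 (0, 2 * int c) a)" for s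
    using SPP_white_sides(2)[OF assms(2) that] run_axis(1)[OF that] by (simp add: side_letters_def)
  moreover have "side_letters (lozenges a b c p) (SPP_domain a c) s = [Barred 4]" if "s \<in> set (run_bwd E3 (int a, 2 * int c - int a) c)" for s
    using SPP_white_sides(1)[OF assms(2) that] run_axis(2)[OF that] by (simp add: side_letters_def)
  moreover have "side_letters (lozenges a b c p) (SPP_domain a c) s = [Plain 2]" if "s \<in> set (run_fwd E2 (int a, - int a) a)" for s
    using SPP_white_sides(3)[OF assms(2) that] run_axis(1)[OF that] SPP_no_hourglass(3)[OF assms(1) that] by (simp add: side_letters_def)
  moreover have "map (side_letters (lozenges a b c p) (SPP_domain a c)) (run_fwd E3 (0, 2 * - int a) (a + c)) =
    map (\<lambda>i. vertical_letters (- int a + int i)) [0..<a + c]"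
    by (rule map_vertical_letters) (use SPP_white_sides(4)[OF assms(2)] assms in \<open>auto simp: hexagon_iff\<close>)
  ultimately show ?thesis unfolding SPP_boundary_def map_append by (simp add: map_constant)
qed

end

definition CSPP_domain :: "nat \<Rightarrow> triangle set" where
  "CSPP_domain a = triangles_in (hexagon a a a \<inter> {(X, Y). 0 \<le> X \<and> - X \<le> Y})"

definition CSPP_boundary :: "nat \<Rightarrow> side list" where
  "CSPP_boundary a = run_fwd E1 (0, 2 * int a) a @ run_bwd E3 (int a, int a) a @
     run_bwd E1 (int a, - int a) a @ run_fwd E3 (0, 0) a"

definition CSPP_path :: "nat \<Rightarrow> step list" where
  "CSPP_path a = replicate a (Fwd E1) @ replicate a (Bwd E3) @ replicate a (Bwd E1) @ replicate a (Fwd E3)"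

lemma CSPP_White: "White (X, Y) \<in> CSPP_domain a \<longleftrightarrow>
  even (X + Y) \<and> 0 \<le> X \<and> X < int a \<and> 0 \<le> X + Y \<and> X + Y < 2 * int a"
  unfolding CSPP_domain_def White_in by (simp add: hexagon_iff; auto; presburger)

lemma CSPP_Black: "Black (X, Y) \<in> CSPP_domain a \<longleftrightarrow>
  even (X + Y) \<and> 1 \<le> X \<and> X \<le> int a \<and> 0 \<le> X + Y \<and> X + Y < 2 * int a"
  unfolding CSPP_domain_def Black_in by (simp add: hexagon_iff; auto; presburger)

lemma CSPP_boundary_iff:
  assumes "1 \<le> a"
  shows "s \<in> set (CSPP_boundary a) \<longleftrightarrow> (white_tri s \<in> CSPP_domain a \<longleftrightarrow> black_tri s \<notin> CSPP_domain a)"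
proof -
  obtain x X Y where s: "s = (x, X, Y)" by (cases s)
  show ?thesis
  proof (cases "even (X + Y)")
    case True
    then obtain H where H: "Y = 2 * H - X" by (metis add_diff_cancel_left' evenE)
    show ?thesis using assms unfolding s CSPP_boundary_def set_append Un_iff in_run H
      by (cases x; simp add: CSPP_White CSPP_Black; auto; presburger?)
  next
    case False
    then show ?thesis using assms unfolding s CSPP_boundary_def set_append Un_iff in_run
      by (cases x; simp add: CSPP_White CSPP_Black; auto; presburger?)
  qed
qed

lemma CSPP_white_sides:
  "s \<in> set (run_fwd E1 (0, 2 * int a) a) \<Longrightarrow> white_tri s \<in> CSPP_domain a"
  "s \<in> set (run_bwd E3 (int a, int a) a) \<Longrightarrow> white_tri s \<notin> CSPP_domain a"
  "s \<in> set (run_bwd E1 (int a, - int a) a) \<Longrightarrow> white_tri s \<notin> CSPP_domain a"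
  "s \<in> set (run_fwd E3 (0, 0) a) \<Longrightarrow> white_tri s \<in> CSPP_domain a"
proof -
  obtain x X Y where s: "s = (x, X, Y)" by (cases s)
  show "s \<in> set (run_fwd E1 (0, 2 * int a) a) \<Longrightarrow> white_tri s \<in> CSPP_domain a"
    unfolding s in_run by (elim conjE; simp add: CSPP_White; presburger?)
  show "s \<in> set (run_bwd E3 (int a, int a) a) \<Longrightarrow> white_tri s \<notin> CSPP_domain a"
    unfolding s in_run by (elim conjE; simp add: CSPP_White; presburger?)
  show "s \<in> set (run_bwd E1 (int a, - int a) a) \<Longrightarrow> white_tri s \<notin> CSPP_domain a"
    unfolding s in_run by (elim conjE; simp add: CSPP_White; presburger?)
  show "s \<in> set (run_fwd E3 (0, 0) a) \<Longrightarrow> white_tri s \<in> CSPP_domain a"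
    unfolding s in_run by (elim conjE; simp add: CSPP_White; presburger?)
qed

lemma CSPP_path_sides: "path_sides (0, 2 * int a) (CSPP_path a) = CSPP_boundary a"
  by (simp add: CSPP_path_def CSPP_boundary_def stride_pair algebra_simps)

lemma CSPP_chain: "side_chain (CSPP_domain a) (0, 2 * int a) (CSPP_boundary a) (0, 2 * int a)"
proof -
  have "path_end (0, 2 * int a) (CSPP_path a) = (0, 2 * int a)"
    by (simp add: CSPP_path_def stride_pair algebra_simps)
  moreover have "oriented (CSPP_domain a) (0, 2 * int a) (CSPP_path a)"
    using CSPP_white_sides[where a = a] by (simp add: CSPP_path_def stride_pair algebra_simps)
  ultimately show ?thesis using side_chain_path CSPP_path_sides by metis
qed

lemma CSPP_ranks:
  "s \<in> set (run_fwd E1 (0, 2 * int a) a) \<Longrightarrow> turning_rank (CSPP_domain a) s = 0"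
  "s \<in> set (run_bwd E3 (int a, int a) a) \<Longrightarrow> turning_rank (CSPP_domain a) s = 1"
  "s \<in> set (run_bwd E1 (int a, - int a) a) \<Longrightarrow> turning_rank (CSPP_domain a) s = 2"
  "s \<in> set (run_fwd E3 (0, 0) a) \<Longrightarrow> turning_rank (CSPP_domain a) s = 3"
  by (simp_all add: turning_rank.simps CSPP_white_sides run_axis del: white_tri.simps)

definition TSPP_domain :: "nat \<Rightarrow> triangle set" where
  "TSPP_domain a = triangles_in (hexagon a a a \<inter> {(X, Y). 0 \<le> X \<and> X \<le> Y})"

definition TSPP_boundary :: "nat \<Rightarrow> side list" where
  "TSPP_boundary a = run_fwd E1 (0, 2 * int a) a @ run_fwd E2 (int a, int a) a @ run_fwd E3 (0, 0) a"

definition TSPP_path :: "nat \<Rightarrow> step list" where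
  "TSPP_path a = replicate a (Fwd E1) @ replicate a (Fwd E2) @ replicate a (Fwd E3)"

lemma TSPP_White: "White (X, Y) \<in> TSPP_domain a \<longleftrightarrow>
  even (X + Y) \<and> 0 \<le> X \<and> X \<le> Y \<and> X + Y < 2 * int a"
  unfolding TSPP_domain_def White_in by (simp add: hexagon_iff; auto; presburger)

lemma TSPP_Black: "Black (X, Y) \<in> TSPP_domain a \<longleftrightarrow>
  even (X + Y) \<and> 1 \<le> X \<and> X \<le> Y \<and> X + Y < 2 * int a"
  unfolding TSPP_domain_def Black_in by (simp add: hexagon_iff; auto; presburger)

lemma TSPP_boundary_iff:
  "s \<in> set (TSPP_boundary a) \<longleftrightarrow> (white_tri s \<in> TSPP_domain a \<longleftrightarrow> black_tri s \<notin> TSPP_domain a)"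
proof -
  obtain x X Y where s: "s = (x, X, Y)" by (cases s)
  show ?thesis unfolding s TSPP_boundary_def set_append Un_iff in_run
    by (cases x; simp add: TSPP_White TSPP_Black; auto; presburger)
qed

lemma TSPP_white_sides:
  "s \<in> set (run_fwd E1 (0, 2 * int a) a) \<Longrightarrow> white_tri s \<in> TSPP_domain a"
  "s \<in> set (run_fwd E2 (int a, int a) a) \<Longrightarrow> white_tri s \<in> TSPP_domain a"
  "s \<in> set (run_fwd E3 (0, 0) a) \<Longrightarrow> white_tri s \<in> TSPP_domain a"
proof -
  obtain x X Y where s: "s = (x, X, Y)" by (cases s)
  show "s \<in> set (run_fwd E1 (0, 2 * int a) a) \<Longrightarrow> white_tri s \<in> TSPP_domain a"
    unfolding s in_run by (elim conjE; simp add: TSPP_White; presburger?)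
  show "s \<in> set (run_fwd E2 (int a, int a) a) \<Longrightarrow> white_tri s \<in> TSPP_domain a"
    unfolding s in_run by (elim conjE; simp add: TSPP_White; presburger?)
  show "s \<in> set (run_fwd E3 (0, 0) a) \<Longrightarrow> white_tri s \<in> TSPP_domain a"
    unfolding s in_run by (elim conjE; simp add: TSPP_White; presburger?)
qed

lemma TSPP_path_sides: "path_sides (0, 2 * int a) (TSPP_path a) = TSPP_boundary a"
  by (simp add: TSPP_path_def TSPP_boundary_def stride_pair algebra_simps)

lemma TSPP_chain: "side_chain (TSPP_domain a) (0, 2 * int a) (TSPP_boundary a) (0, 2 * int a)"
proof -
  have "path_end (0, 2 * int a) (TSPP_path a) = (0, 2 * int a)"
    by (simp add: TSPP_path_def stride_pair algebra_simps)
  moreover have "oriented (TSPP_domain a) (0, 2 * int a) (TSPP_path a)"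
    using TSPP_white_sides[where a = a] by (simp add: TSPP_path_def stride_pair algebra_simps)
  ultimately show ?thesis using side_chain_path TSPP_path_sides by metis
qed

lemma TSPP_ranks:
  "s \<in> set (run_fwd E1 (0, 2 * int a) a) \<Longrightarrow> turning_rank (TSPP_domain a) s = 0"
  "s \<in> set (run_fwd E2 (int a, int a) a) \<Longrightarrow> turning_rank (TSPP_domain a) s = 1"
  "s \<in> set (run_fwd E3 (0, 0) a) \<Longrightarrow> turning_rank (TSPP_domain a) s = 3"
  by (simp_all add: turning_rank.simps TSPP_white_sides run_axis del: white_tri.simps)

locale cubic_partition = boxed_partition a a a p for a :: nat and p :: pp +
  assumes pos: "1 \<le> a"
begin

lemma cube_no_hourglass:
  "s \<in> set (run_fwd E1 (0, 2 * int a) n) \<Longrightarrow> n \<le> a \<Longrightarrow> \<not> hourglass_at (lozenges a a a p) s"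
  "s \<in> set (run_bwd E3 (int a, int a) a) \<Longrightarrow> \<not> hourglass_at (lozenges a a a p) s"
proof -
  obtain x X Y where s: "s = (x, X, Y)" by (cases s)
  show "s \<in> set (run_fwd E1 (0, 2 * int a) n) \<Longrightarrow> n \<le> a \<Longrightarrow> \<not> hourglass_at (lozenges a a a p) s"
    "s \<in> set (run_bwd E3 (int a, int a) a) \<Longrightarrow> \<not> hourglass_at (lozenges a a a p) s"
    unfolding s in_run by (rule no_hourglass_on_border; auto simp: hexagon_iff; presburger?)+
qed

lemma CSPP_web_domain:
  "web_domain (lozenges a a a p) (CSPP_domain a) (0, 2 * int a) (CSPP_boundary a) (lift_coordinate p)"
proof (rule web_domainI)
  show "CSPP_domain a = triangles_in (hexagon a a a \<inter> {(X, Y). 0 \<le> X \<and> - X \<le> Y})"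
    by (simp add: CSPP_domain_def)
  show "distinct (CSPP_boundary a)"
    unfolding CSPP_boundary_def using pos by (auto simp: distinct_run in_run)
  show "s \<in> set (CSPP_boundary a) \<longleftrightarrow> (white_tri s \<in> CSPP_domain a \<longleftrightarrow> black_tri s \<notin> CSPP_domain a)" for s
    by (rule CSPP_boundary_iff[OF pos])
  show "side_chain (CSPP_domain a) (0, 2 * int a) (CSPP_boundary a) (0, 2 * int a)" by (rule CSPP_chain)
  show "sorted (map (turning_rank (CSPP_domain a)) (CSPP_boundary a))"
    unfolding CSPP_boundary_def map_append
    by (intro sorted_appendI sorted_constant) (auto simp: CSPP_ranks)
  show "white_tri s \<in> CSPP_domain a" if "s \<in> set (CSPP_boundary a)" "fst s = E2" for s
    using that(1) unfolding CSPP_boundary_def set_append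
    by (elim UnE) (use that(2) in \<open>simp_all add: CSPP_white_sides run_axis del: white_tri.simps\<close>)
  show "(fst s = E1 \<longrightarrow> white_tri s \<notin> CSPP_domain a) \<and> (fst s = E3 \<longrightarrow> white_tri s \<in> CSPP_domain a)"
    if "s \<in> set (CSPP_boundary a)" "hourglass_at (lozenges a a a p) s" for s
    using that(1) unfolding CSPP_boundary_def set_append
    by (elim UnE) (use that(2) in \<open>simp_all add: CSPP_white_sides run_axis cube_no_hourglass del: white_tri.simps\<close>)
qed

text \<open>For arbitrary partitions in a cube the slanted cut at 120 degrees depends on a third function. For
  cyclically symmetric ones it is determined by the vertical cut.\<close>

definition slanted_barred :: "int \<Rightarrow> letter list" where
  "slanted_barred k = (if hourglass_at (lozenges a a a p) (E1, (k, - k)) then [Barred 3, Barred 1] else [Barred 1])"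

lemma CSPP_word:
  "boundary_word (CSPP_web a p) =
    replicate a [Plain 1] @ replicate a [Barred 4] @ map (\<lambda>i. slanted_barred (int a - 1 - int i)) [0..<a] @
    map (\<lambda>i. vertical_letters (int i)) [0..<a]"
proof -
  interpret web_domain "lozenges a a a p" "CSPP_domain a" "(0, 2 * int a)" "CSPP_boundary a" "lift_coordinate p"
    using CSPP_web_domain .
  let ?f = "side_letters (lozenges a a a p) (CSPP_domain a)"
  have "CSPP_web a p = web (lozenges a a a p) (CSPP_domain a) (0, 2 * int a) (CSPP_boundary a)"
    unfolding CSPP_web_def restricted_web_def Let_def CSPP_path_def[symmetric]
    by (simp add: proj_eq CSPP_path_sides CSPP_domain_def)
  then have "boundary_word (CSPP_web a p) = map ?f (CSPP_boundary a)"
    using boundary_word_web by simp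
  moreover have "?f s = [Plain 1]" if "s \<in> set (run_fwd E1 (0, 2 * int a) a)" for s
    using CSPP_white_sides(1)[OF that] run_axis(1)[OF that] by (simp add: side_letters_def)
  moreover have "?f s = [Barred 4]" if "s \<in> set (run_bwd E3 (int a, int a) a)" for s
    using CSPP_white_sides(2)[OF that] run_axis(2)[OF that] by (simp add: side_letters_def)
  moreover have "map ?f (run_bwd E1 (int a, - int a) a) = map (\<lambda>i. slanted_barred (int a - 1 - int i)) [0..<a]"
  proof -
    have "?f (E1, stride (int a, - int a) (Suc i) (- vec E1)) = slanted_barred (int a - 1 - int i)" if i: "i < a" for i
    proof -
      let ?s = "(E1, stride (int a, - int a) (Suc i) (- vec E1))"
      have s: "?s = (E1, (int a - 1 - int i, - (int a - 1 - int i)))" by (simp add: stride_pair)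
      have "?s \<in> set (run_bwd E1 (int a, - int a) a)" using i by (auto simp: run_bwd_def)
      from CSPP_white_sides(3)[OF this] have w: "white_tri ?s \<notin> CSPP_domain a" .
      then show ?thesis unfolding s by (simp add: side_letters_def slanted_barred_def del: white_tri.simps)
    qed
    then show ?thesis by (simp add: run_bwd_def del: vec_eq)
  qed
  moreover have "map ?f (run_fwd E3 (0, 2 * 0) a) = map (\<lambda>i. vertical_letters (0 + int i)) [0..<a]"
    by (rule map_vertical_letters) (use CSPP_white_sides(4) in \<open>auto simp: hexagon_iff\<close>)
  ultimately show ?thesis unfolding CSPP_boundary_def map_append by (simp add: map_constant)
qed

lemma TSPP_web_domain:
  "web_domain (lozenges a a a p) (TSPP_domain a) (0, 2 * int a) (TSPP_boundary a) (lift_coordinate p)"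
proof (rule web_domainI)
  show "TSPP_domain a = triangles_in (hexagon a a a \<inter> {(X, Y). 0 \<le> X \<and> X \<le> Y})"
    by (simp add: TSPP_domain_def)
  show "distinct (TSPP_boundary a)"
    unfolding TSPP_boundary_def by (auto simp: distinct_run in_run)
  show "s \<in> set (TSPP_boundary a) \<longleftrightarrow> (white_tri s \<in> TSPP_domain a \<longleftrightarrow> black_tri s \<notin> TSPP_domain a)" for s
    by (rule TSPP_boundary_iff)
  show "side_chain (TSPP_domain a) (0, 2 * int a) (TSPP_boundary a) (0, 2 * int a)" by (rule TSPP_chain)
  show "sorted (map (turning_rank (TSPP_domain a)) (TSPP_boundary a))"
    unfolding TSPP_boundary_def map_append
    by (intro sorted_appendI sorted_constant) (auto simp: TSPP_ranks)
  show "white_tri s \<in> TSPP_domain a" if "s \<in> set (TSPP_boundary a)" "fst s = E2" for s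
    using that(1) unfolding TSPP_boundary_def set_append
    by (elim UnE) (use that(2) in \<open>simp_all add: TSPP_white_sides run_axis del: white_tri.simps\<close>)
  show "(fst s = E1 \<longrightarrow> white_tri s \<notin> TSPP_domain a) \<and> (fst s = E3 \<longrightarrow> white_tri s \<in> TSPP_domain a)"
    if "s \<in> set (TSPP_boundary a)" "hourglass_at (lozenges a a a p) s" for s
    using that(1) unfolding TSPP_boundary_def set_append
    by (elim UnE) (use that(2) in \<open>simp_all add: TSPP_white_sides run_axis cube_no_hourglass del: white_tri.simps\<close>)
qed

lemma TSPP_word:
  "boundary_word (TSPP_web a p) =
    replicate a [Plain 1] @ map (\<lambda>i. slanted_letters (int a - 1 - int i)) [0..<a] @
    map (\<lambda>i. vertical_letters (int i)) [0..<a]"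
proof -
  interpret web_domain "lozenges a a a p" "TSPP_domain a" "(0, 2 * int a)" "TSPP_boundary a" "lift_coordinate p"
    using TSPP_web_domain .
  let ?f = "side_letters (lozenges a a a p) (TSPP_domain a)"
  have "TSPP_web a p = web (lozenges a a a p) (TSPP_domain a) (0, 2 * int a) (TSPP_boundary a)"
    unfolding TSPP_web_def restricted_web_def Let_def TSPP_path_def[symmetric]
    by (simp add: proj_eq TSPP_path_sides TSPP_domain_def)
  then have "boundary_word (TSPP_web a p) = map ?f (TSPP_boundary a)"
    using boundary_word_web by simp
  moreover have "?f s = [Plain 1]" if "s \<in> set (run_fwd E1 (0, 2 * int a) a)" for s
    using TSPP_white_sides(1)[OF that] run_axis(1)[OF that] by (simp add: side_letters_def)
  moreover have "map ?f (run_fwd E2 (int a, int a) a) = map (\<lambda>i. slanted_letters (int a - 1 - int i)) [0..<a]"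
  proof -
    have "?f (E2, stride (int a, int a) i (vec E2)) = slanted_letters (int a - 1 - int i)" if i: "i < a" for i
    proof -
      let ?s = "(E2, stride (int a, int a) i (vec E2))" and ?k = "int a - 1 - int i"
      have s: "?s = (E2, (?k + 1, ?k + 1))" by (simp add: stride_pair)
      have "?s \<in> set (run_fwd E2 (int a, int a) a)" using i by (auto simp: run_fwd_def)
      from TSPP_white_sides(2)[OF this] have w: "white_tri ?s \<in> TSPP_domain a" .
      have "(?k + 1, ?k + 1) \<in> hexagon a a a" using i by (simp add: hexagon_iff)
      from hourglass_slanted[OF this] have "hourglass_at (lozenges a a a p) ?s \<longleftrightarrow> r_cut ?k = r_cut (?k + 1)"
        unfolding s by (auto simp: of_bool_def split: if_splits)
      then show ?thesis using w by (simp add: side_letters_def slanted_letters_def del: white_tri.simps vec_eq)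
    qed
    then show ?thesis by (simp add: run_fwd_def del: vec_eq)
  qed
  moreover have "map ?f (run_fwd E3 (0, 2 * 0) a) = map (\<lambda>i. vertical_letters (0 + int i)) [0..<a]"
    by (rule map_vertical_letters) (use TSPP_white_sides(3) in \<open>auto simp: hexagon_iff\<close>)
  ultimately show ?thesis unfolding TSPP_boundary_def map_append by (simp add: map_constant)
qed

end

text \<open>The slanted cut at 30 degrees passes along the line Y = 3 X, and the period of the zigzag is
  \<open>- vec E3 + vec E2\<close> = (- 1, - 3).\<close>

definition run_zigzag :: "point \<Rightarrow> nat \<Rightarrow> side list" where
  "run_zigzag A n = concat (map (\<lambda>i. [(E3, stride A i (- 1, - 3) - vec E3), (E2, stride A i (- 1, - 3) - vec E3)]) [0..<n])"

lemma run_zigzag_Suc: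
  "run_zigzag A (Suc n) = (E3, A - vec E3) # (E2, A - vec E3) # run_zigzag (A - vec E3 + vec E2) n"
proof -
  have "stride A (Suc i) (- 1, - 3) = stride (A - vec E3 + vec E2) i (- 1, - 3)" for i
    by (cases A) (simp add: stride_pair algebra_simps)
  then show ?thesis
    unfolding run_zigzag_def upt_conv_Cons[OF zero_less_Suc] map_Suc_upt[symmetric]
    by (simp add: o_def del: upt_Suc vec_eq)
qed

lemma stride_zigzag: "stride (A - vec E3 + vec E2) n (- 1, - 3) = stride A (Suc n) (- 1, - 3)"
  by (cases A) (simp add: stride_pair algebra_simps)

lemma path_sides_zigzag:
  "path_sides A (concat (replicate n [Bwd E3, Fwd E2]) @ ss) = run_zigzag A n @ path_sides (stride A n (- 1, - 3)) ss"
  by (induction n arbitrary: A) (simp add: run_zigzag_def, simp add: run_zigzag_Suc stride_zigzag[symmetric] del: vec_eq)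

lemma path_end_zigzag:
  "path_end A (concat (replicate n [Bwd E3, Fwd E2]) @ ss) = path_end (stride A n (- 1, - 3)) ss"
  by (induction n arbitrary: A) (simp, simp add: stride_zigzag[symmetric] del: vec_eq)

lemma oriented_zigzag:
  "oriented D A (concat (replicate n [Bwd E3, Fwd E2]) @ ss) \<longleftrightarrow>
    (\<forall>s\<in>set (run_zigzag A n). white_tri s \<in> D \<longleftrightarrow> fst s = E2) \<and> oriented D (stride A n (- 1, - 3)) ss"
  by (induction n arbitrary: A)
    (simp add: run_zigzag_def, simp add: run_zigzag_Suc stride_zigzag[symmetric] del: vec_eq white_tri.simps)

lemma in_zigzag:
  "(y, X', Y') \<in> set (run_zigzag (X, Y) n) \<longleftrightarrow>
    (y = E3 \<or> y = E2) \<and> X - int n < X' \<and> X' \<le> X \<and> Y' - 3 * X' = Y - 3 * X - 2"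
proof (induction n arbitrary: X Y)
  case 0
  then show ?case by (simp add: run_zigzag_def)
next
  case (Suc n)
  then show ?case unfolding run_zigzag_Suc by (cases y) (auto simp: algebra_simps)
qed

lemma distinct_zigzag: "distinct (run_zigzag A n)"
proof (induction n arbitrary: A)
  case (Suc n)
  then show ?case unfolding run_zigzag_Suc by (cases A) (simp add: in_zigzag)
qed (simp add: run_zigzag_def)

definition TSSCPP_domain :: "nat \<Rightarrow> triangle set" where
  "TSSCPP_domain d = triangles_in (hexagon (2 * d) (2 * d) (2 * d) \<inter> {(X, Y). 0 \<le> X \<and> 3 * X \<le> Y})"

definition TSSCPP_boundary :: "nat \<Rightarrow> side list" where
  "TSSCPP_boundary d = run_fwd E1 (0, 4 * int d) d @ (E2, (int d, 3 * int d)) #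
     run_zigzag (int d - 1, 3 * int d - 1) (d - 1) @ run_fwd E3 (0, 2) (2 * d - 1)"

definition TSSCPP_path :: "nat \<Rightarrow> step list" where
  "TSSCPP_path d = replicate d (Fwd E1) @ Fwd E2 # concat (replicate (d - 1) [Bwd E3, Fwd E2]) @
      replicate (2 * d - 1) (Fwd E3)"

lemma TSSCPP_White: "White (X, Y) \<in> TSSCPP_domain d \<longleftrightarrow>
  even (X + Y) \<and> 0 \<le> X \<and> 3 * X + 2 \<le> Y \<and> X + Y < 4 * int d"
  unfolding TSSCPP_domain_def White_in by (simp add: hexagon_iff; auto; presburger)

lemma TSSCPP_Black: "Black (X, Y) \<in> TSSCPP_domain d \<longleftrightarrow>
  even (X + Y) \<and> 1 \<le> X \<and> 3 * X \<le> Y \<and> X + Y < 4 * int d"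
  unfolding TSSCPP_domain_def Black_in by (simp add: hexagon_iff; auto; presburger)

lemma TSSCPP_boundary_iff:
  assumes "1 \<le> d"
  shows "s \<in> set (TSSCPP_boundary d) \<longleftrightarrow> (white_tri s \<in> TSSCPP_domain d \<longleftrightarrow> black_tri s \<notin> TSSCPP_domain d)"
proof -
  obtain x X Y where s: "s = (x, X, Y)" by (cases s)
  have d: "int (d - 1) = int d - 1" "int (2 * d - 1) = 2 * int d - 1" using assms by auto
  show ?thesis
  proof (cases "even (X + Y)")
    case True
    then obtain H where H: "Y = 2 * H - X" by (metis add_diff_cancel_left' evenE)
    show ?thesis using assms
      unfolding s TSSCPP_boundary_def set_append list.set insert_iff Un_iff in_run in_zigzag H d
      by (cases x; simp add: TSSCPP_White TSSCPP_Black; auto; presburger?)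
  next
    case False
    then show ?thesis using assms
      unfolding s TSSCPP_boundary_def set_append list.set insert_iff Un_iff in_run in_zigzag d
      by (cases x; simp add: TSSCPP_White TSSCPP_Black; presburger?)
  qed
qed

lemma TSSCPP_white_sides:
  assumes "1 \<le> d"
  shows "s \<in> set (run_fwd E1 (0, 4 * int d) d) \<Longrightarrow> white_tri s \<in> TSSCPP_domain d"
    "white_tri (E2, (int d, 3 * int d)) \<in> TSSCPP_domain d"
    "s \<in> set (run_zigzag (int d - 1, 3 * int d - 1) (d - 1)) \<Longrightarrow> white_tri s \<in> TSSCPP_domain d \<longleftrightarrow> fst s = E2"
    "s \<in> set (run_fwd E3 (0, 2) (2 * d - 1)) \<Longrightarrow> white_tri s \<in> TSSCPP_domain d"
proof -
  have d: "int (d - 1) = int d - 1" "int (2 * d - 1) = 2 * int d - 1" using assms by auto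
  obtain x X Y where s: "s = (x, X, Y)" by (cases s)
  show "s \<in> set (run_fwd E1 (0, 4 * int d) d) \<Longrightarrow> white_tri s \<in> TSSCPP_domain d"
    unfolding s in_run in_zigzag d using assms by (elim conjE; simp add: TSSCPP_White; auto; presburger?)
  show "white_tri (E2, (int d, 3 * int d)) \<in> TSSCPP_domain d"
    using assms by (simp add: TSSCPP_White)
  show "s \<in> set (run_zigzag (int d - 1, 3 * int d - 1) (d - 1)) \<Longrightarrow> white_tri s \<in> TSSCPP_domain d \<longleftrightarrow> fst s = E2"
    unfolding s in_run in_zigzag d using assms by (elim conjE; auto simp: TSSCPP_White; presburger?)
  show "s \<in> set (run_fwd E3 (0, 2) (2 * d - 1)) \<Longrightarrow> white_tri s \<in> TSSCPP_domain d"
    unfolding s in_run in_zigzag d using assms by (elim conjE; simp add: TSSCPP_White; auto; presburger?)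
qed

lemma TSSCPP_path_sides:
  assumes "1 \<le> d"
  shows "path_sides (0, 4 * int d) (TSSCPP_path d) = TSSCPP_boundary d"
proof -
  have "int (d - 1) = int d - 1" using assms by auto
  then show ?thesis by (simp add: TSSCPP_path_def TSSCPP_boundary_def path_sides_zigzag stride_pair algebra_simps)
qed

lemma TSSCPP_chain:
  assumes "1 \<le> d"
  shows "side_chain (TSSCPP_domain d) (0, 4 * int d) (TSSCPP_boundary d) (0, 4 * int d)"
proof -
  have d: "int (d - 1) = int d - 1" "int (2 * d - 1) = 2 * int d - 1" using assms by auto
  have "path_end (0, 4 * int d) (TSSCPP_path d) = (0, 4 * int d)"
    using d by (simp add: TSSCPP_path_def path_end_zigzag stride_pair algebra_simps)
  moreover have "oriented (TSSCPP_domain d) (0, 4 * int d) (TSSCPP_path d)"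
  proof -
    have e: "stride (0, 4 * int d) d (vec E1) = (int d, 3 * int d)" "(int d, 3 * int d) + vec E2 = (int d - 1, 3 * int d - 1)"
      "stride (int d - 1, 3 * int d - 1) (d - 1) (- 1, - 3) = (0, 2)" using d by (simp_all add: stride_pair algebra_simps)
    show ?thesis
      unfolding TSSCPP_path_def oriented_fwd e oriented.simps oriented_zigzag oriented_fwd'
      using TSSCPP_white_sides[OF assms] by blast
  qed
  ultimately show ?thesis using side_chain_path TSSCPP_path_sides[OF assms] by metis
qed

lemma TSSCPP_ranks:
  assumes "1 \<le> d"
  shows "s \<in> set (run_fwd E1 (0, 4 * int d) d) \<Longrightarrow> turning_rank (TSSCPP_domain d) s = 0"
    "turning_rank (TSSCPP_domain d) (E2, (int d, 3 * int d)) = 1"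
    "s \<in> set (run_zigzag (int d - 1, 3 * int d - 1) (d - 1)) \<Longrightarrow> turning_rank (TSSCPP_domain d) s = 1"
    "s \<in> set (run_fwd E3 (0, 2) (2 * d - 1)) \<Longrightarrow> turning_rank (TSSCPP_domain d) s = 3"
proof -
  show "s \<in> set (run_zigzag (int d - 1, 3 * int d - 1) (d - 1)) \<Longrightarrow> turning_rank (TSSCPP_domain d) s = 1"
  proof -
    assume s: "s \<in> set (run_zigzag (int d - 1, 3 * int d - 1) (d - 1))"
    have "fst s = E3 \<or> fst s = E2" using s unfolding run_zigzag_def by auto
    then show ?thesis using TSSCPP_white_sides(3)[OF assms s] by (auto simp: turning_rank.simps)
  qed
qed (simp_all add: turning_rank.simps TSSCPP_white_sides[OF assms] run_axis del: white_tri.simps)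

lemma (in boxed_partition) hourglass_unique:
  assumes "corners \<tau> \<subseteq> hexagon a b c" "hourglass_at (lozenges a b c p) (side_at \<tau> y)" "hourglass_at (lozenges a b c p) (side_at \<tau> z)"
  shows "y = z"
proof -
  have "diff (lift_coordinate p w) (side_at \<tau> x) = of_bool (x = w) - of_bool (hourglass_at (lozenges a b c p) (side_at \<tau> x))" for x w
  proof -
    have "snd (side_at \<tau> x) \<in> hexagon a b c" using assms(1) side_at_corner by blast
    moreover have "side_at \<tau> x = (x, snd (side_at \<tau> x))" using fst_side_at by (metis prod.collapse)
    ultimately show ?thesis using lift_step_cases[of "snd (side_at \<tau> x)" w x] by (simp add: diff_def)
  qed
  then show ?thesis
    using sum_diff_triangle[of "lift_coordinate p E1" \<tau>] assms(2,3)
    by (cases y; cases z) (auto simp: of_bool_def split: if_splits)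
qed

text \<open>The line Y = 3 X runs along the long diagonals of lozenges whose short diagonals are these sides.\<close>

locale bisected_partition = boxed_partition "2 * d" "2 * d" "2 * d" p for d :: nat and p :: pp +
  assumes d_pos: "1 \<le> d"
    and bisected: "\<And>k. 0 \<le> k \<Longrightarrow> k < int d \<Longrightarrow> hourglass_at (lozenges (2 * d) (2 * d) (2 * d) p) (E1, (k, 3 * k + 2))"
begin

sublocale cubic_partition "2 * d" p
  by unfold_locales (use d_pos in simp)

text \<open>A side of the zigzag belongs to a triangle outside of the domain whose hourglass is at a bisected
  lozenge, and a triangle has only one hourglass.\<close>

lemma zigzag_no_hourglass:
  "1 \<le> k \<Longrightarrow> k < int d \<Longrightarrow> \<not> hourglass_at (lozenges (2 * d) (2 * d) (2 * d) p) (E3, (k, 3 * k))"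
  "1 \<le> k \<Longrightarrow> k \<le> int d \<Longrightarrow> \<not> hourglass_at (lozenges (2 * d) (2 * d) (2 * d) p) (E2, (k, 3 * k))"
proof -
  show "\<not> hourglass_at (lozenges (2 * d) (2 * d) (2 * d) p) (E3, (k, 3 * k))" if k: "1 \<le> k" "k < int d"
  proof -
    have "corners (White (k, 3 * k)) \<subseteq> hexagon (2 * d) (2 * d) (2 * d)" using k by (simp add: hexagon_iff)
    moreover have "side_at (White (k, 3 * k)) E1 = (E1, (k, 3 * k + 2))" by simp
    ultimately show ?thesis using hourglass_unique[of "White (k, 3 * k)" E1 E3] bisected[of k] k by auto
  qed
  show "\<not> hourglass_at (lozenges (2 * d) (2 * d) (2 * d) p) (E2, (k, 3 * k))" if k: "1 \<le> k" "k \<le> int d"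
  proof -
    have "corners (Black (k, 3 * k - 2)) \<subseteq> hexagon (2 * d) (2 * d) (2 * d)" using k by (simp add: hexagon_iff)
    moreover have "side_at (Black (k, 3 * k - 2)) E1 = (E1, (k - 1, 3 * (k - 1) + 2))"
      "side_at (Black (k, 3 * k - 2)) E2 = (E2, (k, 3 * k))" by simp_all
    ultimately show ?thesis using hourglass_unique[of "Black (k, 3 * k - 2)" E1 E2] bisected[of "k - 1"] k by auto
  qed
qed

lemma zigzag_no_hourglass':
  assumes "s \<in> set (run_zigzag (int d - 1, 3 * int d - 1) (d - 1))"
  shows "\<not> hourglass_at (lozenges (2 * d) (2 * d) (2 * d) p) s"
proof -
  obtain x X Y where s: "s = (x, X, Y)" by (cases s)
  have "(x = E3 \<or> x = E2) \<and> Y = 3 * X \<and> 1 \<le> X \<and> X < int d"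
    using assms d_pos unfolding s in_zigzag by auto
  then show ?thesis using zigzag_no_hourglass[of X] unfolding s by auto
qed

lemma TSSCPP_web_domain:
  "web_domain (lozenges (2 * d) (2 * d) (2 * d) p) (TSSCPP_domain d) (0, 4 * int d) (TSSCPP_boundary d) (lift_coordinate p)"
proof (rule web_domainI)
  show "TSSCPP_domain d = triangles_in (hexagon (2 * d) (2 * d) (2 * d) \<inter> {(X, Y). 0 \<le> X \<and> 3 * X \<le> Y})"
    by (simp add: TSSCPP_domain_def)
  show "distinct (TSSCPP_boundary d)"
    unfolding TSSCPP_boundary_def using d_pos by (auto simp: distinct_run distinct_zigzag in_run in_zigzag)
  show "s \<in> set (TSSCPP_boundary d) \<longleftrightarrow> (white_tri s \<in> TSSCPP_domain d \<longleftrightarrow> black_tri s \<notin> TSSCPP_domain d)" for s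
    by (rule TSSCPP_boundary_iff[OF d_pos])
  show "side_chain (TSSCPP_domain d) (0, 4 * int d) (TSSCPP_boundary d) (0, 4 * int d)" by (rule TSSCPP_chain[OF d_pos])
  show "sorted (map (turning_rank (TSSCPP_domain d)) (TSSCPP_boundary d))"
  proof -
    have "TSSCPP_boundary d = run_fwd E1 (0, 4 * int d) d @ [(E2, (int d, 3 * int d))] @
     run_zigzag (int d - 1, 3 * int d - 1) (d - 1) @ run_fwd E3 (0, 2) (2 * d - 1)" by (simp add: TSSCPP_boundary_def)
    then show ?thesis
      unfolding map_append
      by (simp only: map_append) (intro sorted_appendI sorted_constant; auto simp: TSSCPP_ranks[OF d_pos])
  qed
  show "white_tri s \<in> TSSCPP_domain d" if "s \<in> set (TSSCPP_boundary d)" "fst s = E2" for s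
    using that(1) unfolding TSSCPP_boundary_def set_append list.set
    by (elim UnE insertE) (use that(2) in \<open>simp_all add: TSSCPP_white_sides[OF d_pos] run_axis del: white_tri.simps\<close>)
  show "(fst s = E1 \<longrightarrow> white_tri s \<notin> TSSCPP_domain d) \<and> (fst s = E3 \<longrightarrow> white_tri s \<in> TSSCPP_domain d)"
    if "s \<in> set (TSSCPP_boundary d)" "hourglass_at (lozenges (2 * d) (2 * d) (2 * d) p) s" for s
  proof -
    have ne: "s \<notin> set (run_fwd E1 (0, 4 * int d) d)" "s \<notin> set (run_zigzag (int d - 1, 3 * int d - 1) (d - 1))"
      using that(2) cube_no_hourglass(1)[of s d] zigzag_no_hourglass'[of s] by auto
    then show ?thesis using that(1) unfolding TSSCPP_boundary_def set_append list.set
      by (elim UnE insertE) (simp_all add: TSSCPP_white_sides[OF d_pos] run_axis del: white_tri.simps)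
  qed
qed

lemma TSSCPP_word:
  "boundary_word (TSSCPP_web d p) =
    replicate d [Plain 1] @ map (\<lambda>i. if even i then [Plain 2] else [Barred 4]) [0..<2 * d - 1] @
    map (\<lambda>i. vertical_letters (1 + int i)) [0..<2 * d - 1]"
proof -
  interpret web_domain "lozenges (2 * d) (2 * d) (2 * d) p" "TSSCPP_domain d" "(0, 4 * int d)" "TSSCPP_boundary d" "lift_coordinate p"
    using TSSCPP_web_domain .
  let ?f = "side_letters (lozenges (2 * d) (2 * d) (2 * d) p) (TSSCPP_domain d)"
  have "TSSCPP_web d p = web (lozenges (2 * d) (2 * d) (2 * d) p) (TSSCPP_domain d) (0, 4 * int d) (TSSCPP_boundary d)"
    unfolding TSSCPP_web_def restricted_web_def Let_def TSSCPP_path_def[symmetric]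
    by (simp add: proj_eq TSSCPP_path_sides[OF d_pos] TSSCPP_domain_def)
  then have "boundary_word (TSSCPP_web d p) = map ?f (TSSCPP_boundary d)"
    using boundary_word_web by simp
  moreover have "?f s = [Plain 1]" if "s \<in> set (run_fwd E1 (0, 4 * int d) d)" for s
    using TSSCPP_white_sides(1)[OF d_pos that] run_axis(1)[OF that] by (simp add: side_letters_def)
  moreover have "?f (E2, (int d, 3 * int d)) = [Plain 2]"
    using TSSCPP_white_sides(2)[OF d_pos] zigzag_no_hourglass(2)[of "int d"] d_pos
    by (simp add: side_letters_def del: white_tri.simps)
  moreover have "map ?f (run_zigzag (int d - 1, 3 * int d - 1) (d - 1)) = concat (replicate (d - 1) [[Barred 4], [Plain 2]])"
  proof -
    have "?f s = (if fst s = E2 then [Plain 2] else [Barred 4])" if s: "s \<in> set (run_zigzag (int d - 1, 3 * int d - 1) (d - 1))" for s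
    proof -
      have "fst s = E3 \<or> fst s = E2" using s unfolding run_zigzag_def by auto
      then show ?thesis using TSSCPP_white_sides(3)[OF d_pos s] zigzag_no_hourglass'[OF s] by (auto simp: side_letters_def)
    qed
    then have "map ?f (run_zigzag (int d - 1, 3 * int d - 1) (d - 1)) =
       map (\<lambda>s. if fst s = E2 then [Plain 2] else [Barred 4]) (run_zigzag (int d - 1, 3 * int d - 1) (d - 1))" by simp
    also have "\<dots> = concat (replicate (d - 1) [[Barred 4], [Plain 2]])"
      unfolding run_zigzag_def map_concat map_map by (simp add: o_def map_replicate_const)
    finally show ?thesis .
  qed
  moreover have "map ?f (run_fwd E3 (0, 2 * 1) (2 * d - 1)) = map (\<lambda>i. vertical_letters (1 + int i)) [0..<2 * d - 1]"
    by (rule map_vertical_letters) (use TSSCPP_white_sides(4)[OF d_pos] in \<open>auto simp: hexagon_iff\<close>)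
  moreover have "[Plain 2] # concat (replicate n [[Barred 4], [Plain 2]]) =
    map (\<lambda>i. if even i then [Plain 2] else [Barred 4]) [0..<2 * n + 1]" for n
    by (induction n) (simp_all flip: replicate_append_same)
  moreover have "2 * (d - 1) + 1 = 2 * d - 1" using d_pos by simp
  ultimately show ?thesis unfolding TSSCPP_boundary_def map_append list.map
    by (simp add: map_constant del: upt_Suc)
qed

end

section \<open>Properties of the heights and of the symmetry classes\<close>

context boxed_partition
begin

lemma height_iff: "1 \<le> i \<Longrightarrow> 1 \<le> j \<Longrightarrow> (i, j, k) \<in> p \<longleftrightarrow> 1 \<le> k \<and> k \<le> height p i j"
  using columns(1)[of i j k] by (simp add: height_def)

lemma height_le: "height p i j \<le> c"
proof -
  have "{k. (i, j, k) \<in> p} \<subseteq> {1..c}" using in_box by auto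
  then show ?thesis unfolding height_def by (metis card_atLeastAtMost card_mono diff_Suc_1 finite_atLeastAtMost)
qed

lemma n_cut_eqI:
  assumes "surf p (i, i, i + t)"
  shows "n_cut t = i"
  using lift_eqI[OF assms, of "(0, 2 * t)"] by (simp add: n_cut_def lift_coordinate_def proj_eq)

lemma n_cut_surf: "surf p (n_cut t, n_cut t, n_cut t + t)"
proof -
  obtain x y z where v: "lift p (0, 2 * t) = (x, y, z)" by (cases "lift p (0, 2 * t)")
  then have "surf p (x, y, z)" "x = y" "z = x + t" using lift_surf[of "(0, 2 * t)"] by (auto simp: proj_eq)
  moreover have "n_cut t = x" by (simp add: n_cut_def lift_coordinate_def v)
  ultimately show ?thesis by simp
qed

lemma r_cut_eqI:
  assumes "surf p (i + k, i, i + k)"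
  shows "r_cut k = i"
  using lift_eqI[OF assms, of "(k, k)"] by (simp add: r_cut_def lift_coordinate_def proj_eq)

lemma r_cut_surf: "surf p (r_cut k + k, r_cut k, r_cut k + k)"
proof -
  obtain x y z where v: "lift p (k, k) = (x, y, z)" by (cases "lift p (k, k)")
  then have "surf p (x, y, z)" "x = y + k" "z = y + k" using lift_surf[of "(k, k)"] by (auto simp: proj_eq)
  moreover have "r_cut k = y" by (simp add: r_cut_def lift_coordinate_def v)
  ultimately show ?thesis by simp
qed

lemma n_cut_step: "n_cut t - n_cut (t + 1) = 0 \<or> n_cut t - n_cut (t + 1) = 1"
proof -
  define i where "i = n_cut t"
  have v: "surf p (i, i, i + t)" unfolding i_def by (rule n_cut_surf)
  show ?thesis
  proof (cases "exposed E3 (i, i, i + t)")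
    case True
    then have "surf p (i - 1, i - 1, i - 1 + (t + 1))" using exposed_iff[of E3 "(i, i, i + t)"] by simp
    then have "n_cut (t + 1) = i - 1" by (rule n_cut_eqI)
    then show ?thesis by (simp add: i_def)
  next
    case False
    then have "surf p (i, i, i + (t + 1))" using surf_step[OF v False] by (simp add: add.assoc)
    then have "n_cut (t + 1) = i" by (rule n_cut_eqI)
    then show ?thesis by (simp add: i_def)
  qed
qed

lemma r_cut_step: "r_cut k - r_cut (k + 1) = 0 \<or> r_cut k - r_cut (k + 1) = 1"
proof -
  define i where "i = r_cut (k + 1)"
  have v: "surf p (i + (k + 1), i, i + (k + 1))" unfolding i_def by (rule r_cut_surf)
  show ?thesis
  proof (cases "exposed E2 (i + (k + 1), i, i + (k + 1))")
    case True
    then have "surf p (i + k, i, i + k)" using exposed_iff[of E2 "(i + (k + 1), i, i + (k + 1))"] by simp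
    then have "r_cut k = i" by (rule r_cut_eqI)
    then show ?thesis by (simp add: i_def)
  next
    case False
    have e: "i + 1 + k = i + (k + 1)" by simp
    have "surf p (i + 1 + k, i + 1, i + 1 + k)" unfolding e using surf_step[OF v False] by simp
    then have "r_cut k = i + 1" by (rule r_cut_eqI)
    then show ?thesis by (simp add: i_def)
  qed
qed

lemma n_cut_top: "n_cut (int c) = 0"
  using in_box[of 1 1 "nat (int c + 1)"] by (intro n_cut_eqI) (auto simp: surf_def solid_def)

lemma n_cut_bottom: "a \<le> b \<Longrightarrow> n_cut (- int a) = int a"
  using in_box[of "nat (int a + 1)" "nat (int a + 1)" 1] by (intro n_cut_eqI) (auto simp: surf_def solid_def)

lemma r_cut_end: "a \<le> c \<Longrightarrow> r_cut (int a) = 0"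
  using in_box[of "nat (int a + 1)" 1 "nat (int a + 1)"] by (intro r_cut_eqI) (auto simp: surf_def solid_def)

lemma r_cut_0: "r_cut 0 = n_cut 0"
  using n_cut_surf[of 0] by (intro r_cut_eqI) simp

text \<open>If r were greater than n at k, the point (n, n, n + k) + (1, 1, 1) would lie below
  (r + k, r, r + k), and so in the solid.\<close>

lemma r_cut_le_n_cut:
  assumes "0 \<le> k"
  shows "r_cut k \<le> n_cut k"
proof (rule ccontr)
  assume "\<not> r_cut k \<le> n_cut k"
  then have "n_cut k + 1 \<le> r_cut k + k" "n_cut k + 1 \<le> r_cut k" "n_cut k + k + 1 \<le> r_cut k + k"
    using assms by linarith+
  moreover have "(r_cut k + k, r_cut k, r_cut k + k) \<in> solid p" using r_cut_surf by (simp add: surf_def)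
  ultimately have "(n_cut k + 1, n_cut k + 1, n_cut k + k + 1) \<in> solid p" by (rule solid_down[rotated])
  then show False using n_cut_surf[of k] by (simp add: surf_def)
qed

end

lemma SPP_iff:
  assumes "plane_partition a a c p"
  shows "p \<in> SPP a c \<longleftrightarrow> (\<forall>i j k. (i, j, k) \<in> p \<longrightarrow> (j, i, k) \<in> p)"
proof -
  interpret boxed_partition a a c p by unfold_locales (rule assms)
  show ?thesis
  proof
    assume "p \<in> SPP a c"
    then have h: "height p i j = height p j i" if "i \<in> {1..a}" "j \<in> {1..a}" for i j
      using that by (auto simp: SPP_def)
    show "\<forall>i j k. (i, j, k) \<in> p \<longrightarrow> (j, i, k) \<in> p"
    proof (intro allI impI)
      fix i j k assume "(i, j, k) \<in> p"
      then show "(j, i, k) \<in> p" using in_box[of i j k] height_iff[of i j k] height_iff[of j i k] h[of i j] by auto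
    qed
  next
    assume sym: "\<forall>i j k. (i, j, k) \<in> p \<longrightarrow> (j, i, k) \<in> p"
    then have "{k. (i, j, k) \<in> p} = {k. (j, i, k) \<in> p}" for i j by blast
    then show "p \<in> SPP a c" using assms by (simp add: SPP_def height_def)
  qed
qed

lemma CSPP_iff:
  assumes "plane_partition a a a p"
  shows "p \<in> CSPP a \<longleftrightarrow> (\<forall>i j k. (i, j, k) \<in> p \<longleftrightarrow> (k, i, j) \<in> p)"
proof -
  interpret boxed_partition a a a p by unfold_locales (rule assms)
  have conj: "conjugate_parts a (\<lambda>j. height p i j) k = card {j. (i, j, k) \<in> p}" if "1 \<le> i" "1 \<le> k" for i k
  proof -
    have "{j \<in> {1..a}. k \<le> height p i j} = {j. (i, j, k) \<in> p}"
      using height_iff[of i _ k] in_box[of i _ k] that by auto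
    then show ?thesis by (simp add: conjugate_parts_def)
  qed
  show ?thesis
  proof
    assume "p \<in> CSPP a"
    then have h: "height p k i = card {j. (i, j, k) \<in> p}" if "i \<in> {1..a}" "k \<in> {1..a}" for i k
      using that conj[of i k] by (auto simp: CSPP_def)
    have "(i, j, k) \<in> p \<longleftrightarrow> (k, i, j) \<in> p" if "i \<in> {1..a}" "k \<in> {1..a}" for i j k
      using that columns(2)[of i k j] height_iff[of k i j] h[of i k] by auto
    then show "\<forall>i j k. (i, j, k) \<in> p \<longleftrightarrow> (k, i, j) \<in> p"
      using in_box by (metis atLeastAtMost_iff)
  next
    assume cyc: "\<forall>i j k. (i, j, k) \<in> p \<longleftrightarrow> (k, i, j) \<in> p"
    then have "{j. (i, j, k) \<in> p} = {j. (k, i, j) \<in> p}" for i k by blast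
    then have "height p k i = card {j. (i, j, k) \<in> p}" for i k unfolding height_def by metis
    then have "height p k i = conjugate_parts a (\<lambda>j. height p i j) k" if "1 \<le> i" "1 \<le> k" for i k
      using conj[OF that] by metis
    then show "p \<in> CSPP a" using assms unfolding CSPP_def by simp
  qed
qed

lemma self_complementary_iff:
  assumes "plane_partition a a a p"
  shows "(\<forall>i\<in>{1..a}. \<forall>j\<in>{1..a}. height p i j + height p (a - i + 1) (a - j + 1) = a) \<longleftrightarrow>
    (\<forall>i\<in>{1..a}. \<forall>j\<in>{1..a}. \<forall>k\<in>{1..a}. (i, j, k) \<in> p \<longleftrightarrow> (a - i + 1, a - j + 1, a - k + 1) \<notin> p)"
proof -
  interpret boxed_partition a a a p by unfold_locales (rule assms)
  have "height p i j + height p (a - i + 1) (a - j + 1) = a \<longleftrightarrow>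
    (\<forall>k\<in>{1..a}. (i, j, k) \<in> p \<longleftrightarrow> (a - i + 1, a - j + 1, a - k + 1) \<notin> p)" (is "?l \<longleftrightarrow> ?r")
    if ij: "i \<in> {1..a}" "j \<in> {1..a}" for i j
  proof -
    let ?h = "height p i j" and ?g = "height p (a - i + 1) (a - j + 1)"
    have mem: "(i, j, k) \<in> p \<longleftrightarrow> k \<le> ?h" "(a - i + 1, a - j + 1, a - k + 1) \<in> p \<longleftrightarrow> a - k + 1 \<le> ?g"
      if "k \<in> {1..a}" for k
      using height_iff[of i j k] height_iff[of "a - i + 1" "a - j + 1" "a - k + 1"] ij that by auto
    have le: "?h \<le> a" "?g \<le> a" using height_le by auto
    show ?thesis
    proof
      assume ?l
      then show ?r using mem by auto
    next
      assume r: ?r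
      have "?h < k \<longleftrightarrow> a - k + 1 \<le> ?g" if "k \<in> {1..a}" for k using r mem[OF that] that by auto
      from this[of ?h] this[of "Suc ?h"] show ?l using le by (cases "?h = 0"; cases "?h = a"; auto; arith)
    qed
  qed
  then show ?thesis by blast
qed

section \<open>Functions with unit drops as words\<close>

lemma mset_drop_word:
  fixes N :: "int \<Rightarrow> int"
  assumes step: "\<And>t. N t - N (t + 1) = 0 \<or> N t - N (t + 1) = 1"
  shows "mset (map (\<lambda>i. if N (t + int i) \<noteq> N (t + int i + 1) then x else y) [0..<m]) =
    replicate_mset (nat (N t - N (t + int m))) x + replicate_mset (m - nat (N t - N (t + int m))) y \<and>
    0 \<le> N t - N (t + int m) \<and> N t - N (t + int m) \<le> int m"
proof (induction m)
  case (Suc m)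
  have e: "t + int (Suc m) = t + int m + 1" by simp
  have le: "nat (N t - N (t + int m)) \<le> m" and IH: "0 \<le> N t - N (t + int m)" "N t - N (t + int m) \<le> int m"
    using Suc by linarith+
  show ?case
  proof (cases "N (t + int m) = N (t + int m + 1)")
    case True
    then have D: "N t - N (t + int (Suc m)) = N t - N (t + int m)" unfolding e by simp
    have "Suc m - nat (N t - N (t + int m)) = Suc (m - nat (N t - N (t + int m)))" using le by (rule Suc_diff_le)
    then show ?thesis unfolding D using Suc True by simp
  next
    case False
    then have D: "N t - N (t + int (Suc m)) = N t - N (t + int m) + 1" unfolding e using step[of "t + int m"] by auto
    have n1: "nat (N t - N (t + int m) + 1) = Suc (nat (N t - N (t + int m)))" using IH by linarith
    show ?thesis unfolding D n1 using Suc False by simp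
  qed
qed simp

lemma card_flat:
  fixes N :: "int \<Rightarrow> int"
  assumes step: "\<And>t. N t - N (t + 1) = 0 \<or> N t - N (t + 1) = 1"
  shows "int (card {j \<in> {0..i}. N (int j) = N (int j + 1)}) = int i + 1 - (N 0 - N (int i + 1))"
proof (induction i)
  case 0
  have "{j \<in> {0..0::nat}. N (int j) = N (int j + 1)} = (if N 0 = N 1 then {0} else {})" by auto
  then show ?case using step[of 0] by auto
next
  case (Suc i)
  have "{j \<in> {0..Suc i}. N (int j) = N (int j + 1)} =
    (if N (int (Suc i)) = N (int (Suc i) + 1) then insert (Suc i) {j \<in> {0..i}. N (int j) = N (int j + 1)}
     else {j \<in> {0..i}. N (int j) = N (int j + 1)})" by (auto simp: le_Suc_eq)
  then show ?case using Suc step[of "int (Suc i)"] by (auto simp: add.commute)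
qed

text \<open>The function that drops by 1 at the positions of the letter x and is constant elsewhere,
  normalized to end with 0.\<close>

definition tail_count :: "'a \<Rightarrow> 'a list \<Rightarrow> int \<Rightarrow> int" where
  "tail_count x w t = int (count_list (drop (nat t) w) x)"

lemma tail_count_step: "tail_count x w t - tail_count x w (t + 1) = of_bool (0 \<le> t \<and> t < int (length w) \<and> w ! nat t = x)"
proof (cases "0 \<le> t \<and> t < int (length w)")
  case True
  then have "drop (nat t) w = w ! nat t # drop (Suc (nat t)) w" by (intro Cons_nth_drop_Suc[symmetric]) auto
  moreover have "nat (t + 1) = Suc (nat t)" using True by linarith
  ultimately show ?thesis using True by (simp add: tail_count_def)
next
  case False
  then have "t < 0 \<or> int (length w) \<le> t" by auto
  then show ?thesis by (auto simp: tail_count_def)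
qed

lemma tail_count_step': "tail_count x w t - tail_count x w (t + 1) = 0 \<or> tail_count x w t - tail_count x w (t + 1) = 1"
  unfolding tail_count_step by auto

lemma tail_count_nonneg: "0 \<le> tail_count x w t"
  by (simp add: tail_count_def)

lemma tail_count_end: "int (length w) \<le> t \<Longrightarrow> tail_count x w t = 0"
  by (simp add: tail_count_def)

lemma tail_count_0: "t \<le> 0 \<Longrightarrow> tail_count x w t = int (count (mset w) x)"
  by (simp add: tail_count_def count_mset)

lemma drop_steps:
  fixes N :: "int \<Rightarrow> int"
  assumes step: "\<And>t. N t - N (t + 1) = 0 \<or> N t - N (t + 1) = 1" and "s \<le> t"
  shows "N t \<le> N s \<and> N s \<le> N t + (t - s)"
  using \<open>s \<le> t\<close>
proof (induction t rule: int_ge_induct)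
  case (step t)
  then show ?case using assms(1)[of t] by auto
qed simp

lemma word_from_tail_count:
  assumes "set w \<subseteq> {x, y}" "x \<noteq> y"
  shows "map (\<lambda>i. if tail_count x w (int i) \<noteq> tail_count x w (int i + 1) then x else y) [0..<length w] = w"
proof (rule nth_equalityI)
  fix i assume "i < length (map (\<lambda>i. if tail_count x w (int i) \<noteq> tail_count x w (int i + 1) then x else y) [0..<length w])"
  then have i: "i < length w" by simp
  have "tail_count x w (int i) \<noteq> tail_count x w (int i + 1) \<longleftrightarrow> w ! i = x"
    using tail_count_step[of x w "int i"] i by (auto simp: of_bool_def split: if_splits)
  moreover have "w ! i \<in> {x, y}" using assms(1) i nth_mem by blast
  ultimately show "map (\<lambda>i. if tail_count x w (int i) \<noteq> tail_count x w (int i + 1) then x else y) [0..<length w] ! i = w ! i"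
    using i by auto
qed simp

lemma two_letter_words:
  assumes "mset w = replicate_mset k x + replicate_mset l y" "x \<noteq> y"
  shows "set w \<subseteq> {x, y}" "length w = k + l" "count (mset w) x = k" "count (mset w) y = l"
proof -
  have "set_mset (mset w) \<subseteq> {x, y}" unfolding assms(1) by (auto split: if_splits)
  then show "set w \<subseteq> {x, y}" by simp
  show "length w = k + l" using arg_cong[OF assms(1), of size] by simp
  show "count (mset w) x = k" "count (mset w) y = l" unfolding assms(1) using assms(2) by auto
qed

section \<open>Symmetric plane partitions\<close>

abbreviation pair34 :: "letter list" where "pair34 \<equiv> [Plain 3, Plain 4]"
abbreviation single4 :: "letter list" where "single4 \<equiv> [Plain 4]"

lemma SPP_word_in:
  assumes "p \<in> SPP a c" "1 \<le> a"
  shows "boundary_word (SPP_web a c p) \<in> SPP_words a c"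
proof -
  interpret boxed_partition a a c p by unfold_locales (use assms(1) in \<open>simp add: SPP_def\<close>)
  let ?w = "map (\<lambda>i. vertical_letters (- int a + int i)) [0..<a + c]"
  have "mset ?w = replicate_mset a pair34 + replicate_mset c single4"
    using mset_drop_word[of n_cut "- int a" pair34 single4 "a + c", OF n_cut_step] n_cut_top n_cut_bottom
    by (simp add: vertical_letters_def)
  then show ?thesis
    unfolding SPP_word[OF refl assms(2)] SPP_words_def mem_Collect_eq
    by (intro exI[of _ ?w]) (simp add: add.commute)
qed

text \<open>The given word prescribes \<open>n_cut\<close>. Put a cell (x, y, z) into the partition iff the cell (M, M, z)
  with M the maximum of x and y lies below the prescribed surface point on the diagonal plane.\<close>

lemma SPP_word_attained:
  assumes "w \<in> SPP_words a c" "1 \<le> a"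
  shows "\<exists>p\<in>SPP a c. boundary_word (SPP_web a c p) = w"
proof -
  obtain v where w: "w = replicate a [Plain 1] @ replicate c [Barred 4] @ replicate a [Plain 2] @ v"
    and v: "mset v = replicate_mset a pair34 + replicate_mset c single4"
    using assms(1) by (auto simp: SPP_words_def add.commute)
  have ne: "pair34 \<noteq> single4" by simp
  note v' = two_letter_words[OF v ne]
  \<comment> \<open>The vertical cut of the half hexagon starts at t = - a.\<close>
  define N where "N t = tail_count pair34 v (t + int a)" for t
  have step: "N t - N (t + 1) = 0 \<or> N t - N (t + 1) = 1" for t
    using tail_count_step'[of pair34 v "t + int a"] by (simp add: N_def algebra_simps)
  note drops = drop_steps[of N, OF step]
  have N_top: "N (int c) = 0" unfolding N_def by (rule tail_count_end) (use v' in simp)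
  have N_bottom: "N (- int a) = int a" unfolding N_def using tail_count_0[of 0 pair34 v] v' by simp
  define p where "p = {(x, y, z). x \<in> {1..a} \<and> y \<in> {1..a} \<and> z \<in> {1..c} \<and> int (max x y) \<le> N (int z - int (max x y))}"
  have pp: "plane_partition a a c p"
    unfolding plane_partition_def
  proof (intro conjI allI impI)
    show "p \<subseteq> {1..a} \<times> {1..a} \<times> {1..c}" by (auto simp: p_def)
    fix x y z i j k
    assume *: "(x, y, z) \<in> p \<and> 1 \<le> i \<and> i \<le> x \<and> 1 \<le> j \<and> j \<le> y \<and> 1 \<le> k \<and> k \<le> z"
    define M M' where "M = int (max x y)" and "M' = int (max i j)"
    have "M \<le> N (int z - M)" "M' \<le> M" using * by (auto simp: p_def M_def M'_def)
    moreover have "N (int z - M' ) \<le> N (int k - M')" using drops[of "int k - M'" "int z - M'"] * by auto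
    moreover have "N (int z - M) \<le> N (int z - M') + (M - M')" using drops[of "int z - M" "int z - M'"] \<open>M' \<le> M\<close> by simp
    ultimately have "M' \<le> N (int k - M')" by linarith
    then show "(i, j, k) \<in> p" using * by (auto simp: p_def M'_def)
  qed
  interpret boxed_partition a a c p by unfold_locales (rule pp)
  have cut: "n_cut t = N t" if "- int a \<le> t" "t \<le> int c" for t
  proof (rule n_cut_eqI)
    have b: "0 \<le> N t" "N t \<le> int a" "- t \<le> N t" "N t + t \<le> int c"
      using drops[OF that(1)] drops[OF that(2)] N_top N_bottom by linarith+
    have "(nat (N t), nat (N t), nat (N t + t)) \<in> p" if "0 < N t" "0 < N t + t"
      using b that unfolding p_def by auto
    moreover have "(nat (N t + 1), nat (N t + 1), nat (N t + t + 1)) \<notin> p"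
      using b unfolding p_def by auto
    ultimately show "surf p (N t, N t, N t + t)"
      using b by (cases "0 < N t"; cases "0 < N t + t"; simp add: surf_def solid_def)
  qed
  have "map (\<lambda>i. vertical_letters (- int a + int i)) [0..<a + c] = v"
  proof -
    have "vertical_letters (- int a + int i) =
      (if tail_count pair34 v (int i) \<noteq> tail_count pair34 v (int i + 1) then pair34 else single4)" if "i < a + c" for i
      using that cut[of "- int a + int i"] cut[of "- int a + int i + 1"]
      by (simp add: vertical_letters_def N_def algebra_simps)
    then have "map (\<lambda>i. vertical_letters (- int a + int i)) [0..<a + c] =
      map (\<lambda>i. if tail_count pair34 v (int i) \<noteq> tail_count pair34 v (int i + 1) then pair34 else single4) [0..<length v]"
      using v' by simp
    also have "\<dots> = v" by (rule word_from_tail_count[OF v'(1) ne])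
    finally show ?thesis .
  qed
  then have "boundary_word (SPP_web a c p) = w" unfolding SPP_word[OF refl assms(2)] w by simp
  moreover have "p \<in> SPP a c" unfolding SPP_iff[OF pp] by (auto simp: p_def max.commute)
  ultimately show ?thesis by blast
qed

section \<open>Totally symmetric partitions with prescribed heights\<close>

text \<open>Functions n and r with the properties of \<open>n_cut\<close> and \<open>r_cut\<close>. Let G be the set of the points
  (n t, n t, n t + t) and (r t + t, r t, r t + t) and of their images under permutations of the
  coordinates. The order ideal of G is totally symmetric, and it has the prescribed heights because
  the points of G on a cut are the greatest ones of the ideal on this cut.\<close>

locale cube_profile =
  fixes a :: nat and n r :: "int \<Rightarrow> int"
  assumes n_step: "\<And>t. n t - n (t + 1) = 0 \<or> n t - n (t + 1) = 1"
    and r_step: "\<And>t. r t - r (t + 1) = 0 \<or> r t - r (t + 1) = 1"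
    and n_nonneg: "\<And>t. 0 \<le> n t" and r_nonneg: "\<And>t. 0 \<le> r t"
    and n_end: "n (int a) = 0" and r_end: "r (int a) = 0"
    and r_0: "r 0 = n 0" and r_le_n: "\<And>t. 0 \<le> t \<Longrightarrow> r t \<le> n t"
begin

lemma n_drops: "s \<le> t \<Longrightarrow> n t \<le> n s \<and> n s \<le> n t + (t - s)"
  using drop_steps[of n, OF n_step] .

lemma r_drops: "s \<le> t \<Longrightarrow> r t \<le> r s \<and> r s \<le> r t + (t - s)"
  using drop_steps[of r, OF r_step] .

definition under_n :: "int \<Rightarrow> int \<Rightarrow> int \<Rightarrow> bool" where
  "under_n x y z \<longleftrightarrow> (\<exists>t\<ge>0. x \<le> n t + t \<and> y \<le> n t \<and> z \<le> n t)"

definition under_r :: "int \<Rightarrow> int \<Rightarrow> int \<Rightarrow> bool" where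
  "under_r x y z \<longleftrightarrow> (\<exists>t\<ge>0. x \<le> r t + t \<and> y \<le> r t + t \<and> z \<le> r t)"

definition inside :: "int \<Rightarrow> int \<Rightarrow> int \<Rightarrow> bool" where
  "inside x y z \<longleftrightarrow> under_n x y z \<or> under_n y z x \<or> under_n z x y \<or> under_r x y z \<or> under_r y z x \<or> under_r z x y"

lemma inside_rotate: "inside x y z \<longleftrightarrow> inside z x y"
  unfolding inside_def by blast

lemma under_n_commute: "under_n x y z \<Longrightarrow> under_n x z y"
  unfolding under_n_def by blast

lemma under_r_commute: "under_r x y z \<Longrightarrow> under_r y x z"
  unfolding under_r_def by blast

lemma inside_swap: "inside x y z \<Longrightarrow> inside y x z"
  unfolding inside_def using under_n_commute under_r_commute by blast

lemma under_n_mono: "under_n x y z \<Longrightarrow> x' \<le> x \<Longrightarrow> y' \<le> y \<Longrightarrow> z' \<le> z \<Longrightarrow> under_n x' y' z'"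
  unfolding under_n_def by (meson order_trans)

lemma under_r_mono: "under_r x y z \<Longrightarrow> x' \<le> x \<Longrightarrow> y' \<le> y \<Longrightarrow> z' \<le> z \<Longrightarrow> under_r x' y' z'"
  unfolding under_r_def by (meson order_trans)

lemma inside_mono:
  assumes "inside x y z" "x' \<le> x" "y' \<le> y" "z' \<le> z"
  shows "inside x' y' z'"
  using assms(1) unfolding inside_def
  by (elim disjE) (use assms(2-) under_n_mono under_r_mono in meson)+

lemma under_n_bounded: "under_n x y z \<Longrightarrow> 1 \<le> y \<Longrightarrow> x \<le> int a \<and> y \<le> int a \<and> z \<le> int a"
proof -
  assume "under_n x y z" "1 \<le> y"
  then obtain t where t: "0 \<le> t" "x \<le> n t + t" "y \<le> n t" "z \<le> n t" by (auto simp: under_n_def)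
  have "t < int a" using n_drops[of "int a" t] n_end t \<open>1 \<le> y\<close> by linarith
  then show ?thesis using n_drops[of t "int a"] n_end t by linarith
qed

lemma under_r_bounded: "under_r x y z \<Longrightarrow> 1 \<le> z \<Longrightarrow> x \<le> int a \<and> y \<le> int a \<and> z \<le> int a"
proof -
  assume "under_r x y z" "1 \<le> z"
  then obtain t where t: "0 \<le> t" "x \<le> r t + t" "y \<le> r t + t" "z \<le> r t" by (auto simp: under_r_def)
  have "t < int a" using r_drops[of "int a" t] r_end t \<open>1 \<le> z\<close> by linarith
  then show ?thesis using r_drops[of t "int a"] r_end t by linarith
qed

lemma inside_bounded: "inside x y z \<Longrightarrow> 1 \<le> x \<Longrightarrow> 1 \<le> y \<Longrightarrow> 1 \<le> z \<Longrightarrow> x \<le> int a \<and> y \<le> int a \<and> z \<le> int a"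
  unfolding inside_def using under_n_bounded under_r_bounded by blast

text \<open>A generator covers (i, i, i + t) in one of two ways. Either i + t is below its greatest coordinate
  n s + s and i is below n s, and the drop of n between s and t is compared with the
  distance. Or i + t is below n s, hence below n 0, which is at most n t + t. The generators with r
  cover no more than this because r is at most n.\<close>

lemma inside_n:
  assumes "0 \<le> t"
  shows "inside i i (i + t) \<longleftrightarrow> i \<le> n t"
proof
  have long: "i \<le> n t" if s: "0 \<le> s" "i + t \<le> n s + s" "i \<le> n s" for s
    using n_drops[of s t] n_drops[of t s] s by linarith
  have short: "i \<le> n t" if s: "0 \<le> s" "i + t \<le> n s" for s
    using n_drops[of 0 s] n_drops[of 0 t] s assms by linarith
  have long': "i \<le> n t" if s: "0 \<le> s" "i + t \<le> r s + s" "i \<le> r s" for s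
    using long[of s] r_le_n[of s] s by linarith
  have short': "i \<le> n t" if s: "0 \<le> s" "i + t \<le> r s" for s
    using short[of s] r_le_n[of s] s by linarith
  show "i \<le> n t" if "inside i i (i + t)"
    using that unfolding inside_def under_n_def under_r_def
    by (elim disjE exE conjE)
      ((rule short, assumption, assumption) | (rule long, assumption, assumption, assumption)
       | (rule short', assumption, assumption) | (rule long', assumption, assumption, assumption))+
  show "inside i i (i + t)" if "i \<le> n t"
    unfolding inside_def under_n_def using that assms by auto
qed

text \<open>The point (i + t, i, i + t) has two great coordinates. It is covered by (r s + s, r s, r s + s)
  with the great coordinates in the same places, or one of its great coordinates is at most n s,
  hence at most n 0 = r 0.\<close>

lemma inside_r:
  assumes "0 \<le> t"
  shows "inside (i + t) i (i + t) \<longleftrightarrow> i \<le> r t"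
proof
  have long: "i \<le> r t" if s: "0 \<le> s" "i + t \<le> r s + s" "i \<le> r s" for s
    using r_drops[of s t] r_drops[of t s] s by linarith
  have short: "i \<le> r t" if s: "0 \<le> s" "i + t \<le> n s" for s
    using n_drops[of 0 s] r_drops[of 0 t] s assms r_0 by linarith
  have short': "i \<le> r t" if s: "0 \<le> s" "i + t \<le> r s" for s
    using short[of s] r_le_n[of s] s by linarith
  show "i \<le> r t" if "inside (i + t) i (i + t)"
    using that unfolding inside_def under_n_def under_r_def
    by (elim disjE exE conjE)
      ((rule short, assumption, assumption) | (rule short', assumption, assumption)
       | (rule long, assumption, assumption, assumption))+
  show "inside (i + t) i (i + t)" if "i \<le> r t"
    unfolding inside_def under_r_def using that assms by auto
qed

definition cells :: pp where
  "cells = {(x, y, z). 1 \<le> x \<and> 1 \<le> y \<and> 1 \<le> z \<and> inside (int x) (int y) (int z)}"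

lemma plane_partition_cells: "plane_partition a a a cells"
  unfolding plane_partition_def
proof (intro conjI allI impI)
  show "cells \<subseteq> {1..a} \<times> {1..a} \<times> {1..a}"
    using inside_bounded by (fastforce simp: cells_def)
  fix x y z i j k
  assume *: "(x, y, z) \<in> cells \<and> 1 \<le> i \<and> i \<le> x \<and> 1 \<le> j \<and> j \<le> y \<and> 1 \<le> k \<and> k \<le> z"
  then show "(i, j, k) \<in> cells" using inside_mono[of "int x" "int y" "int z" "int i" "int j" "int k"] by (simp add: cells_def)
qed

lemma TSPP_cells: "cells \<in> TSPP a"
proof -
  have "cells \<in> SPP a a" unfolding SPP_iff[OF plane_partition_cells] using inside_swap by (auto simp: cells_def)
  moreover have "cells \<in> CSPP a" unfolding CSPP_iff[OF plane_partition_cells] using inside_rotate by (auto simp: cells_def)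
  ultimately show ?thesis by (simp add: TSPP_def)
qed

lemma solid_cells: "(x, y, z) \<in> solid cells \<longleftrightarrow> x \<le> 0 \<or> y \<le> 0 \<or> z \<le> 0 \<or> inside x y z"
  by (auto simp: solid_def cells_def)

sublocale cells: boxed_partition a a a cells
  by unfold_locales (rule plane_partition_cells)

lemma n_cut_cells: "0 \<le> t \<Longrightarrow> cells.n_cut t = n t"
  using inside_n[of t "n t"] inside_n[of t "n t + 1"] n_nonneg[of t]
  by (intro cells.n_cut_eqI) (simp add: surf_def solid_cells add.commute add.left_commute)

lemma r_cut_cells: "0 \<le> t \<Longrightarrow> cells.r_cut t = r t"
  using inside_r[of t "r t"] inside_r[of t "r t + 1"] r_nonneg[of t]
  by (intro cells.r_cut_eqI) (simp add: surf_def solid_cells add.commute add.left_commute)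

end

section \<open>Totally symmetric plane partitions\<close>

lemma rev_map_index: "map (\<lambda>i. g (int a - 1 - int i)) [0..<a] = rev (map (\<lambda>i. g (int i)) [0..<a])"
  by (rule nth_equalityI) (auto simp: rev_nth of_nat_diff algebra_simps)

lemma (in boxed_partition) vertical_letters_eq:
  "vertical_letters = (\<lambda>t. if n_cut t \<noteq> n_cut (t + 1) then pair34 else single4)"
  by (simp add: vertical_letters_def fun_eq_iff)

lemma (in boxed_partition) slanted_letters_eq:
  "slanted_letters = (\<lambda>t. if r_cut t \<noteq> r_cut (t + 1) then [Plain 2] else [Plain 2, Plain 3])"
  by (simp add: slanted_letters_def fun_eq_iff)

abbreviation flat_before :: "letter list list \<Rightarrow> letter list list \<Rightarrow> nat \<Rightarrow> bool" where
  "flat_before u v i \<equiv> card {j \<in> {length u - 1 - i..length u - 1}. u ! j = [Plain 2, Plain 3]}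
     \<le> card {j \<in> {0..i}. v ! j = single4}"

text \<open>The letters (23), read from the centre, are the steps in which r stays, and the letters 4 are
  those in which n stays. After i + 1 steps their numbers are i + 1 minus the drops of r and n, and
  the two functions start with the same value.\<close>

lemma flat_before_iff:
  fixes n r :: "int \<Rightarrow> int"
  assumes n: "\<And>t. n t - n (t + 1) = 0 \<or> n t - n (t + 1) = 1"
    and r: "\<And>t. r t - r (t + 1) = 0 \<or> r t - r (t + 1) = 1" and "r 0 = n 0" "i < a"
    and v: "\<And>j. j < a \<Longrightarrow> v ! j = single4 \<longleftrightarrow> n (int j) = n (int j + 1)"
    and u: "\<And>j. j < a \<Longrightarrow> u ! (a - 1 - j) = [Plain 2, Plain 3] \<longleftrightarrow> r (int j) = r (int j + 1)"
    and len: "length u = a"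
  shows "flat_before u v i \<longleftrightarrow> r (int i + 1) \<le> n (int i + 1)"
proof -
  have "{j \<in> {0..i}. v ! j = single4} = {j \<in> {0..i}. n (int j) = n (int j + 1)}" using v \<open>i < a\<close> by auto
  then have c1: "int (card {j \<in> {0..i}. v ! j = single4}) = int i + 1 - (n 0 - n (int i + 1))"
    using card_flat[of n i, OF n] by simp
  have "{j \<in> {a - 1 - i..a - 1}. u ! j = [Plain 2, Plain 3]} = (\<lambda>j. a - 1 - j) ` {j \<in> {0..i}. r (int j) = r (int j + 1)}" (is "?A = ?f ` ?B")
  proof
    show "?A \<subseteq> ?f ` ?B"
    proof
      fix j assume j: "j \<in> ?A"
      then have "a - 1 - (a - 1 - j) = j" "a - 1 - j < a" using \<open>i < a\<close> by auto
      then have "a - 1 - j \<in> ?B" using j u[of "a - 1 - j"] by auto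
      then show "j \<in> ?f ` ?B" using \<open>a - 1 - (a - 1 - j) = j\<close> by (metis imageI)
    qed
    show "?f ` ?B \<subseteq> ?A" using u \<open>i < a\<close> by auto
  qed
  moreover have "inj_on ?f ?B" using \<open>i < a\<close> by (intro inj_onI) auto
  ultimately have "card ?A = card ?B" by (simp add: card_image)
  then have c2: "int (card ?A) = int i + 1 - (r 0 - r (int i + 1))" using card_flat[of r i, OF r] by simp
  show ?thesis unfolding len using c1 c2 \<open>r 0 = n 0\<close> by linarith
qed

lemma TSPP_word_in:
  assumes "p \<in> TSPP a" "1 \<le> a"
  shows "boundary_word (TSPP_web a p) \<in> TSPP_words a"
proof -
  interpret cubic_partition a p by unfold_locales (use assms in \<open>auto simp: TSPP_def SPP_def\<close>)
  let ?v = "map (\<lambda>i. vertical_letters (int i)) [0..<a]"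
  let ?u = "map (\<lambda>i. slanted_letters (int a - 1 - int i)) [0..<a]"
  define m where "m = nat (n_cut 0)"
  have ends: "n_cut (int a) = 0" "r_cut (int a) = 0" using n_cut_top r_cut_end by auto
  have m: "n_cut 0 = int m" "m \<le> a"
    using drop_steps[of n_cut 0 "int a", OF n_cut_step] ends by (auto simp: m_def)
  have "mset ?v = replicate_mset m pair34 + replicate_mset (a - m) single4"
    using mset_drop_word[of n_cut 0 pair34 single4 a, OF n_cut_step] ends m by (simp add: vertical_letters_eq)
  then have v: "mset ?v = replicate_mset (a - m) single4 + replicate_mset m pair34" by (simp add: add.commute)
  have "mset ?u = mset (map (\<lambda>i. slanted_letters (int i)) [0..<a])"
    unfolding rev_map_index by simp
  also have "\<dots> = replicate_mset m [Plain 2] + replicate_mset (a - m) [Plain 2, Plain 3]"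
    using mset_drop_word[of r_cut 0 "[Plain 2]" "[Plain 2, Plain 3]" a, OF r_cut_step] ends m r_cut_0
    by (simp add: slanted_letters_eq)
  finally have u: "mset ?u = replicate_mset (a - m) [Plain 2, Plain 3] + replicate_mset m [Plain 2]" by (simp add: add.commute)
  have "flat_before ?u ?v i" if "i < a - 1" for i
  proof -
    have "flat_before ?u ?v i \<longleftrightarrow> r_cut (int i + 1) \<le> n_cut (int i + 1)"
    proof (rule flat_before_iff[of n_cut r_cut i a, OF n_cut_step r_cut_step r_cut_0])
      show "?u ! (a - 1 - j) = [Plain 2, Plain 3] \<longleftrightarrow> r_cut (int j) = r_cut (int j + 1)" if "j < a" for j
      proof -
        have "int a - 1 - int (a - 1 - j) = int j" using that by simp
        then show ?thesis using that by (simp add: slanted_letters_eq add.commute)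
      qed
    qed (use that in \<open>auto simp: vertical_letters_eq\<close>)
    then show ?thesis using r_cut_le_n_cut[of "int i + 1"] by simp
  qed
  then show ?thesis
    unfolding TSPP_word TSPP_words_def mem_Collect_eq
    by (intro exI[of _ ?u] exI[of _ ?v] exI[of _ m]) (use u v m in simp)
qed

lemma (in cube_profile) cells_vertical:
  assumes "v = map (\<lambda>i. if n (int i) \<noteq> n (int i + 1) then pair34 else single4) [0..<length v]" "length v = a"
  shows "map (\<lambda>i. cells.vertical_letters (int i)) [0..<a] = v"
proof -
  have "cells.vertical_letters (int i) = (if n (int i) \<noteq> n (int i + 1) then pair34 else single4)" for i
    using n_cut_cells by (simp add: cells.vertical_letters_eq)
  then show ?thesis using assms by simp
qed

lemma TSPP_word_attained:
  assumes "w \<in> TSPP_words a" "1 \<le> a"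
  shows "\<exists>p\<in>TSPP a. boundary_word (TSPP_web a p) = w"
proof -
  obtain u v m where w: "w = replicate a [Plain 1] @ u @ v" and m: "m \<le> a"
    and mu: "mset u = replicate_mset (a - m) [Plain 2, Plain 3] + replicate_mset m [Plain 2]"
    and mv: "mset v = replicate_mset (a - m) single4 + replicate_mset m pair34"
    and cond: "\<And>i. i < a - 1 \<Longrightarrow> card {j \<in> {a - 1 - i..a - 1}. u ! j = [Plain 2, Plain 3]} \<le> card {j \<in> {0..i}. v ! j = single4}"
    using assms(1) unfolding TSPP_words_def by blast
  have ne: "single4 \<noteq> pair34" "[Plain 2, Plain 3] \<noteq> [Plain 2]" by simp_all
  note u = two_letter_words[OF mu ne(2)] and v = two_letter_words[OF mv ne(1)]
  have len: "length u = a" "length v = a" using u v m by auto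
  define n where "n = tail_count pair34 v"
  define r where "r = tail_count [Plain 2] (rev u)"
  have step: "n t - n (t + 1) = 0 \<or> n t - n (t + 1) = 1" "r t - r (t + 1) = 0 \<or> r t - r (t + 1) = 1" for t
    unfolding n_def r_def by (rule tail_count_step')+
  have start: "r 0 = n 0" unfolding n_def r_def using u v by (simp add: tail_count_0)
  have ends: "n (int a) = 0" "r (int a) = 0" unfolding n_def r_def using len by (auto intro!: tail_count_end)
  have letters: "v ! j = single4 \<longleftrightarrow> n (int j) = n (int j + 1)"
    "u ! (a - 1 - j) = [Plain 2, Plain 3] \<longleftrightarrow> r (int j) = r (int j + 1)" if "j < a" for j
  proof -
    have "v ! j \<in> set v" "rev u ! j \<in> set (rev u)" using that len by (intro nth_mem; simp)+
    then have "v ! j \<in> {single4, pair34}" "rev u ! j \<in> {[Plain 2, Plain 3], [Plain 2]}"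
      using u(1) v(1) unfolding set_rev by blast+
    then show "v ! j = single4 \<longleftrightarrow> n (int j) = n (int j + 1)"
      "u ! (a - 1 - j) = [Plain 2, Plain 3] \<longleftrightarrow> r (int j) = r (int j + 1)"
      using tail_count_step[of pair34 v "int j"] tail_count_step[of "[Plain 2]" "rev u" "int j"] that len
      by (auto simp: n_def r_def rev_nth)
  qed
  have le: "r t \<le> n t" if "0 \<le> t" for t
  proof (cases "t = 0 \<or> int a \<le> t")
    case True
    then show ?thesis
      using start len tail_count_nonneg[of pair34 v t] tail_count_end[of "rev u" t "[Plain 2]"] by (auto simp: n_def r_def)
  next
    case False
    define i where "i = nat (t - 1)"
    have i: "i < a - 1" "t = int i + 1" using False that by (auto simp: i_def)
    have "flat_before u v i \<longleftrightarrow> r (int i + 1) \<le> n (int i + 1)"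
      by (rule flat_before_iff[of n r i a, OF step start]) (use i letters len in auto)
    then show ?thesis using cond[OF i(1)] i len by simp
  qed
  interpret cube_profile a n r
    by unfold_locales (use step ends start le tail_count_nonneg in \<open>auto simp: n_def r_def\<close>)
  interpret cubic_partition a cells by unfold_locales (rule assms(2))
  have "map (\<lambda>i. cells.slanted_letters (int i)) [0..<a] = rev u"
  proof -
    have "cells.slanted_letters (int i) = (if r (int i) \<noteq> r (int i + 1) then [Plain 2] else [Plain 2, Plain 3])" for i
      using r_cut_cells by (simp add: cells.slanted_letters_eq)
    then show ?thesis
      using word_from_tail_count[of "rev u" "[Plain 2]" "[Plain 2, Plain 3]"] u(1) len by (simp add: r_def insert_commute)
  qed
  then have "map (\<lambda>i. cells.slanted_letters (int a - 1 - int i)) [0..<a] = u" unfolding rev_map_index by simp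
  moreover have "map (\<lambda>i. cells.vertical_letters (int i)) [0..<a] = v"
    by (rule cells_vertical) (use word_from_tail_count[of v pair34 single4] v(1) len in \<open>auto simp: n_def insert_commute\<close>)
  ultimately have "boundary_word (TSPP_web a cells) = w" unfolding TSPP_word w by simp
  then show ?thesis using TSPP_cells by blast
qed

section \<open>Cyclically symmetric plane partitions\<close>

text \<open>Rotation takes the surface point (n, n, n + k) over the vertical cut to (n + k, n, n) over the
  slanted one, and it takes squares orthogonal to \<open>E3\<close> to squares orthogonal to \<open>E1\<close>.\<close>

lemma CSPP_slanted:
  assumes "p \<in> CSPP a" "1 \<le> a" "0 \<le> k" "k < int a"
  shows "cubic_partition.slanted_barred a p k =
    (if boxed_partition.n_cut p k \<noteq> boxed_partition.n_cut p (k + 1) then [Barred 3, Barred 1] else [Barred 1])"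
proof -
  have pp: "plane_partition a a a p" using assms(1) by (simp add: CSPP_def)
  interpret cubic_partition a p by unfold_locales (use pp assms(2) in auto)
  have cyc: "(x, y, z) \<in> solid p \<longleftrightarrow> (z, x, y) \<in> solid p" for x y z
    using assms(1) CSPP_iff[OF pp] by (auto simp: solid_def)
  define i where "i = n_cut k"
  have v: "surf p (i, i, i + k)" unfolding i_def by (rule n_cut_surf)
  then have v': "surf p (i + k, i, i)" using cyc[of i i "i + k"] cyc[of "i + 1" "i + 1" "i + k + 1"] by (simp add: surf_def)
  have A: "(k, - k) \<in> hexagon a a a" "(0, 2 * k) \<in> hexagon a a a" using assms(3,4) by (auto simp: hexagon_iff)
  have "hourglass_at (lozenges a a a p) (E1, (k, - k)) \<longleftrightarrow> exposed E1 (i + k, i, i)"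
    using hourglass_iff[OF v', of E1] A(1) by (simp add: proj_eq)
  also have "\<dots> \<longleftrightarrow> exposed E3 (i, i, i + k)"
    unfolding exposed_def using cyc[of i i "i + k"] cyc[of i i "i + k + 1"] by (simp add: algebra_simps)
  also have "\<dots> \<longleftrightarrow> hourglass_at (lozenges a a a p) (E3, (0, 2 * k))"
    using hourglass_iff[OF v, of E3] A(2) by (simp add: proj_eq)
  also have "\<dots> \<longleftrightarrow> n_cut k \<noteq> n_cut (k + 1)"
    using hourglass_vertical[OF A(2)] by (auto simp: of_bool_def split: if_splits)
  finally show ?thesis by (simp add: slanted_barred_def)
qed

lemma CSPP_slanted_word:
  assumes "p \<in> CSPP a" "1 \<le> a"
  shows "map (\<lambda>i. cubic_partition.slanted_barred a p (int a - 1 - int i)) [0..<a] =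
    rev (map (\<lambda>i. if boxed_partition.n_cut p (int i) \<noteq> boxed_partition.n_cut p (int i + 1) then [Barred 3, Barred 1] else [Barred 1]) [0..<a])"
proof -
  have "map (\<lambda>i. cubic_partition.slanted_barred a p (int i)) [0..<a] =
    map (\<lambda>i. if boxed_partition.n_cut p (int i) \<noteq> boxed_partition.n_cut p (int i + 1) then [Barred 3, Barred 1] else [Barred 1]) [0..<a]"
    using CSPP_slanted[OF assms] by (intro map_cong) auto
  then show ?thesis unfolding rev_map_index by (rule arg_cong)
qed

lemma CSPP_word_in:
  assumes "p \<in> CSPP a" "1 \<le> a"
  shows "boundary_word (CSPP_web a p) \<in> CSPP_words a"
proof -
  interpret cubic_partition a p by unfold_locales (use assms in \<open>auto simp: CSPP_def\<close>)
  let ?v = "map (\<lambda>i. vertical_letters (int i)) [0..<a]"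
  let ?u' = "map (\<lambda>i. if n_cut (int i) \<noteq> n_cut (int i + 1) then [Barred 3, Barred 1] else [Barred 1]) [0..<a]"
  let ?u = "map (\<lambda>i. slanted_barred (int a - 1 - int i)) [0..<a]"
  have u_eq: "?u = rev ?u'" using CSPP_slanted_word[OF assms] .
  define m where "m = nat (n_cut 0)"
  have ends: "n_cut (int a) = 0" using n_cut_top by auto
  have m: "n_cut 0 = int m" "m \<le> a"
    using drop_steps[of n_cut 0 "int a", OF n_cut_step] ends by (auto simp: m_def)
  have "mset ?v = replicate_mset m pair34 + replicate_mset (a - m) single4"
    using mset_drop_word[of n_cut 0 pair34 single4 a, OF n_cut_step] ends m by (simp add: vertical_letters_eq)
  then have v: "mset ?v = replicate_mset (a - m) single4 + replicate_mset m pair34" by (simp add: add.commute)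
  have u: "mset ?u = replicate_mset m [Barred 3, Barred 1] + replicate_mset (a - m) [Barred 1]"
    unfolding u_eq using mset_drop_word[of n_cut 0 "[Barred 3, Barred 1]" "[Barred 1]" a, OF n_cut_step] ends m by simp
  have "?v ! (a - i - 1) = pair34" if "i < a" "?u ! i = [Barred 3, Barred 1]" for i
  proof -
    have "?u' ! (a - i - 1) = [Barred 3, Barred 1]" using that unfolding u_eq by (simp add: rev_nth)
    then show ?thesis using that(1) by (simp add: vertical_letters_eq split: if_splits)
  qed
  then show ?thesis
    unfolding CSPP_word CSPP_words_def mem_Collect_eq
    by (intro exI[of _ ?u] exI[of _ ?v] exI[of _ m]) (use u v m in simp)
qed

text \<open>A totally symmetric partition suffices, since only the heights over the vertical cut matter.\<close>

lemma CSPP_word_attained: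
  assumes "w \<in> CSPP_words a" "1 \<le> a"
  shows "\<exists>p\<in>CSPP a. boundary_word (CSPP_web a p) = w"
proof -
  obtain u v m where w: "w = replicate a [Plain 1] @ replicate a [Barred 4] @ u @ v" and m: "m \<le> a"
    and mu: "mset u = replicate_mset m [Barred 3, Barred 1] + replicate_mset (a - m) [Barred 1]"
    and mv: "mset v = replicate_mset (a - m) single4 + replicate_mset m pair34"
    and cond: "\<And>i. i < a \<Longrightarrow> u ! i = [Barred 3, Barred 1] \<Longrightarrow> v ! (a - i - 1) = pair34"
    using assms(1) unfolding CSPP_words_def by blast
  have ne: "single4 \<noteq> pair34" "[Barred 3, Barred 1] \<noteq> [Barred 1]" by simp_all
  note u = two_letter_words[OF mu ne(2)] and v = two_letter_words[OF mv ne(1)]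
  have len: "length u = a" "length v = a" using u v m by auto
  define n where "n = tail_count pair34 v"
  \<comment> \<open>The least nonnegative function with r 0 = m whose drops are at most 1, hence at most n.\<close>
  define r where "r t = max 0 (int m - t)" for t
  have step: "n t - n (t + 1) = 0 \<or> n t - n (t + 1) = 1" "r t - r (t + 1) = 0 \<or> r t - r (t + 1) = 1" for t
    unfolding n_def by (rule tail_count_step') (auto simp: r_def)
  have start: "n 0 = int m" unfolding n_def using v by (simp add: tail_count_0)
  interpret cube_profile a n r
  proof
    show "r t \<le> n t" if "0 \<le> t" for t
      using drop_steps[of n 0 t, OF step(1) that] start tail_count_nonneg[of pair34 v t] by (auto simp: r_def n_def)
  qed (use step start tail_count_nonneg len m in \<open>auto simp: n_def r_def intro!: tail_count_end\<close>)
  have cells: "cells \<in> CSPP a" using TSPP_cells by (simp add: TSPP_def)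
  interpret cubic_partition a cells by unfold_locales (rule assms(2))
  have "v = map (\<lambda>i. if n (int i) \<noteq> n (int i + 1) then pair34 else single4) [0..<length v]"
    using word_from_tail_count[of v pair34 single4] v(1) unfolding n_def by (simp add: insert_commute)
  from cells_vertical[OF this len(2)] have vv: "map (\<lambda>i. cells.vertical_letters (int i)) [0..<a] = v" .
  \<comment> \<open>The letters of the two subwords match one way by hypothesis, hence both ways since there are equally many.\<close>
  have same: "u ! i = [Barred 3, Barred 1] \<longleftrightarrow> v ! (a - i - 1) = pair34" if "i < a" for i
  proof -
    let ?U = "{i. i < a \<and> u ! i = [Barred 3, Barred 1]}" and ?V = "{i. i < a \<and> v ! (a - i - 1) = pair34}"
    have "card ?U = m"
      using u(3) len(1) by (simp add: count_mset count_list_eq_length_filter length_filter_conv_card eq_commute)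
    moreover have "card ?V = m"
    proof -
      have "count (mset (rev v)) pair34 = m" using v(4) by simp
      moreover have "?V = {i. i < length (rev v) \<and> rev v ! i = pair34}" using len by (auto simp: rev_nth)
      ultimately show ?thesis
        by (simp only: count_mset count_list_eq_length_filter length_filter_conv_card) (simp add: eq_commute)
    qed
    moreover have "?U \<subseteq> ?V" using cond by auto
    ultimately have "?U = ?V" using card_subset_eq[of ?V ?U] by simp
    then show ?thesis using that by blast
  qed
  have "map (\<lambda>i. slanted_barred (int a - 1 - int i)) [0..<a] = u"
    unfolding CSPP_slanted_word[OF cells assms(2)]
  proof (rule nth_equalityI)
    show "length (rev (map (\<lambda>i. if cells.n_cut (int i) \<noteq> cells.n_cut (int i + 1) then [Barred 3, Barred 1] else [Barred 1]) [0..<a])) = length u"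
      using len by simp
    fix i assume "i < length (rev (map (\<lambda>i. if cells.n_cut (int i) \<noteq> cells.n_cut (int i + 1) then [Barred 3, Barred 1] else [Barred 1]) [0..<a]))"
    then have i: "i < a" by simp
    have "v ! (a - i - 1) = cells.vertical_letters (int (a - i - 1))" using i by (subst vv[symmetric]) simp
    then have "v ! (a - i - 1) = pair34 \<longleftrightarrow> cells.n_cut (int (a - i - 1)) \<noteq> cells.n_cut (int (a - i - 1) + 1)"
      by (simp add: cells.vertical_letters_eq)
    moreover have "u ! i \<in> {[Barred 3, Barred 1], [Barred 1]}"
    proof -
      have "u ! i \<in> set u" using i len by simp
      then show ?thesis using u(1) by blast
    qed
    ultimately show "rev (map (\<lambda>i. if cells.n_cut (int i) \<noteq> cells.n_cut (int i + 1) then [Barred 3, Barred 1] else [Barred 1]) [0..<a]) ! i = u ! i"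
      using same[OF i] i by (auto simp: rev_nth)
  qed
  then have "boundary_word (CSPP_web a cells) = w" unfolding CSPP_word w using vv by simp
  then show ?thesis using cells by blast
qed

section \<open>Totally symmetric self-complementary plane partitions\<close>

lemma TSSCPP_iff:
  assumes "plane_partition a a a p"
  shows "p \<in> TSSCPP a \<longleftrightarrow> (\<forall>i j k. (i, j, k) \<in> p \<longrightarrow> (j, i, k) \<in> p) \<and> (\<forall>i j k. (i, j, k) \<in> p \<longleftrightarrow> (k, i, j) \<in> p) \<and>
    (\<forall>i\<in>{1..a}. \<forall>j\<in>{1..a}. \<forall>k\<in>{1..a}. (i, j, k) \<in> p \<longleftrightarrow> (a - i + 1, a - j + 1, a - k + 1) \<notin> p)"
  unfolding self_complementary_iff[OF assms, symmetric] SPP_iff[OF assms, symmetric] CSPP_iff[OF assms, symmetric]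
  by (auto simp: TSSCPP_def TSPP_def)

locale self_complementary = boxed_partition "2 * d" "2 * d" "2 * d" p for d :: nat and p :: pp +
  assumes d_pos: "1 \<le> d" and TSSCPP: "p \<in> TSSCPP (2 * d)"
begin

lemma solid_swap: "(x, y, z) \<in> solid p \<longleftrightarrow> (y, x, z) \<in> solid p"
proof -
  have "(nat x, nat y, nat z) \<in> p \<longleftrightarrow> (nat y, nat x, nat z) \<in> p"
    using TSSCPP unfolding TSSCPP_iff[OF pp] by blast
  then show ?thesis by (auto simp: solid_def)
qed

lemma solid_rotate: "(x, y, z) \<in> solid p \<longleftrightarrow> (z, x, y) \<in> solid p"
proof -
  have "(nat x, nat y, nat z) \<in> p \<longleftrightarrow> (nat z, nat x, nat y) \<in> p"
    using TSSCPP unfolding TSSCPP_iff[OF pp] by blast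
  then show ?thesis by (auto simp: solid_def)
qed

lemma solid_complement:
  assumes "1 \<le> x" "x \<le> 2 * int d" "1 \<le> y" "y \<le> 2 * int d" "1 \<le> z" "z \<le> 2 * int d"
  shows "(x, y, z) \<in> solid p \<longleftrightarrow> (2 * int d + 1 - x, 2 * int d + 1 - y, 2 * int d + 1 - z) \<notin> solid p"
proof -
  have n: "nat (2 * int d + 1 - x) = 2 * d - nat x + 1" if "1 \<le> x" "x \<le> 2 * int d" for x
    using that by linarith
  have m: "nat x \<in> {1..2 * d}" "nat y \<in> {1..2 * d}" "nat z \<in> {1..2 * d}" using assms by auto
  have "(nat x, nat y, nat z) \<in> p \<longleftrightarrow> (2 * d - nat x + 1, 2 * d - nat y + 1, 2 * d - nat z + 1) \<notin> p"
    using TSSCPP m unfolding TSSCPP_iff[OF pp] by blast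
  then show ?thesis using assms n[of x] n[of y] n[of z] by (simp add: solid_def)
qed

lemma surf_complement:
  assumes "surf p (x, y, z)" "x \<le> 2 * int d" "y \<le> 2 * int d" "z \<le> 2 * int d"
  shows "surf p (2 * int d - x, 2 * int d - y, 2 * int d - z)"
proof -
  let ?a = "2 * int d"
  have nonneg: "0 \<le> x" "0 \<le> y" "0 \<le> z" using assms(1) by (auto simp: surf_def solid_def)
  have "(?a - x, ?a - y, ?a - z) \<in> solid p"
  proof (cases "?a - x \<le> 0 \<or> ?a - y \<le> 0 \<or> ?a - z \<le> 0")
    case False
    have "(x + 1, y + 1, z + 1) \<notin> solid p" using assms(1) by (simp add: surf_def)
    then show ?thesis using False nonneg solid_complement[of "x + 1" "y + 1" "z + 1"] by simp
  qed (auto simp: solid_def)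
  moreover have "(?a - x + 1, ?a - y + 1, ?a - z + 1) \<notin> solid p"
  proof (cases "x = 0 \<or> y = 0 \<or> z = 0")
    case True
    then show ?thesis
      using solid_box[of "?a - x + 1" "?a - y + 1" "?a - z + 1"] assms by auto
  next
    case False
    have "(x, y, z) \<in> solid p" using assms(1) by (simp add: surf_def)
    then show ?thesis using False nonneg assms(2-4) solid_complement[of x y z] by (simp add: algebra_simps)
  qed
  ultimately show ?thesis by (simp add: surf_def)
qed

lemma surf_rotate: "surf p (x, y, z) \<Longrightarrow> surf p (z, x, y)"
  using solid_rotate[of x y z] solid_rotate[of "x + 1" "y + 1" "z + 1"] by (simp add: surf_def)

lemma surf_swap: "surf p (x, y, z) \<Longrightarrow> surf p (y, x, z)"
  using solid_swap[of x y z] solid_swap[of "x + 1" "y + 1" "z + 1"] by (simp add: surf_def)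

text \<open>The surface is invariant under (x, y, z) \<open>\<mapsto>\<close> (2 d - x, 2 d - z, 2 d - y), which covers the
  reflection of the plane in the line Y = 3 X. This reflection exchanges the ends of the side. If
  there were no hourglass, the coordinate x would increase by 1 from one end to the other, while
  its value at the other end is 2 d - x. This is impossible for reasons of parity.\<close>

lemma bisected_hourglass:
  assumes "0 \<le> k" "k < int d"
  shows "hourglass_at (lozenges (2 * d) (2 * d) (2 * d) p) (E1, (k, 3 * k + 2))"
proof (rule ccontr)
  let ?A = "(k, 3 * k + 2)"
  assume no: "\<not> hourglass_at (lozenges (2 * d) (2 * d) (2 * d) p) (E1, ?A)"
  have A: "?A \<in> hexagon (2 * d) (2 * d) (2 * d)" using assms by (simp add: hexagon_iff)
  obtain x y z where v: "lift p ?A = (x, y, z)" by (cases "lift p ?A")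
  have s: "surf p (x, y, z)" "proj (x, y, z) = ?A" using lift_surf[of ?A] v by auto
  have xyz: "x = y + k" "z = y + 2 * k + 1" using s(2) by (auto simp: proj_eq)
  have box: "x \<le> 2 * int d \<and> y \<le> 2 * int d \<and> z \<le> 2 * int d"
    using surf_in_box[OF s(1)] A s(2) by auto
  have "surf p (x + 1, y, z)"
    using surf_step[OF s(1), of E1] hourglass_iff_exposed[OF A, of E1] no v by simp
  moreover have "surf p (2 * int d - x, 2 * int d - z, 2 * int d - y)"
  proof -
    have "surf p (2 * int d - x, 2 * int d - y, 2 * int d - z)" using surf_complement[OF s(1)] box by blast
    then show ?thesis using surf_rotate surf_swap by blast
  qed
  moreover have "proj (x + 1, y, z) = proj (2 * int d - x, 2 * int d - z, 2 * int d - y)"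
    by (simp add: proj_eq xyz)
  ultimately have "(x + 1, y, z) = (2 * int d - x, 2 * int d - z, 2 * int d - y)" by (rule surf_unique)
  then have "2 * x + 1 = 2 * int d" by simp
  then show False by presburger
qed

text \<open>The complement of (n, n, n + k) is (2 d - n, 2 d - n, 2 d - n - k), a permutation of a surface point
  over the slanted cut.\<close>

lemma r_cut_n_cut:
  assumes "0 \<le> k" "k \<le> 2 * int d"
  shows "n_cut k + r_cut k = 2 * int d - k"
proof -
  let ?n = "n_cut k"
  have A: "(0, 2 * k) \<in> hexagon (2 * d) (2 * d) (2 * d)" using assms by (simp add: hexagon_iff)
  have s: "surf p (?n, ?n, ?n + k)" by (rule n_cut_surf)
  have "?n \<le> 2 * int d \<and> ?n + k \<le> 2 * int d" using surf_in_box[OF s] A by (simp add: proj_eq)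
  then have "surf p (2 * int d - ?n, 2 * int d - ?n, 2 * int d - (?n + k))" using surf_complement[OF s] by blast
  then have "surf p (2 * int d - ?n, 2 * int d - (?n + k), 2 * int d - ?n)" using surf_rotate by blast
  then have "surf p ((2 * int d - ?n - k) + k, 2 * int d - ?n - k, (2 * int d - ?n - k) + k)" by (simp add: algebra_simps)
  then have "r_cut k = 2 * int d - ?n - k" by (rule r_cut_eqI)
  then show ?thesis by simp
qed

sublocale bisected_partition d p
  by unfold_locales (use d_pos bisected_hourglass in auto)

end

lemma count_list_mset: "count_list xs x = count (mset xs) x"
  by (simp add: count_mset)

lemma TSSCPP_word_in:
  assumes "p \<in> TSSCPP (2 * d)" "1 \<le> d"
  shows "boundary_word (TSSCPP_web d p) \<in> TSSCPP_words d"
proof -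
  interpret self_complementary d p
    by unfold_locales (use assms in \<open>auto simp: TSSCPP_def TSPP_def SPP_def\<close>)
  let ?f = "\<lambda>i. vertical_letters (int i)"
  let ?w = "map (\<lambda>i. vertical_letters (1 + int i)) [0..<2 * d - 2]"
  \<comment> \<open>By duality this is the inequality between the two heights.\<close>
  have le: "2 * int d - k \<le> 2 * n_cut k" if "0 \<le> k" "k \<le> 2 * int d" for k
    using r_cut_n_cut[OF that] r_cut_le_n_cut[OF that(1)] by linarith
  have n0: "n_cut 0 = int d" using r_cut_n_cut[of 0] r_cut_0 by simp
  have n1: "n_cut 1 = int d" using le[of 1] n_cut_step[of 0] n0 assms(2) by auto
  have ntop: "n_cut (2 * int d) = 0" using n_cut_top by simp
  have nlast: "n_cut (2 * int d - 1) = 1"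
    using le[of "2 * int d - 1"] n_cut_step[of "2 * int d - 1"] ntop assms(2) by auto
  have all: "single4 # ?w @ [pair34] = map ?f [0..<2 * d]"
  proof -
    have "[0..<2 * d] = 0 # map Suc [0..<2 * d - 2] @ [2 * d - 1]"
    proof -
      have "2 * d = Suc (Suc (2 * d - 2))" using assms(2) by simp
      then have "[0..<2 * d] = [0..<Suc (Suc (2 * d - 2))]" by simp
      also have "\<dots> = [0..<Suc (2 * d - 2)] @ [Suc (2 * d - 2)]" by simp
      also have "[0..<Suc (2 * d - 2)] = 0 # map Suc [0..<2 * d - 2]" by (simp only: upt_conv_Cons[OF zero_less_Suc] map_Suc_upt)
      finally show ?thesis using assms(2) by (simp add: Suc_diff_Suc numeral_2_eq_2)
    qed
    moreover have "int (2 * d - 1) = 2 * int d - 1" using assms(2) by auto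
    ultimately show ?thesis using n0 n1 nlast ntop by (simp add: vertical_letters_eq o_def)
  qed
  have "map (\<lambda>i. vertical_letters (1 + int i)) [0..<2 * d - 1] = ?w @ [pair34]"
  proof -
    have "2 * d - 1 = Suc (2 * d - 2)" using assms(2) by simp
    then have "[0..<2 * d - 1] = [0..<2 * d - 2] @ [2 * d - 2]" by simp
    moreover have "1 + int (2 * d - 2) = 2 * int d - 1" using assms(2) by auto
    ultimately show ?thesis using nlast ntop by (simp add: vertical_letters_eq)
  qed
  moreover have "mset ?w = replicate_mset (d - 1) single4 + replicate_mset (d - 1) pair34"
  proof -
    have e: "1 + int (2 * d - 2) = 2 * int d - 1" using assms(2) by auto
    have "nat (int d - 1) = d - 1" "2 * d - 2 - (d - 1) = d - 1" using assms(2) by auto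
    then show ?thesis
      using mset_drop_word[of n_cut 1 pair34 single4 "2 * d - 2", OF n_cut_step] n1 nlast unfolding e
      by (simp add: vertical_letters_eq add.commute)
  qed
  moreover have "yamanouchi single4 pair34 (single4 # ?w @ [pair34])"
    unfolding yamanouchi_def
  proof (intro allI impI)
    fix j assume "j \<le> length (single4 # ?w @ [pair34])"
    then have j: "j \<le> 2 * d" unfolding all by simp
    have t: "take j (single4 # ?w @ [pair34]) = map ?f [0..<j]" unfolding all using j by (simp add: take_map take_upt)
    have m: "mset (map ?f [0..<j]) = replicate_mset (nat (int d - n_cut (int j))) pair34 +
        replicate_mset (j - nat (int d - n_cut (int j))) single4"
      using mset_drop_word[of n_cut 0 pair34 single4 j, OF n_cut_step] n0 by (simp add: vertical_letters_eq)
    have "2 * int d - int j \<le> 2 * n_cut (int j)" using le[of "int j"] j by simp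
    then show "count_list (take j (single4 # ?w @ [pair34])) pair34 \<le> count_list (take j (single4 # ?w @ [pair34])) single4"
      unfolding t count_list_mset m by simp
  qed
  ultimately show ?thesis
    unfolding TSSCPP_word TSSCPP_words_def mem_Collect_eq by (intro exI[of _ ?w]) simp
qed

text \<open>Profiles of self-complementary partitions. The order ideal of \<open>cube_profile\<close> need not be
  self-complementary, but no two of its points are complementary (\<open>inside_clash\<close>), so it can be
  completed.\<close>

locale self_dual_profile = cube_profile "2 * d" n r for d :: nat and n r +
  assumes dual: "\<And>t. 0 \<le> t \<Longrightarrow> t \<le> 2 * int d \<Longrightarrow> n t + r t = 2 * int d - t"
begin

abbreviation coinside :: "int \<Rightarrow> int \<Rightarrow> int \<Rightarrow> bool" where
  "coinside x y z \<equiv> inside (2 * int d + 1 - x) (2 * int d + 1 - y) (2 * int d + 1 - z)"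

lemma n_le: "0 \<le> t \<Longrightarrow> n t \<le> int d"
  using n_drops[of 0 t] dual[of 0] r_0 by simp

lemma r_le: "0 \<le> t \<Longrightarrow> r t \<le> int d"
  using r_le_n n_le order_trans by blast

lemma under_n_cases:
  assumes "under_n x y z" "1 \<le> y"
  obtains t where "0 \<le> t" "t \<le> 2 * int d" "x \<le> n t + t" "y \<le> n t" "z \<le> n t"
proof -
  obtain t where t: "0 \<le> t" "x \<le> n t + t" "y \<le> n t" "z \<le> n t" using assms(1) by (auto simp: under_n_def)
  moreover have "t \<le> 2 * int d" using n_drops[of "2 * int d" t] n_end t assms(2) by (cases "2 * int d \<le> t") auto
  ultimately show thesis using that by blast
qed

lemma under_r_cases:
  assumes "under_r x y z" "1 \<le> z"
  obtains t where "0 \<le> t" "t \<le> 2 * int d" "x \<le> r t + t" "y \<le> r t + t" "z \<le> r t"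
proof -
  obtain t where t: "0 \<le> t" "x \<le> r t + t" "y \<le> r t + t" "z \<le> r t" using assms(1) by (auto simp: under_r_def)
  moreover have "t \<le> 2 * int d" using r_drops[of "2 * int d" t] r_end t assms(2) by (cases "2 * int d \<le> t") auto
  ultimately show thesis using that by blast
qed

text \<open>This and the next two lemmas exclude that two generators cover complementary points, that is,
  points whose coordinates add up to 2 d + 1. The kinds of the two generators and the places of
  their great coordinates lead to three cases. By duality r s + s is 2 d - n s, and the
  assumptions become contradictory bounds.\<close>

lemma clash_nn:
  assumes "0 \<le> s" "0 \<le> t" "2 * int d + 1 \<le> n s + n t"
  shows False
  using n_le[OF assms(1)] n_le[OF assms(2)] assms(3) by linarith

lemma clash_nr:
  assumes "0 \<le> s" "0 \<le> t" "s \<le> 2 * int d" "2 * int d + 1 \<le> n t + (r s + s)" "2 * int d + 1 \<le> (n t + t) + r s"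
  shows False
  using dual[OF assms(1,3)] n_drops[of s t] n_drops[of t s] assms(4,5) by linarith

lemma clash_rr:
  assumes "0 \<le> s" "0 \<le> t" "s \<le> 2 * int d" "t \<le> 2 * int d"
    "2 * int d + 1 \<le> r t + (r s + s)" "2 * int d + 1 \<le> (r t + t) + r s"
  shows False
  using dual[OF assms(1,3)] dual[OF assms(2,4)] r_le_n[OF assms(1)] r_le_n[OF assms(2)] assms(5,6) by linarith

lemma under_n_clash:
  assumes "under_n x y z" "inside x' y' z'" "1 \<le> y" "1 \<le> x'" "1 \<le> y'" "1 \<le> z'"
    and sum: "x + x' = 2 * int d + 1" "y + y' = 2 * int d + 1" "z + z' = 2 * int d + 1"
  shows False
proof -
  obtain t where t: "0 \<le> t" "t \<le> 2 * int d" "x \<le> n t + t" "y \<le> n t" "z \<le> n t"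
    using under_n_cases[OF assms(1,3)] by blast
  have short: False if "0 \<le> s" "y' \<le> n s \<or> z' \<le> n s" for s
    using clash_nn[of s t] t that sum by linarith
  have short': False if "0 \<le> s" "y' \<le> r s \<or> z' \<le> r s" for s
    using short[of s] r_le_n[of s] that by linarith
  from assms(2) consider "under_n x' y' z'" | "under_n y' z' x'" | "under_n z' x' y'"
    | "under_r x' y' z'" | "under_r y' z' x'" | "under_r z' x' y'" unfolding inside_def by blast
  then show False
  proof cases
    case 5
    then obtain s where "0 \<le> s" "s \<le> 2 * int d" "y' \<le> r s + s" "z' \<le> r s + s" "x' \<le> r s"
      using under_r_cases[OF _ assms(4)] by blast
    then show False using clash_nr[of s t] t sum by linarith
  next
    case 1
    then show False using short unfolding under_n_def by metis
  next
    case 2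
    then show False using short unfolding under_n_def by metis
  next
    case 3
    then show False using short unfolding under_n_def by metis
  next
    case 4
    then show False using short' unfolding under_r_def by metis
  next
    case 6
    then show False using short' unfolding under_r_def by metis
  qed
qed

lemma under_r_clash:
  assumes "under_r x y z" "1 \<le> z" "1 \<le> x'" "1 \<le> y'" "1 \<le> z'"
    and "under_r x' y' z' \<or> under_r y' z' x' \<or> under_r z' x' y'"
    and sum: "x + x' = 2 * int d + 1" "y + y' = 2 * int d + 1" "z + z' = 2 * int d + 1"
  shows False
proof -
  obtain t where t: "0 \<le> t" "t \<le> 2 * int d" "x \<le> r t + t" "y \<le> r t + t" "z \<le> r t"
    using under_r_cases[OF assms(1,2)] by blast
  consider "under_r x' y' z'" | "under_r y' z' x'" | "under_r z' x' y'" using assms(6) by blast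
  then show False
  proof cases
    case 1
    then obtain s where "0 \<le> s" "z' \<le> r s" using under_r_cases[OF _ assms(5)] by blast
    then show False using r_le[of s] r_le[of t] t sum by linarith
  next
    case 2
    then obtain s where "0 \<le> s" "s \<le> 2 * int d" "y' \<le> r s + s" "z' \<le> r s + s" "x' \<le> r s"
      using under_r_cases[OF _ assms(3)] by blast
    then show False using clash_rr[of s t] t sum by linarith
  next
    case 3
    then obtain s where "0 \<le> s" "s \<le> 2 * int d" "z' \<le> r s + s" "x' \<le> r s + s" "y' \<le> r s"
      using under_r_cases[OF _ assms(4)] by blast
    then show False using clash_rr[of s t] t sum by linarith
  qed
qed

lemma inside_clash:
  assumes "inside x y z" "inside x' y' z'" and pos: "1 \<le> x" "1 \<le> y" "1 \<le> z" "1 \<le> x'" "1 \<le> y'" "1 \<le> z'"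
    and sum: "x + x' = 2 * int d + 1" "y + y' = 2 * int d + 1" "z + z' = 2 * int d + 1"
  shows False
proof -
  note rot = inside_rotate[of x y z] inside_rotate[of z x y] inside_rotate[of x' y' z'] inside_rotate[of z' x' y']
  have sum': "x' + x = 2 * int d + 1" "y' + y = 2 * int d + 1" "z' + z = 2 * int d + 1" using sum by simp_all
  have n: "\<not> under_n x y z" "\<not> under_n y z x" "\<not> under_n z x y"
    using under_n_clash[of x y z x' y' z'] under_n_clash[of y z x y' z' x'] under_n_clash[of z x y z' x' y'] assms rot by blast+
  have n': "\<not> under_n x' y' z'" "\<not> under_n y' z' x'" "\<not> under_n z' x' y'"
    using under_n_clash[of x' y' z' x y z] under_n_clash[of y' z' x' y z x] under_n_clash[of z' x' y' z x y] assms sum' rot by blast+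
  have r': "under_r x' y' z' \<or> under_r y' z' x' \<or> under_r z' x' y'" using assms(2) n' unfolding inside_def by blast
  show False
    using assms(1) n under_r_clash[of x y z x' y' z'] under_r_clash[of y z x y' z' x'] under_r_clash[of z x y z' x' y'] pos sum r'
    unfolding inside_def by blast
qed

text \<open>From each pair of complementary points that is not decided by the ideal, the one with the smaller
  coordinate sum is taken. The two sums add up to the odd number 3 (2 d + 1), so they are never
  equal.\<close>

definition completed :: pp where
  "completed = {(x, y, z). x \<in> {1..2 * d} \<and> y \<in> {1..2 * d} \<and> z \<in> {1..2 * d} \<and>
     (inside (int x) (int y) (int z) \<or>
      \<not> coinside (int x) (int y) (int z) \<and> 2 * (x + y + z) < 3 * (2 * d + 1))}"

lemma plane_partition_completed: "plane_partition (2 * d) (2 * d) (2 * d) completed"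
  unfolding plane_partition_def
proof (intro conjI allI impI)
  show "completed \<subseteq> {1..2 * d} \<times> {1..2 * d} \<times> {1..2 * d}" by (auto simp: completed_def)
  fix x y z i j k
  assume *: "(x, y, z) \<in> completed \<and> 1 \<le> i \<and> i \<le> x \<and> 1 \<le> j \<and> j \<le> y \<and> 1 \<le> k \<and> k \<le> z"
  have "inside (int x) (int y) (int z) \<Longrightarrow> inside (int i) (int j) (int k)"
    by (erule inside_mono) (use * in auto)
  moreover have "coinside (int i) (int j) (int k) \<Longrightarrow> coinside (int x) (int y) (int z)"
    by (erule inside_mono) (use * in auto)
  ultimately show "(i, j, k) \<in> completed" using * by (auto simp: completed_def)
qed

lemma completed_complement:
  assumes "i \<in> {1..2 * d}" "j \<in> {1..2 * d}" "k \<in> {1..2 * d}"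
  shows "(i, j, k) \<in> completed \<longleftrightarrow> (2 * d - i + 1, 2 * d - j + 1, 2 * d - k + 1) \<notin> completed"
proof -
  define i' j' k' where "i' = 2 * d - i + 1" and "j' = 2 * d - j + 1" and "k' = 2 * d - k + 1"
  note defs = i'_def j'_def k'_def
  have box: "i' \<in> {1..2 * d}" "j' \<in> {1..2 * d}" "k' \<in> {1..2 * d}" using assms by (auto simp: defs)
  have sum: "i + i' = 2 * d + 1" "j + j' = 2 * d + 1" "k + k' = 2 * d + 1" using assms by (auto simp: defs)
  then have int: "2 * int d + 1 - int i = int i'" "2 * int d + 1 - int j = int j'" "2 * int d + 1 - int k = int k'"
    "2 * int d + 1 - int i' = int i" "2 * int d + 1 - int j' = int j" "2 * int d + 1 - int k' = int k" by linarith+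
  have flip: "2 * (i' + j' + k') < 3 * (2 * d + 1) \<longleftrightarrow> \<not> 2 * (i + j + k) < 3 * (2 * d + 1)"
  proof -
    have "(i' + j' + k') + (i + j + k) = (i + i') + (j + j') + (k + k')" by simp
    then have "(i' + j' + k') + (i + j + k) = 3 * (2 * d + 1)" unfolding sum by simp
    moreover have "2 * u < 3 * (2 * d + 1) \<longleftrightarrow> \<not> 2 * v < 3 * (2 * d + 1)" if "u + v = 3 * (2 * d + 1)" for u v :: nat
      using that by presburger
    ultimately show ?thesis by blast
  qed
  have "\<not> (inside (int i) (int j) (int k) \<and> inside (int i') (int j') (int k'))"
  proof
    assume "inside (int i) (int j) (int k) \<and> inside (int i') (int j') (int k')"
    then have ins: "inside (int i) (int j) (int k)" "inside (int i') (int j') (int k')" by blast+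
    show False by (rule inside_clash[OF ins]) (use assms box sum in auto)
  qed
  moreover have "(i, j, k) \<in> completed \<longleftrightarrow> inside (int i) (int j) (int k) \<or>
      \<not> inside (int i') (int j') (int k') \<and> 2 * (i + j + k) < 3 * (2 * d + 1)"
    unfolding completed_def mem_Collect_eq prod.case int using assms by simp
  moreover have "(i', j', k') \<in> completed \<longleftrightarrow> inside (int i') (int j') (int k') \<or>
      \<not> inside (int i) (int j) (int k) \<and> 2 * (i' + j' + k') < 3 * (2 * d + 1)"
    unfolding completed_def mem_Collect_eq prod.case int using box by simp
  ultimately have "(i, j, k) \<in> completed \<longleftrightarrow> (i', j', k') \<notin> completed" using flip by blast
  then show ?thesis by (simp only: defs)
qed

lemma TSSCPP_completed: "completed \<in> TSSCPP (2 * d)"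
  unfolding TSSCPP_iff[OF plane_partition_completed]
proof (intro conjI allI impI ballI)
  show "(j, i, k) \<in> completed" if "(i, j, k) \<in> completed" for i j k
    using that inside_swap by (auto simp: completed_def add.commute)
  show "(i, j, k) \<in> completed \<longleftrightarrow> (k, i, j) \<in> completed" for i j k
    using inside_rotate[of "int i" "int j" "int k"] inside_rotate[of "2 * int d + 1 - int i" "2 * int d + 1 - int j" "2 * int d + 1 - int k"]
    by (auto simp: completed_def add.commute add.left_commute)
  show "(i, j, k) \<in> completed \<longleftrightarrow> (2 * d - i + 1, 2 * d - j + 1, 2 * d - k + 1) \<notin> completed"
    if "i \<in> {1..2 * d}" "j \<in> {1..2 * d}" "k \<in> {1..2 * d}" for i j k
    using completed_complement[OF that] .
qed

sublocale completed: boxed_partition "2 * d" "2 * d" "2 * d" completed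
  by unfold_locales (rule plane_partition_completed)

text \<open>The next point on the diagonal after the prescribed one is complementary to a generator of the
  ideal, by the duality of n and r, and so it is left out.\<close>

lemma n_cut_completed:
  assumes "0 \<le> t" "t \<le> 2 * int d"
  shows "completed.n_cut t = n t"
proof (rule completed.n_cut_eqI)
  let ?i = "n t"
  have b: "0 \<le> ?i" "?i \<le> 2 * int d" "?i + t \<le> 2 * int d"
    using n_nonneg n_drops[OF assms(2)] n_end assms by auto
  have "(nat ?i, nat ?i, nat (?i + t)) \<in> completed" if "1 \<le> ?i"
    using b assms that inside_n[of t ?i] by (auto simp: completed_def)
  moreover have "(nat (?i + 1), nat (?i + 1), nat (?i + t + 1)) \<notin> completed"
  proof
    assume *: "(nat (?i + 1), nat (?i + 1), nat (?i + t + 1)) \<in> completed"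
    have "\<not> inside (?i + 1) (?i + 1) (?i + 1 + t)" using inside_n[OF assms(1), of "?i + 1"] by simp
    moreover have "coinside (?i + 1) (?i + 1) (?i + t + 1)"
    proof -
      have "under_r (r t + t) (r t + t) (r t)" unfolding under_r_def using assms(1) by blast
      moreover have e: "2 * int d + 1 - (?i + 1) = r t + t" "2 * int d + 1 - (?i + t + 1) = r t" using dual[OF assms] by linarith+
      ultimately show ?thesis unfolding inside_def e by blast
    qed
    ultimately show False using * b assms by (simp add: completed_def add.commute add.left_commute)
  qed
  ultimately show "surf completed (?i, ?i, ?i + t)"
    using b assms(1) by (cases "1 \<le> ?i") (auto simp: surf_def solid_def)
qed

end

lemma TSSCPP_word_attained:
  assumes "w \<in> TSSCPP_words d" "1 \<le> d"
  shows "\<exists>p\<in>TSSCPP (2 * d). boundary_word (TSSCPP_web d p) = w"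
proof -
  obtain v where w: "w = replicate d [Plain 1] @ map (\<lambda>i. if even i then [Plain 2] else [Barred 4]) [0..<2 * d - 1] @ v @ [pair34]"
    and mv: "mset v = replicate_mset (d - 1) single4 + replicate_mset (d - 1) pair34"
    and yam: "yamanouchi single4 pair34 (single4 # v @ [pair34])"
    using assms(1) unfolding TSSCPP_words_def by blast
  define V where "V = single4 # v @ [pair34]"
  have ne: "single4 \<noteq> pair34" by simp
  have mV: "mset V = replicate_mset d single4 + replicate_mset d pair34"
    using assms(2) mv by (cases d) (simp_all add: V_def)
  note V = two_letter_words[OF mV ne]
  have len: "length V = 2 * d" using V(2) by simp
  define n where "n = tail_count pair34 V"
  define r where "r = tail_count single4 V"
  have counts: "count_list (take j V) x + count_list (drop j V) x = count_list V x" for j and x :: "letter list"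
    by (metis append_take_drop_id count_list_append)
  have total: "count_list V pair34 = d" "count_list V single4 = d" using V(3,4) by (simp_all add: count_list_mset)
  have both: "count_list xs single4 + count_list xs pair34 = length xs" if "set xs \<subseteq> {single4, pair34}" for xs
    using that by (induction xs) auto
  interpret self_dual_profile d n r
  proof
    show "r t \<le> n t" if "0 \<le> t" for t
    proof (cases "nat t \<le> length V")
      case True
      then have "count_list (take (nat t) V) pair34 \<le> count_list (take (nat t) V) single4"
        using yam unfolding yamanouchi_def V_def by blast
      then show ?thesis using counts[of "nat t" pair34] counts[of "nat t" single4] total
        unfolding n_def r_def tail_count_def by linarith
    qed (simp add: n_def r_def tail_count_def)
    show "n t + r t = 2 * int d - t" if "0 \<le> t" "t \<le> 2 * int d" for t
    proof -
      have "set (drop (nat t) V) \<subseteq> {single4, pair34}" using V(1) set_drop_subset by fast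
      from both[OF this] show ?thesis using that len by (simp add: n_def r_def tail_count_def)
    qed
    show "n t - n (t + 1) = 0 \<or> n t - n (t + 1) = 1" "r t - r (t + 1) = 0 \<or> r t - r (t + 1) = 1" for t
      unfolding n_def r_def by (rule tail_count_step')+
  qed (auto simp: n_def r_def tail_count_nonneg tail_count_0 V(3,4) len intro!: tail_count_end)
  interpret dual: self_complementary d completed
    by unfold_locales (use assms(2) TSSCPP_completed in auto)
  have "completed.vertical_letters (int i) = (if n (int i) \<noteq> n (int i + 1) then pair34 else single4)" if "i < 2 * d" for i
    using n_cut_completed[of "int i"] n_cut_completed[of "int i + 1"] that by (simp add: completed.vertical_letters_eq)
  then have "map (\<lambda>i. completed.vertical_letters (int i)) [0..<2 * d] =
    map (\<lambda>i. if n (int i) \<noteq> n (int i + 1) then pair34 else single4) [0..<length V]" using len by simp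
  also have "\<dots> = V" unfolding n_def by (rule word_from_tail_count) (use V(1) in auto)
  finally have all: "map (\<lambda>i. completed.vertical_letters (int i)) [0..<2 * d] = V" .
  have "map (\<lambda>i. completed.vertical_letters (1 + int i)) [0..<2 * d - 1] = tl (map (\<lambda>i. completed.vertical_letters (int i)) [0..<2 * d])"
  proof -
    have "[0..<2 * d] = 0 # map Suc [0..<2 * d - 1]"
      using assms(2) by (simp add: map_Suc_upt upt_conv_Cons)
    then show ?thesis by (simp add: o_def)
  qed
  also have "\<dots> = v @ [pair34]" unfolding all by (simp add: V_def)
  finally have "boundary_word (TSSCPP_web d completed) = w" unfolding dual.TSSCPP_word w by simp
  then show ?thesis using TSSCPP_completed by blast
qed

theorem theorem1p2:
  fixes a c d :: nat
  assumes "1 \<le> a" and "1 \<le> c" and "1 \<le> d"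
  shows "{boundary_word (SPP_web a c p) | p. p \<in> SPP a c} = SPP_words a c \<and>
         {boundary_word (CSPP_web a p) | p. p \<in> CSPP a} = CSPP_words a \<and>
         {boundary_word (TSPP_web a p) | p. p \<in> TSPP a} = TSPP_words a \<and>
         {boundary_word (TSSCPP_web d p) | p. p \<in> TSSCPP (2 * d)} = TSSCPP_words d"
proof (intro conjI)
  have eq: "{f p | p. p \<in> A} = B" if "\<And>p. p \<in> A \<Longrightarrow> f p \<in> B" "\<And>w. w \<in> B \<Longrightarrow> \<exists>p\<in>A. f p = w"
    for f :: "pp \<Rightarrow> letter list list" and A B
    using that by blast
  show "{boundary_word (SPP_web a c p) | p. p \<in> SPP a c} = SPP_words a c"
    by (rule eq) (use SPP_word_in SPP_word_attained assms in auto)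
  show "{boundary_word (CSPP_web a p) | p. p \<in> CSPP a} = CSPP_words a"
    by (rule eq) (use CSPP_word_in CSPP_word_attained assms in auto)
  show "{boundary_word (TSPP_web a p) | p. p \<in> TSPP a} = TSPP_words a"
    by (rule eq) (use TSPP_word_in TSPP_word_attained assms in auto)
  show "{boundary_word (TSSCPP_web d p) | p. p \<in> TSSCPP (2 * d)} = TSSCPP_words d"
    by (rule eq) (use TSSCPP_word_in TSSCPP_word_attained assms in auto)
qed

end
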